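(* $\mathsf{RCA}_0 \vdash \mathsf{TS}(2) \rightarrow \mathsf{RRT}^2_2$. That is, over $\mathsf{RCA}_0$, the thin set theorem for pairs implies the rainbow Ramsey theorem for pairs (and 2-bounded colorings).
   Context: $\mathsf{RCA}_0$ is the usual base system of reverse mathematics (second-order arithmetic with $\Delta^0_1$-comprehension and $\Sigma^0_1$-induction). $[\mathbb{N}]^n$ denotes the set of $n$-element subsets of $\mathbb{N}$, identified with strictly increasing $n$-tuples; $[A]^n$ is defined similarly for $A\subseteq\mathbb{N}$. Thin set theorem: for $f:[\mathbb{N}]^2\to\mathbb{N}$, a set $A$ is thin for $f$ if $f([A]^2)\neq\mathbb{N}$. $\mathsf{TS}(2)$ is the statement "every function $f:[\mathbb{N}]^2\to\mathbb{N}$ has an infinite set thin for $f$". Rainbow Ramsey theorem: $f:[\mathbb{N}]^2\to\mathbb{N}$ is 2-bounded if $|f^{-1}(y)|\le 2$ for every $y\in\mathbb{N}$. A set $R$ is a rainbow for $f$ if $f$ is injective on $[R]^2$. $\mathsf{RRT}^2_2$ is the statement "every 2-bounded function $f:[\mathbb{N}]^2\to\mathbb{N}$ has an infinite rainbow". *)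

theory Defs
  imports Main
begin

section \<open>The language of second-order arithmetic\<close>

text \<open>
  Formulas use de Bruijn indices, with two independent families of variables: numbers
  (quantified by \<open>AllN\<close>, occurring in terms as \<open>V n\<close>) and sets (quantified by \<open>AllS\<close>, occurring
  only on the right of the membership symbol). Equality is primitive for numbers only.
\<close>

datatype tm = V nat | Zero | One | Add tm tm (infixl "\<^bold>+" 75) | Mul tm tm (infixl "\<^bold>*" 77)

datatype fm =
    Falsum ("\<^bold>\<bottom>")
  | Eq tm tm (infix "\<^bold>=" 70)
  | Less tm tm (infix "\<^bold><" 70)
  | Mem tm nat (infix "\<^bold>\<in>" 70)
  | Imp fm fm (infixr "\<^bold>\<longrightarrow>" 55)
  | AllN fm
  | AllS fm

abbreviation Neg ("\<^bold>\<not> _" [68] 68) where "\<^bold>\<not> p \<equiv> p \<^bold>\<longrightarrow> \<^bold>\<bottom>"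
abbreviation Disj (infixr "\<^bold>\<or>" 60) where "p \<^bold>\<or> q \<equiv> \<^bold>\<not> p \<^bold>\<longrightarrow> q"
abbreviation Conj (infixr "\<^bold>\<and>" 65) where "p \<^bold>\<and> q \<equiv> \<^bold>\<not> (p \<^bold>\<longrightarrow> \<^bold>\<not> q)"
abbreviation Iff (infix "\<^bold>\<longleftrightarrow>" 54) where "p \<^bold>\<longleftrightarrow> q \<equiv> (p \<^bold>\<longrightarrow> q) \<^bold>\<and> (q \<^bold>\<longrightarrow> p)"
abbreviation ExN where "ExN p \<equiv> \<^bold>\<not> AllN (\<^bold>\<not> p)"
abbreviation ExS where "ExS p \<equiv> \<^bold>\<not> AllS (\<^bold>\<not> p)"

text \<open>
  Simultaneous capture-avoiding substitution: \<open>\<sigma>\<close> maps number variables to terms and \<open>\<tau>\<close> maps set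
  variables to set variables (there are no other set terms).
\<close>

primrec subst_tm :: "(nat \<Rightarrow> tm) \<Rightarrow> tm \<Rightarrow> tm" where
  "subst_tm \<sigma> (V n) = \<sigma> n"
| "subst_tm \<sigma> Zero = Zero"
| "subst_tm \<sigma> One = One"
| "subst_tm \<sigma> (s \<^bold>+ t) = subst_tm \<sigma> s \<^bold>+ subst_tm \<sigma> t"
| "subst_tm \<sigma> (s \<^bold>* t) = subst_tm \<sigma> s \<^bold>* subst_tm \<sigma> t"

definition lift_tm :: "tm \<Rightarrow> tm" where
  "lift_tm = subst_tm (\<lambda>n. V (Suc n))"

primrec subst :: "(nat \<Rightarrow> tm) \<Rightarrow> (nat \<Rightarrow> nat) \<Rightarrow> fm \<Rightarrow> fm" where
  "subst \<sigma> \<tau> \<^bold>\<bottom> = \<^bold>\<bottom>"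
| "subst \<sigma> \<tau> (s \<^bold>= t) = (subst_tm \<sigma> s \<^bold>= subst_tm \<sigma> t)"
| "subst \<sigma> \<tau> (s \<^bold>< t) = (subst_tm \<sigma> s \<^bold>< subst_tm \<sigma> t)"
| "subst \<sigma> \<tau> (t \<^bold>\<in> X) = (subst_tm \<sigma> t \<^bold>\<in> \<tau> X)"
| "subst \<sigma> \<tau> (p \<^bold>\<longrightarrow> q) = (subst \<sigma> \<tau> p \<^bold>\<longrightarrow> subst \<sigma> \<tau> q)"
| "subst \<sigma> \<tau> (AllN p) = AllN (subst (case_nat (V 0) (\<lambda>n. lift_tm (\<sigma> n))) \<tau> p)"
| "subst \<sigma> \<tau> (AllS p) = AllS (subst \<sigma> (case_nat 0 (\<lambda>X. Suc (\<tau> X))) p)"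

definition lift_num :: "fm \<Rightarrow> fm" where
  "lift_num = subst (\<lambda>n. V (Suc n)) id"

definition lift_set :: "fm \<Rightarrow> fm" where
  "lift_set = subst V Suc"

definition inst_num :: "tm \<Rightarrow> fm \<Rightarrow> fm" where
  "inst_num t = subst (case_nat t V) id"

definition inst_set :: "nat \<Rightarrow> fm \<Rightarrow> fm" where
  "inst_set X = subst V (case_nat X id)"

primrec bounded_tm :: "nat \<Rightarrow> tm \<Rightarrow> bool" where
  "bounded_tm m (V n) \<longleftrightarrow> n < m"
| "bounded_tm m Zero \<longleftrightarrow> True"
| "bounded_tm m One \<longleftrightarrow> True"
| "bounded_tm m (s \<^bold>+ t) \<longleftrightarrow> bounded_tm m s \<and> bounded_tm m t"
| "bounded_tm m (s \<^bold>* t) \<longleftrightarrow> bounded_tm m s \<and> bounded_tm m t"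

text \<open>
  \<open>bounded m k p\<close>: all free number variables of \<open>p\<close> are below \<open>m\<close> and all its free set variables are
  below \<open>k\<close>. Sentences are the formulas with \<open>bounded 0 0 p\<close>.
\<close>

primrec bounded :: "nat \<Rightarrow> nat \<Rightarrow> fm \<Rightarrow> bool" where
  "bounded m k \<^bold>\<bottom> \<longleftrightarrow> True"
| "bounded m k (s \<^bold>= t) \<longleftrightarrow> bounded_tm m s \<and> bounded_tm m t"
| "bounded m k (s \<^bold>< t) \<longleftrightarrow> bounded_tm m s \<and> bounded_tm m t"
| "bounded m k (t \<^bold>\<in> X) \<longleftrightarrow> bounded_tm m t \<and> X < k"
| "bounded m k (p \<^bold>\<longrightarrow> q) \<longleftrightarrow> bounded m k p \<and> bounded m k q"
| "bounded m k (AllN p) \<longleftrightarrow> bounded (Suc m) k p"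
| "bounded m k (AllS p) \<longleftrightarrow> bounded m (Suc k) p"

definition univ_closures :: "fm set \<Rightarrow> fm set" where
  "univ_closures A = {(AllS ^^ k) ((AllN ^^ m) p) | p m k. p \<in> A \<and> bounded m k p}"


section \<open>Provability\<close>

text \<open>
  Natural deduction for classical two-sorted first-order logic with equality on numbers.
  \<open>\<Gamma>\<close> may be infinite. Lifting \<open>\<Gamma>\<close> in the two generalisation rules makes index 0 fresh, which is
  the eigenvariable condition.
\<close>

inductive proves :: "fm set \<Rightarrow> fm \<Rightarrow> bool" (infix "\<turnstile>" 50) where
  Assm: "p \<in> \<Gamma> \<Longrightarrow> \<Gamma> \<turnstile> p"
| ImpI: "insert p \<Gamma> \<turnstile> q \<Longrightarrow> \<Gamma> \<turnstile> p \<^bold>\<longrightarrow> q"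
| ImpE: "\<Gamma> \<turnstile> p \<^bold>\<longrightarrow> q \<Longrightarrow> \<Gamma> \<turnstile> p \<Longrightarrow> \<Gamma> \<turnstile> q"
| Classical: "insert (\<^bold>\<not> p) \<Gamma> \<turnstile> \<^bold>\<bottom> \<Longrightarrow> \<Gamma> \<turnstile> p"
| AllNI: "lift_num ` \<Gamma> \<turnstile> p \<Longrightarrow> \<Gamma> \<turnstile> AllN p"
| AllNE: "\<Gamma> \<turnstile> AllN p \<Longrightarrow> \<Gamma> \<turnstile> inst_num t p"
| AllSI: "lift_set ` \<Gamma> \<turnstile> p \<Longrightarrow> \<Gamma> \<turnstile> AllS p"
| AllSE: "\<Gamma> \<turnstile> AllS p \<Longrightarrow> \<Gamma> \<turnstile> inst_set X p"
| EqI: "\<Gamma> \<turnstile> t \<^bold>= t"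
| EqE: "\<Gamma> \<turnstile> s \<^bold>= t \<Longrightarrow> \<Gamma> \<turnstile> inst_num s p \<Longrightarrow> \<Gamma> \<turnstile> inst_num t p"


section \<open>The system RCA\<open>\<^sub>0\<close>\<close>

text \<open>Applying \<open>lift_tm\<close> to the bound expresses that it does not contain the quantified variable.\<close>

inductive_set Delta00 :: "fm set" where
  "\<^bold>\<bottom> \<in> Delta00"
| "(s \<^bold>= t) \<in> Delta00"
| "(s \<^bold>< t) \<in> Delta00"
| "(t \<^bold>\<in> X) \<in> Delta00"
| "p \<in> Delta00 \<Longrightarrow> q \<in> Delta00 \<Longrightarrow> (p \<^bold>\<longrightarrow> q) \<in> Delta00"
| "p \<in> Delta00 \<Longrightarrow> AllN (V 0 \<^bold>< lift_tm t \<^bold>\<longrightarrow> p) \<in> Delta00"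
| "p \<in> Delta00 \<Longrightarrow> ExN (V 0 \<^bold>< lift_tm t \<^bold>\<and> p) \<in> Delta00"

definition Sigma01 :: "fm set" where
  "Sigma01 = {ExN p | p. p \<in> Delta00}"

definition Pi01 :: "fm set" where
  "Pi01 = {AllN p | p. p \<in> Delta00}"

definition basic_axioms :: "fm set" where
  "basic_axioms =
    {\<^bold>\<not> (V 0 \<^bold>+ One \<^bold>= Zero),
     V 0 \<^bold>+ One \<^bold>= V 1 \<^bold>+ One \<^bold>\<longrightarrow> V 0 \<^bold>= V 1,
     V 0 \<^bold>+ Zero \<^bold>= V 0,
     V 0 \<^bold>+ (V 1 \<^bold>+ One) \<^bold>= (V 0 \<^bold>+ V 1) \<^bold>+ One,
     V 0 \<^bold>* Zero \<^bold>= Zero,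
     V 0 \<^bold>* (V 1 \<^bold>+ One) \<^bold>= V 0 \<^bold>* V 1 \<^bold>+ V 0,
     \<^bold>\<not> (V 0 \<^bold>< Zero),
     V 0 \<^bold>< V 1 \<^bold>+ One \<^bold>\<longleftrightarrow> V 0 \<^bold>< V 1 \<^bold>\<or> V 0 \<^bold>= V 1}"

text \<open>
  In both schemes the distinguished number variable of the given formulas is index 0; all other free
  variables are number and set parameters.
\<close>

definition Sigma01_induction :: "fm set" where
  "Sigma01_induction =
    {inst_num Zero p \<^bold>\<and> AllN (p \<^bold>\<longrightarrow> subst (case_nat (V 0 \<^bold>+ One) (\<lambda>n. V (Suc n))) id p) \<^bold>\<longrightarrow> AllN p
      | p. p \<in> Sigma01}"

definition Delta01_comprehension :: "fm set" where
  "Delta01_comprehension =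
    {AllN (p \<^bold>\<longleftrightarrow> q) \<^bold>\<longrightarrow> ExS (AllN (V 0 \<^bold>\<in> 0 \<^bold>\<longleftrightarrow> lift_set p))
      | p q. p \<in> Sigma01 \<and> q \<in> Pi01}"

definition RCA0 :: "fm set" where
  "RCA0 = univ_closures (basic_axioms \<union> Sigma01_induction \<union> Delta01_comprehension)"


section \<open>The thin set and rainbow Ramsey theorems\<close>

text \<open>
  The standard pairing \<open>(m + n)\<^sup>2 + m\<close>, provably injective in RCA\<open>\<^sub>0\<close>. An element \<open>x < y\<close> of
  \<open>[\<nat>]\<^sup>2\<close> is coded as \<open>\<langle>x, y\<rangle>\<close>, and a function \<open>f : [\<nat>]\<^sup>2 \<rightarrow> \<nat>\<close> as the set of all
  \<open>\<langle>\<langle>x, y\<rangle>, f(x, y)\<rangle>\<close>. The arguments \<open>F\<close>, \<open>A\<close>, \<open>R\<close> below are free set variables.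
\<close>

definition pair :: "tm \<Rightarrow> tm \<Rightarrow> tm" ("\<^bold>\<langle>_, _\<^bold>\<rangle>") where
  "\<^bold>\<langle>s, t\<^bold>\<rangle> = (s \<^bold>+ t) \<^bold>* (s \<^bold>+ t) \<^bold>+ s"

text \<open>
  \<open>\<forall>e \<in> F. \<exists>x y z. x < y \<and> e = \<langle>\<langle>x, y\<rangle>, z\<rangle>\<close>;
  \<open>\<forall>x y. x < y \<longrightarrow> (\<exists>z. \<langle>\<langle>x, y\<rangle>, z\<rangle> \<in> F)\<close>;
  \<open>\<forall>p z w. \<langle>p, z\<rangle> \<in> F \<and> \<langle>p, w\<rangle> \<in> F \<longrightarrow> z = w\<close>.
\<close>

definition is_function :: "nat \<Rightarrow> fm" where
  "is_function F =
    (AllN (V 0 \<^bold>\<in> F \<^bold>\<longrightarrow>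
       ExN (ExN (ExN (V 2 \<^bold>< V 1 \<^bold>\<and> V 3 \<^bold>= \<^bold>\<langle>\<^bold>\<langle>V 2, V 1\<^bold>\<rangle>, V 0\<^bold>\<rangle>))))
     \<^bold>\<and> AllN (AllN (V 1 \<^bold>< V 0 \<^bold>\<longrightarrow> ExN (\<^bold>\<langle>\<^bold>\<langle>V 2, V 1\<^bold>\<rangle>, V 0\<^bold>\<rangle> \<^bold>\<in> F)))
     \<^bold>\<and> AllN (AllN (AllN (\<^bold>\<langle>V 2, V 1\<^bold>\<rangle> \<^bold>\<in> F \<^bold>\<and> \<^bold>\<langle>V 2, V 0\<^bold>\<rangle> \<^bold>\<in> F \<^bold>\<longrightarrow> V 1 \<^bold>= V 0))))"

text \<open>\<open>\<forall>n. \<exists>x. n < x \<and> x \<in> A\<close>.\<close>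

definition is_infinite :: "nat \<Rightarrow> fm" where
  "is_infinite A = AllN (ExN (V 1 \<^bold>< V 0 \<^bold>\<and> V 0 \<^bold>\<in> A))"

text \<open>\<open>\<not> (\<forall>z. \<exists>x y. x \<in> A \<and> y \<in> A \<and> x < y \<and> \<langle>\<langle>x, y\<rangle>, z\<rangle> \<in> F)\<close>.\<close>

definition is_thin :: "nat \<Rightarrow> nat \<Rightarrow> fm" where
  "is_thin F A =
    \<^bold>\<not> AllN (ExN (ExN
      (V 1 \<^bold>\<in> A \<^bold>\<and> V 0 \<^bold>\<in> A \<^bold>\<and> V 1 \<^bold>< V 0 \<^bold>\<and> \<^bold>\<langle>\<^bold>\<langle>V 1, V 0\<^bold>\<rangle>, V 2\<^bold>\<rangle> \<^bold>\<in> F)))"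

text \<open>
  No value \<open>z\<close> has three distinct preimages: for all (codes of pairs) \<open>p\<close>, \<open>q\<close>, \<open>r\<close> and all \<open>z\<close>,
  \<open>\<langle>p, z\<rangle> \<in> F \<and> \<langle>q, z\<rangle> \<in> F \<and> \<langle>r, z\<rangle> \<in> F \<longrightarrow> p = q \<or> p = r \<or> q = r\<close>.
\<close>

definition is_2_bounded :: "nat \<Rightarrow> fm" where
  "is_2_bounded F =
    AllN (AllN (AllN (AllN
      (\<^bold>\<langle>V 3, V 0\<^bold>\<rangle> \<^bold>\<in> F \<^bold>\<and> \<^bold>\<langle>V 2, V 0\<^bold>\<rangle> \<^bold>\<in> F \<^bold>\<and> \<^bold>\<langle>V 1, V 0\<^bold>\<rangle> \<^bold>\<in> F
        \<^bold>\<longrightarrow> V 3 \<^bold>= V 2 \<^bold>\<or> V 3 \<^bold>= V 1 \<^bold>\<or> V 2 \<^bold>= V 1))))"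

text \<open>
  For all \<open>x < y\<close> and \<open>u < v\<close> in \<open>R\<close> and all \<open>z\<close>,
  \<open>\<langle>\<langle>x, y\<rangle>, z\<rangle> \<in> F \<and> \<langle>\<langle>u, v\<rangle>, z\<rangle> \<in> F \<longrightarrow> x = u \<and> y = v\<close>.
\<close>

definition is_rainbow :: "nat \<Rightarrow> nat \<Rightarrow> fm" where
  "is_rainbow F R =
    AllN (AllN (AllN (AllN (AllN
      (V 4 \<^bold>\<in> R \<^bold>\<and> V 3 \<^bold>\<in> R \<^bold>\<and> V 4 \<^bold>< V 3 \<^bold>\<and> V 2 \<^bold>\<in> R \<^bold>\<and> V 1 \<^bold>\<in> R \<^bold>\<and> V 2 \<^bold>< V 1
        \<^bold>\<and> \<^bold>\<langle>\<^bold>\<langle>V 4, V 3\<^bold>\<rangle>, V 0\<^bold>\<rangle> \<^bold>\<in> F \<^bold>\<and> \<^bold>\<langle>\<^bold>\<langle>V 2, V 1\<^bold>\<rangle>, V 0\<^bold>\<rangle> \<^bold>\<in> F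
        \<^bold>\<longrightarrow> V 4 \<^bold>= V 2 \<^bold>\<and> V 3 \<^bold>= V 1)))))"

definition TS2 :: fm where
  "TS2 = AllS (is_function 0 \<^bold>\<longrightarrow> ExS (is_infinite 0 \<^bold>\<and> is_thin 1 0))"

definition RRT22 :: fm where
  "RRT22 = AllS (is_function 0 \<^bold>\<and> is_2_bounded 0 \<^bold>\<longrightarrow> ExS (is_infinite 0 \<^bold>\<and> is_rainbow 1 0))"

end

theory Submission
  imports Defs "HOL-Library.Countable"
begin

text \<open>
  By completeness it suffices to work in a term model of \<open>RCA0\<close>. Let \<open>f\<close> be a 2-bounded coloring of pairs.
  Numbers are grouped into finite blocks \<open>B a\<close> which are homogeneous: whether \<open>f(u, v) = f(x, v)\<close> or
  \<open>f(u, v) = f(x, y)\<close> does not depend on the choice of \<open>v\<close> in \<open>B a\<close> when \<open>u, x, y\<close> lie in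
  earlier blocks. The element \<open>B a z\<close> stands for the finite set coded by \<open>z < a\<close>. As \<open>f\<close> is 2-bounded, every
  \<open>u\<close> has at most one later partner \<open>B b z\<close> with \<open>f(u, v) = f(B b z, v)\<close> on \<open>B a\<close>. The
  auxiliary coloring \<open>g\<close> is defined so that, for every color \<open>c\<close>, some element \<open>d\<close> of the set coded by \<open>z\<close>
  gets \<open>g(d, a) = c\<close>, provided this set is large compared with \<open>\<langle>u, c\<rangle>\<close>; large sets make it possible to serve
  all requirements \<open>\<langle>u, c\<rangle>\<close> simultaneously. If \<open>A\<close> is thin for \<open>g\<close>, omitting the color \<open>c\<close>, then
  elements \<open>B a z\<close> with \<open>a\<close> in \<open>A\<close> and \<open>z\<close> coding a large subset of \<open>A\<close> are never partners, so they
  form a rainbow. No limits are taken, hence \<open>\<Sigma>\<^sub>1\<close> induction is enough.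
\<close>

section \<open>Substitution\<close>

text \<open>The thin set A, and with it the elements \<open>B a z\<close> of the rainbow, are known
  only after \<open>g\<close> is fixed. So \<open>g\<close> can react to a partner at stage a only
  if all elements of block a have the same one: this is the purpose of homogeneity. It also excludes
  collisions f(u, v) = f(x, y) with y below the block of v, since they would persist through the
  block and give three pairs of one color. What remains are collisions f(u, v) = f(x, v). Here
  \<open>g\<close> has to know where to put color c, and it reads this off the partner itself: x =
  \<open>B b z\<close> carries in its index z a finite set of candidates, so the partner of u names
  the set in which c must appear. The color that A omits is unknown beforehand, hence every pair of
  a number u and a color c is a requirement. The one with code k asks for k + 1 candidates because
  up to k requirements choose before it and each can block one candidate. The rainbow is then built
  by always taking z as a code of a subset of A that is large enough for all earlier elements and
  the omitted color.\<close>

abbreviation up :: "(nat \<Rightarrow> tm) \<Rightarrow> nat \<Rightarrow> tm" where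
  "up \<sigma> \<equiv> case_nat (V 0) (\<lambda>n. lift_tm (\<sigma> n))"

abbreviation up_set :: "(nat \<Rightarrow> nat) \<Rightarrow> nat \<Rightarrow> nat" where
  "up_set \<tau> \<equiv> case_nat 0 (\<lambda>X. Suc (\<tau> X))"

lemma subst_tm_subst_tm:
  "subst_tm \<sigma>' (subst_tm \<sigma> t) = subst_tm (\<lambda>n. subst_tm \<sigma>' (\<sigma> n)) t"
  by (induction t) auto

lemma up_subst_tm: "subst_tm (up \<sigma>') (up \<sigma> n) = up (\<lambda>n. subst_tm \<sigma>' (\<sigma> n)) n"
  by (cases n) (simp_all add: lift_tm_def subst_tm_subst_tm)

text \<open>Lifting and instantiation are both instances of the simultaneous substitution, so this
  single composition law yields all commutation facts below.\<close>

lemma subst_subst: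
  "subst \<sigma>' \<tau>' (subst \<sigma> \<tau> p) = subst (\<lambda>n. subst_tm \<sigma>' (\<sigma> n)) (\<lambda>X. \<tau>' (\<tau> X)) p"
proof (induction p arbitrary: \<sigma> \<sigma>' \<tau> \<tau>')
  case (AllS p)
  have "(\<lambda>X. up_set \<tau>' (up_set \<tau> X)) = up_set (\<lambda>X. \<tau>' (\<tau> X))"
    by (auto split: nat.split)
  then show ?case using AllS by simp
qed (simp_all add: subst_tm_subst_tm up_subst_tm)

lemma subst_tm_V: "subst_tm V t = t"
  by (induction t) auto

lemma up_V: "up V = V"
  by (auto simp: lift_tm_def split: nat.split)

lemma up_set_id: "up_set id = id" "up_set (\<lambda>X. X) = id"
  by (auto split: nat.split)

lemma subst_id: "subst V id p = p"
  by (induction p) (simp_all add: subst_tm_V up_V up_set_id id_def)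

lemma subst_lift_num: "subst (up \<sigma>) \<tau> (lift_num p) = lift_num (subst \<sigma> \<tau> p)"
  by (simp add: lift_num_def subst_subst lift_tm_def)

lemma subst_lift_set: "subst \<sigma> (up_set \<tau>) (lift_set p) = lift_set (subst \<sigma> \<tau> p)"
  by (simp add: lift_set_def subst_subst subst_tm_V)

lemma inst_num_subst: "inst_num t (subst (up \<sigma>) \<tau> p) = subst (case_nat t \<sigma>) \<tau> p"
proof -
  have "(\<lambda>n. subst_tm (case_nat t V) (up \<sigma> n)) = case_nat t \<sigma>"
    by (auto simp: lift_tm_def subst_tm_subst_tm subst_tm_V split: nat.split)
  then show ?thesis by (simp add: inst_num_def subst_subst)
qed

lemma inst_set_subst: "inst_set X (subst \<sigma> (up_set \<tau>) p) = subst \<sigma> (case_nat X \<tau>) p"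
proof -
  have "(\<lambda>Y. case_nat X id (up_set \<tau> Y)) = case_nat X \<tau>"
    by (auto split: nat.split)
  then show ?thesis by (simp add: inst_set_def subst_subst subst_tm_V)
qed

lemma subst_inst_num: "subst \<sigma> \<tau> (inst_num t p) = inst_num (subst_tm \<sigma> t) (subst (up \<sigma>) \<tau> p)"
proof -
  have "(\<lambda>n. subst_tm \<sigma> (case_nat t V n)) = case_nat (subst_tm \<sigma> t) \<sigma>"
    by (auto split: nat.split)
  then show ?thesis unfolding inst_num_subst by (simp add: inst_num_def subst_subst)
qed

lemma subst_inst_set: "subst \<sigma> \<tau> (inst_set X p) = inst_set (\<tau> X) (subst \<sigma> (up_set \<tau>) p)"
proof -
  have "(\<lambda>Y. \<tau> (case_nat X id Y)) = case_nat (\<tau> X) \<tau>"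
    by (auto split: nat.split)
  then show ?thesis unfolding inst_set_subst by (simp add: inst_set_def subst_subst)
qed

lemma subst_tm_cong:
  "bounded_tm m t \<Longrightarrow> (\<And>n. n < m \<Longrightarrow> \<sigma> n = \<sigma>' n) \<Longrightarrow> subst_tm \<sigma> t = subst_tm \<sigma>' t"
  by (induction t) auto

text \<open>Only variables that can occur matter. Hence a renaming that treats one fresh index
  specially acts as a plain shift on formulas without that index, which turns named fresh variables
  into de Bruijn eigenvariables.\<close>

lemma subst_cong:
  "bounded m k p \<Longrightarrow> (\<And>n. n < m \<Longrightarrow> \<sigma> n = \<sigma>' n) \<Longrightarrow> (\<And>X. X < k \<Longrightarrow> \<tau> X = \<tau>' X) \<Longrightarrow>
    subst \<sigma> \<tau> p = subst \<sigma>' \<tau>' p"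
proof (induction p arbitrary: m k \<sigma> \<sigma>' \<tau> \<tau>')
  case (AllN p)
  have "subst (up \<sigma>) \<tau> p = subst (up \<sigma>') \<tau>' p"
    by (rule AllN.IH[of "Suc m" k]) (use AllN.prems in \<open>auto split: nat.split\<close>)
  then show ?case by simp
next
  case (AllS p)
  have "subst \<sigma> (up_set \<tau>) p = subst \<sigma>' (up_set \<tau>') p"
    by (rule AllS.IH[of m "Suc k"]) (use AllS.prems in \<open>auto split: nat.split\<close>)
  then show ?case by simp
next
  case (Imp p q)
  then show ?case by (metis bounded.simps(5) subst.simps(5))
qed (auto intro: subst_tm_cong)

lemma bounded_tm_mono: "bounded_tm m t \<Longrightarrow> m \<le> m' \<Longrightarrow> bounded_tm m' t"
  by (induction t) auto

lemma bounded_mono: "bounded m k p \<Longrightarrow> m \<le> m' \<Longrightarrow> k \<le> k' \<Longrightarrow> bounded m' k' p"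
proof (induction p arbitrary: m k m' k')
  case (AllN p) then show ?case using AllN.IH[of "Suc m" k "Suc m'" k'] by simp
next
  case (AllS p) then show ?case using AllS.IH[of m "Suc k" m' "Suc k'"] by simp
next
  case (Imp p q) then show ?case by (metis bounded.simps(5))
qed (auto intro: bounded_tm_mono)

lemma bounded_tm_exists: "\<exists>m. bounded_tm m t"
proof (induction t)
  case (V n)
  show ?case by (auto intro: exI[of _ "Suc n"])
next
  case (Add s t)
  then obtain m m' where "bounded_tm m s" "bounded_tm m' t" by blast
  then have "bounded_tm (max m m') (s \<^bold>+ t)" by (auto intro: bounded_tm_mono)
  then show ?case by blast
next
  case (Mul s t)
  then obtain m m' where "bounded_tm m s" "bounded_tm m' t" by blast
  then have "bounded_tm (max m m') (s \<^bold>* t)" by (auto intro: bounded_tm_mono)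
  then show ?case by blast
qed auto

lemma bounded_exists: "\<exists>m k. bounded m k p"
proof (induction p)
  case (Eq s t)
  obtain m where "bounded_tm m (s \<^bold>+ t)" using bounded_tm_exists by blast
  then show ?case by auto
next
  case (Less s t)
  obtain m where "bounded_tm m (s \<^bold>+ t)" using bounded_tm_exists by blast
  then show ?case by auto
next
  case (Mem t X)
  obtain m where "bounded_tm m t" using bounded_tm_exists by blast
  then have "bounded m (Suc X) (t \<^bold>\<in> X)" by auto
  then show ?case by blast
next
  case (Imp p q)
  then obtain m k m' k' where "bounded m k p" "bounded m' k' q" by blast
  then have "bounded (max m m') (max k k') (p \<^bold>\<longrightarrow> q)" by (auto intro: bounded_mono)
  then show ?case by blast
next
  case (AllN p)
  then obtain m k where "bounded m k p" by blast
  then have "bounded m k (AllN p)" by (auto intro: bounded_mono)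
  then show ?case by blast
next
  case (AllS p)
  then obtain m k where "bounded m k p" by blast
  then have "bounded m k (AllS p)" by (auto intro: bounded_mono)
  then show ?case by blast
qed auto

lemma bounded_AllN_pow: "bounded m k p \<Longrightarrow> bounded 0 k ((AllN ^^ m) p)"
proof (induction m arbitrary: p)
  case (Suc m)
  have "bounded 0 k ((AllN ^^ m) (AllN p))" by (rule Suc.IH) (use Suc.prems in simp)
  then show ?case by (simp add: funpow_swap1)
qed simp

lemma bounded_AllS_pow: "bounded m k p \<Longrightarrow> bounded m 0 ((AllS ^^ k) p)"
proof (induction k arbitrary: p)
  case (Suc k)
  have "bounded m 0 ((AllS ^^ k) (AllS p))" by (rule Suc.IH) (use Suc.prems in simp)
  then show ?case by (simp add: funpow_swap1)
qed simp

lemma bounded_univ_closures: "p \<in> univ_closures A \<Longrightarrow> bounded 0 0 p"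
  unfolding univ_closures_def using bounded_AllN_pow bounded_AllS_pow by blast


section \<open>Completeness\<close>

lemma weakening: "\<Gamma> \<turnstile> p \<Longrightarrow> \<Gamma> \<subseteq> \<Delta> \<Longrightarrow> \<Delta> \<turnstile> p"
proof (induction arbitrary: \<Delta> rule: proves.induct)
  case (ImpI p \<Gamma> q) then show ?case by (meson insert_mono proves.ImpI)
next
  case (Classical p \<Gamma>) then show ?case by (meson insert_mono proves.Classical)
next
  case (AllNI \<Gamma> p) then show ?case by (meson image_mono proves.AllNI)
next
  case (AllSI \<Gamma> p) then show ?case by (meson image_mono proves.AllSI)
qed (blast intro: proves.intros)+

text \<open>The generalisation rules lift the context, and lifting commutes with substitution up to
  \<open>up\<close> or \<open>up_set\<close>; hence the induction generalises over both
  substitutions.\<close>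

lemma proves_subst: "\<Gamma> \<turnstile> p \<Longrightarrow> subst \<sigma> \<tau> ` \<Gamma> \<turnstile> subst \<sigma> \<tau> p"
proof (induction arbitrary: \<sigma> \<tau> rule: proves.induct)
  case (Assm p \<Gamma>) then show ?case by (auto intro: proves.Assm)
next
  case (ImpI p \<Gamma> q) then show ?case by (auto intro: proves.ImpI)
next
  case (ImpE \<Gamma> p q) then show ?case by (metis proves.ImpE subst.simps(5))
next
  case (Classical p \<Gamma>)
  from Classical.IH[of \<sigma> \<tau>] show ?case by (auto intro: proves.Classical)
next
  case (AllNI \<Gamma> p)
  have "subst (up \<sigma>) \<tau> ` lift_num ` \<Gamma> = lift_num ` subst \<sigma> \<tau> ` \<Gamma>"
    by (simp add: image_image subst_lift_num)
  with AllNI.IH[of "up \<sigma>" \<tau>] show ?case by (auto intro: proves.AllNI)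
next
  case (AllNE \<Gamma> p t)
  from AllNE.IH[of \<sigma> \<tau>] show ?case unfolding subst_inst_num by (auto intro: proves.AllNE)
next
  case (AllSI \<Gamma> p)
  have "subst \<sigma> (up_set \<tau>) ` lift_set ` \<Gamma> = lift_set ` subst \<sigma> \<tau> ` \<Gamma>"
    by (simp add: image_image subst_lift_set)
  with AllSI.IH[of \<sigma> "up_set \<tau>"] show ?case by (auto intro: proves.AllSI)
next
  case (AllSE \<Gamma> p X)
  from AllSE.IH[of \<sigma> \<tau>] show ?case unfolding subst_inst_set by (auto intro: proves.AllSE)
next
  case (EqI \<Gamma> t) then show ?case by (auto intro: proves.EqI)
next
  case (EqE \<Gamma> s t p)
  show ?case unfolding subst_inst_num
    by (rule proves.EqE[of _ "subst_tm \<sigma> s"])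
      (use EqE.IH[of \<sigma> \<tau>] in \<open>simp_all add: subst_inst_num\<close>)
qed

lemma finite_subset_insert:
  assumes "finite D" "D \<subseteq> insert p \<Gamma>"
  obtains D' where "finite D'" "D' \<subseteq> \<Gamma>" "D \<subseteq> insert p D'"
  using assms that[of "D - {p}"] by blast

text \<open>A derivation uses finitely many assumptions. Where the context is an image under
  lifting, a finite part of it is the image of a finite part.\<close>

lemma compactness: "\<Gamma> \<turnstile> p \<Longrightarrow> \<exists>D. finite D \<and> D \<subseteq> \<Gamma> \<and> D \<turnstile> p"
proof (induction rule: proves.induct)
  case (Assm p \<Gamma>) then show ?case by (intro exI[of _ "{p}"]) (auto intro: proves.Assm)
next
  case (ImpI p \<Gamma> q)
  then obtain D where "finite D" "D \<subseteq> insert p \<Gamma>" "D \<turnstile> q" by blast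
  then show ?case by (metis finite_subset_insert proves.ImpI weakening)
next
  case (ImpE \<Gamma> p q)
  then obtain D E where "finite D" "D \<subseteq> \<Gamma>" "D \<turnstile> p \<^bold>\<longrightarrow> q" "finite E" "E \<subseteq> \<Gamma>" "E \<turnstile> p" by blast
  then show ?case
    by (intro exI[of _ "D \<union> E"]) (auto intro: proves.ImpE[of _ p] weakening)
next
  case (Classical p \<Gamma>)
  then obtain D where "finite D" "D \<subseteq> insert (\<^bold>\<not> p) \<Gamma>" "D \<turnstile> \<^bold>\<bottom>" by blast
  then show ?case by (metis finite_subset_insert proves.Classical weakening)
next
  case (AllNI \<Gamma> p) then show ?case by (metis finite_subset_image proves.AllNI)
next
  case (AllSI \<Gamma> p) then show ?case by (metis finite_subset_image proves.AllSI)
next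
  case (EqE \<Gamma> s t p)
  then obtain D E where "finite D" "D \<subseteq> \<Gamma>" "D \<turnstile> s \<^bold>= t" "finite E" "E \<subseteq> \<Gamma>" "E \<turnstile> inst_num s p"
    by blast
  then show ?case
    by (intro exI[of _ "D \<union> E"]) (auto intro: proves.EqE[of _ s] weakening)
qed (blast intro: proves.intros)+

section \<open>Henkin witnesses and Lindenbaum's construction\<close>

abbreviation consistent :: "fm set \<Rightarrow> bool" where
  "consistent \<Gamma> \<equiv> \<not> \<Gamma> \<turnstile> \<^bold>\<bottom>"

lemma proves_Falsum: "\<Gamma> \<turnstile> \<^bold>\<bottom> \<Longrightarrow> \<Gamma> \<turnstile> p"
  by (rule proves.Classical) (auto intro: weakening)

text \<open>The renaming sends z to the eigenvariable 0 and shifts everything else, so it acts on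
  the context as \<open>lift_num\<close> and undoes the instantiation of p at z.\<close>

lemma fresh_num:
  assumes "\<And>q. q \<in> \<Gamma> \<Longrightarrow> bounded z k q" "bounded (Suc z) k' p" "\<Gamma> \<turnstile> inst_num (V z) p"
  shows "\<Gamma> \<turnstile> AllN p"
proof -
  let ?\<sigma> = "\<lambda>n. if n = z then V 0 else V (Suc n)"
  have "subst ?\<sigma> id ` \<Gamma> = lift_num ` \<Gamma>"
    unfolding lift_num_def by (intro image_cong refl subst_cong[OF assms(1)]) auto
  moreover have "subst ?\<sigma> id (inst_num (V z) p) = subst V id p"
    unfolding inst_num_def subst_subst
    by (rule subst_cong[OF assms(2)]) (auto split: nat.split)
  ultimately show ?thesis
    using proves_subst[OF assms(3), of ?\<sigma> id] by (auto simp: subst_id intro: proves.AllNI)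
qed

lemma fresh_set:
  assumes "\<And>q. q \<in> \<Gamma> \<Longrightarrow> bounded m z q" "bounded m' (Suc z) p" "\<Gamma> \<turnstile> inst_set z p"
  shows "\<Gamma> \<turnstile> AllS p"
proof -
  let ?\<tau> = "\<lambda>n. if n = z then 0 else Suc n"
  have "subst V ?\<tau> ` \<Gamma> = lift_set ` \<Gamma>"
    unfolding lift_set_def by (intro image_cong refl subst_cong[OF assms(1)]) auto
  moreover have "subst V ?\<tau> (inst_set z p) = subst V id p"
    unfolding inst_set_def subst_subst
    by (rule subst_cong[OF assms(2)]) (auto split: nat.split)
  ultimately show ?thesis
    using proves_subst[OF assms(3), of V ?\<tau>] by (auto simp: subst_id intro: proves.AllSI)
qed

text \<open>Guarantees fresh variables above the bound, also for infinite theories. They serve as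
  Henkin witnesses, so no new constants enter the language.\<close>

definition uniformly_bounded :: "fm set \<Rightarrow> bool" where
  "uniformly_bounded \<Gamma> \<longleftrightarrow> (\<exists>m k. \<forall>q\<in>\<Gamma>. bounded m k q)"

lemma uniformly_bounded_insert: "uniformly_bounded (insert p \<Gamma>) \<longleftrightarrow> uniformly_bounded \<Gamma>"
proof
  assume "uniformly_bounded \<Gamma>"
  then obtain m k where mk: "\<forall>q\<in>\<Gamma>. bounded m k q" unfolding uniformly_bounded_def by blast
  obtain m' k' where "bounded m' k' p" using bounded_exists by blast
  then have "\<forall>q\<in>insert p \<Gamma>. bounded (max m m') (max k k') q"
    using mk by (auto intro: bounded_mono)
  then show "uniformly_bounded (insert p \<Gamma>)" unfolding uniformly_bounded_def by blast
qed (auto simp: uniformly_bounded_def)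

lemma Neg_AllN_witness:
  assumes "consistent \<Gamma>" "uniformly_bounded \<Gamma>" "\<^bold>\<not> AllN p \<in> \<Gamma>"
  shows "\<exists>t. consistent (insert (\<^bold>\<not> inst_num t p) \<Gamma>)"
proof -
  obtain m k where mk: "\<forall>q\<in>\<Gamma>. bounded m k q"
    using assms(2) unfolding uniformly_bounded_def by blast
  have p: "bounded (Suc m) k p" using mk assms(3) by force
  have "\<not> \<Gamma> \<turnstile> inst_num (V m) p"
    using fresh_num[of \<Gamma> m k k p] mk p assms(1,3) by (meson proves.Assm proves.ImpE)
  then show ?thesis using proves.Classical by blast
qed

lemma Neg_AllS_witness:
  assumes "consistent \<Gamma>" "uniformly_bounded \<Gamma>" "\<^bold>\<not> AllS p \<in> \<Gamma>"
  shows "\<exists>X. consistent (insert (\<^bold>\<not> inst_set X p) \<Gamma>)"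
proof -
  obtain m k where mk: "\<forall>q\<in>\<Gamma>. bounded m k q"
    using assms(2) unfolding uniformly_bounded_def by blast
  have p: "bounded m (Suc k) p" using mk assms(3) by force
  have "\<not> \<Gamma> \<turnstile> inst_set k p"
    using fresh_set[of \<Gamma> m k m p] mk p assms(1,3) by (meson proves.Assm proves.ImpE)
  then show ?thesis using proves.Classical by blast
qed

text \<open>Completeness and the Henkin property in one: a universal formula may be left out only if
  a negated instance is put in.\<close>

definition decides :: "fm set \<Rightarrow> fm \<Rightarrow> bool" where
  "decides \<Delta> p \<longleftrightarrow> (p \<in> \<Delta> \<or> \<^bold>\<not> p \<in> \<Delta>) \<and>
    (\<forall>q. p = AllN q \<longrightarrow> p \<notin> \<Delta> \<longrightarrow> (\<exists>t. \<^bold>\<not> inst_num t q \<in> \<Delta>)) \<and>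
    (\<forall>q. p = AllS q \<longrightarrow> p \<notin> \<Delta> \<longrightarrow> (\<exists>X. \<^bold>\<not> inst_set X q \<in> \<Delta>))"

lemma decides_mono: "decides \<Delta> p \<Longrightarrow> \<Delta> \<subseteq> T \<Longrightarrow> decides T p"
  unfolding decides_def by blast

lemma Lindenbaum_step:
  assumes "consistent \<Gamma>" "uniformly_bounded \<Gamma>"
  shows "\<exists>\<Delta>. consistent \<Delta> \<and> uniformly_bounded \<Delta> \<and> \<Gamma> \<subseteq> \<Delta> \<and> decides \<Delta> p"
proof (cases "consistent (insert (\<^bold>\<not> p) \<Gamma>)")
  case True
  let ?D = "insert (\<^bold>\<not> p) \<Gamma>"
  have ub: "uniformly_bounded (insert r ?D)" "uniformly_bounded ?D" for r
    using assms(2) by (simp_all add: uniformly_bounded_insert)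
  consider q where "p = AllN q" | q where "p = AllS q" | "\<nexists>q. p = AllN q \<or> p = AllS q" by blast
  then show ?thesis
  proof cases
    case 1
    then obtain t where t: "consistent (insert (\<^bold>\<not> inst_num t q) ?D)"
      using Neg_AllN_witness[OF True ub(2)] by blast
    have "decides (insert (\<^bold>\<not> inst_num t q) ?D) p" using 1 by (auto simp: decides_def)
    then show ?thesis using t ub(1) by blast
  next
    case 2
    then obtain X where X: "consistent (insert (\<^bold>\<not> inst_set X q) ?D)"
      using Neg_AllS_witness[OF True ub(2)] by blast
    have "decides (insert (\<^bold>\<not> inst_set X q) ?D) p" using 2 by (auto simp: decides_def)
    then show ?thesis using X ub(1) by blast
  next
    case 3
    then have "decides ?D p" by (auto simp: decides_def)
    then show ?thesis using True ub(2) by blast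
  qed
next
  case False
  then have p: "\<Gamma> \<turnstile> p" by (auto intro: proves.Classical)
  have "consistent (insert p \<Gamma>)" using assms(1) p by (meson proves.ImpE proves.ImpI)
  moreover have "decides (insert p \<Gamma>) p" by (auto simp: decides_def)
  ultimately show ?thesis using assms(2) uniformly_bounded_insert by blast
qed

definition Henkin :: "fm set \<Rightarrow> bool" where
  "Henkin T \<longleftrightarrow> consistent T \<and> (\<forall>p. decides T p)"

instance tm :: countable by countable_datatype
instance fm :: countable by countable_datatype

text \<open>Stage n decides the n-th formula. Each stage stays uniformly bounded, so the next one
  still has fresh variables; compactness makes the union consistent, although the union itself may
  use all variables.\<close>

lemma Henkin_extension:
  assumes "consistent \<Gamma>" "uniformly_bounded \<Gamma>"
  shows "\<exists>T. \<Gamma> \<subseteq> T \<and> Henkin T"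
proof -
  let ?P = "\<lambda>n \<Delta>. consistent \<Delta> \<and> uniformly_bounded \<Delta> \<and> \<Gamma> \<subseteq> \<Delta>"
  let ?Q = "\<lambda>n \<Delta> \<Delta>'. \<Delta> \<subseteq> \<Delta>' \<and> decides \<Delta>' (from_nat n)"
  have "\<exists>G. \<forall>n. ?P n (G n) \<and> ?Q n (G n) (G (Suc n))"
  proof (rule dependent_nat_choice)
    show "\<exists>\<Delta>. ?P 0 \<Delta>" using assms by blast
    fix \<Delta> and n :: nat assume \<Delta>: "?P n \<Delta>"
    then obtain \<Delta>' where "consistent \<Delta>'" "uniformly_bounded \<Delta>'" "\<Delta> \<subseteq> \<Delta>'" "decides \<Delta>' (from_nat n)"
      using Lindenbaum_step by metis
    then show "\<exists>\<Delta>'. ?P (Suc n) \<Delta>' \<and> ?Q n \<Delta> \<Delta>'" using \<Delta> by blast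
  qed
  then obtain G where G: "\<And>n. ?P n (G n)" "\<And>n. ?Q n (G n) (G (Suc n))" by blast
  have mono: "n \<le> m \<Longrightarrow> G n \<subseteq> G m" for n m
    using lift_Suc_mono_le[of G] G(2) by blast
  have fin: "finite D \<Longrightarrow> D \<subseteq> (\<Union>n. G n) \<Longrightarrow> \<exists>n. D \<subseteq> G n" for D
  proof (induction D rule: finite_induct)
    case (insert x D)
    then obtain n m where "D \<subseteq> G n" "x \<in> G m" by auto
    then have "insert x D \<subseteq> G (max n m)"
      using mono[of n "max n m"] mono[of m "max n m"] by (meson insert_subset max.cobounded1 max.cobounded2 subset_iff)
    then show ?case by blast
  qed auto
  let ?T = "\<Union>n. G n"
  have consT: "consistent ?T"
    using compactness[of ?T "\<^bold>\<bottom>"] fin G(1) weakening by meson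
  have dec: "\<exists>n. decides (G n) p" for p
    using G(2)[of "to_nat p"] by (metis from_nat_to_nat)
  have "decides ?T p" for p
    using dec[of p] decides_mono by blast
  then have "Henkin ?T" unfolding Henkin_def using consT by blast
  then show ?thesis using G(1) by blast
qed

lemma Henkin_proves: "Henkin T \<Longrightarrow> T \<turnstile> p \<longleftrightarrow> p \<in> T"
  unfolding Henkin_def decides_def by (meson proves.Assm proves.ImpE)

lemma Henkin_Falsum: "Henkin T \<Longrightarrow> \<^bold>\<bottom> \<notin> T"
  unfolding Henkin_def by (meson proves.Assm)

lemma Henkin_Imp: "Henkin T \<Longrightarrow> (p \<^bold>\<longrightarrow> q) \<in> T \<longleftrightarrow> (p \<in> T \<longrightarrow> q \<in> T)"
proof
  assume T: "Henkin T" and "p \<in> T \<longrightarrow> q \<in> T"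
  then consider "q \<in> T" | "\<^bold>\<not> p \<in> T" unfolding Henkin_def decides_def by blast
  then have "T \<turnstile> p \<^bold>\<longrightarrow> q"
  proof cases
    case 1 then show ?thesis by (auto intro: proves.ImpI proves.Assm)
  next
    case 2
    then show ?thesis by (meson insertCI proves.Assm proves.ImpE proves.ImpI proves_Falsum)
  qed
  then show "(p \<^bold>\<longrightarrow> q) \<in> T" using T Henkin_proves by blast
next
  assume "Henkin T" "(p \<^bold>\<longrightarrow> q) \<in> T"
  then show "p \<in> T \<longrightarrow> q \<in> T" by (meson Henkin_proves proves.ImpE)
qed

lemma Henkin_AllN:
  assumes "Henkin T"
  shows "AllN p \<in> T \<longleftrightarrow> (\<forall>t. inst_num t p \<in> T)"
proof
  assume "AllN p \<in> T"
  then show "\<forall>t. inst_num t p \<in> T" using assms Henkin_proves proves.AllNE by blast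
next
  assume *: "\<forall>t. inst_num t p \<in> T"
  have "\<^bold>\<not> inst_num t p \<notin> T" for t
    using * Henkin_Imp[OF assms] Henkin_Falsum[OF assms] by blast
  then show "AllN p \<in> T" using assms unfolding Henkin_def decides_def by blast
qed

lemma Henkin_AllS:
  assumes "Henkin T"
  shows "AllS p \<in> T \<longleftrightarrow> (\<forall>X. inst_set X p \<in> T)"
proof
  assume "AllS p \<in> T"
  then show "\<forall>X. inst_set X p \<in> T" using assms Henkin_proves proves.AllSE by blast
next
  assume *: "\<forall>X. inst_set X p \<in> T"
  have "\<^bold>\<not> inst_set X p \<notin> T" for X
    using * Henkin_Imp[OF assms] Henkin_Falsum[OF assms] by blast
  then show "AllS p \<in> T" using assms unfolding Henkin_def decides_def by blast
qed


section \<open>Semantics\<close>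

primrec ev :: "(nat \<Rightarrow> 'a::{zero,one,plus,times}) \<Rightarrow> tm \<Rightarrow> 'a" where
  "ev e (V n) = e n"
| "ev e Zero = 0"
| "ev e One = 1"
| "ev e (s \<^bold>+ t) = ev e s + ev e t"
| "ev e (s \<^bold>* t) = ev e s * ev e t"

text \<open>Henkin semantics: set quantifiers range over a prescribed family \<open>S\<close>, since
  the calculus is not complete for full second-order semantics.\<close>

primrec sat :: "'a set set \<Rightarrow> (nat \<Rightarrow> 'a::{zero,one,plus,times,ord}) \<Rightarrow> (nat \<Rightarrow> 'a set) \<Rightarrow> fm \<Rightarrow> bool"
where
  "sat S e s \<^bold>\<bottom> \<longleftrightarrow> False"
| "sat S e s (t \<^bold>= u) \<longleftrightarrow> ev e t = ev e u"
| "sat S e s (t \<^bold>< u) \<longleftrightarrow> ev e t < ev e u"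
| "sat S e s (t \<^bold>\<in> X) \<longleftrightarrow> ev e t \<in> s X"
| "sat S e s (p \<^bold>\<longrightarrow> q) \<longleftrightarrow> (sat S e s p \<longrightarrow> sat S e s q)"
| "sat S e s (AllN p) \<longleftrightarrow> (\<forall>x. sat S (case_nat x e) s p)"
| "sat S e s (AllS p) \<longleftrightarrow> (\<forall>X\<in>S. sat S e (case_nat X s) p)"

lemma ev_subst_tm: "ev e (subst_tm \<sigma> t) = ev (\<lambda>n. ev e (\<sigma> n)) t"
  by (induction t) auto

lemma ev_lift_tm: "ev (case_nat x e) (lift_tm t) = ev e t"
  by (simp add: lift_tm_def ev_subst_tm)

lemma sat_subst: "sat S e s (subst \<sigma> \<tau> p) \<longleftrightarrow> sat S (\<lambda>n. ev e (\<sigma> n)) (\<lambda>X. s (\<tau> X)) p"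
proof (induction p arbitrary: e s \<sigma> \<tau>)
  case (AllN p)
  have "(\<lambda>n. ev (case_nat x e) (up \<sigma> n)) = case_nat x (\<lambda>n. ev e (\<sigma> n))" for x
    by (intro ext) (auto simp: ev_lift_tm split: nat.split)
  then show ?case using AllN by simp
next
  case (AllS p)
  have "(\<lambda>Y. case_nat X s (up_set \<tau> Y)) = case_nat X (\<lambda>Y. s (\<tau> Y))" for X
    by (intro ext) (auto split: nat.split)
  then show ?case using AllS by simp
qed (simp_all add: ev_subst_tm)

lemma sat_inst_num: "sat S e s (inst_num t p) \<longleftrightarrow> sat S (case_nat (ev e t) e) s p"
proof -
  have "(\<lambda>n. ev e (case_nat t V n)) = case_nat (ev e t) e" by (intro ext) (auto split: nat.split)
  then show ?thesis by (simp add: inst_num_def sat_subst)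
qed

lemma sat_inst_set: "sat S e s (inst_set X p) \<longleftrightarrow> sat S e (case_nat (s X) s) p"
proof -
  have "(\<lambda>Y. s (case_nat X id Y)) = case_nat (s X) s" by (intro ext) (auto split: nat.split)
  then show ?thesis by (simp add: inst_set_def sat_subst)
qed

lemma sat_lift_num: "sat S (case_nat x e) s (lift_num p) \<longleftrightarrow> sat S e s p"
  by (simp add: lift_num_def sat_subst)

lemma sat_lift_set: "sat S e (case_nat X s) (lift_set p) \<longleftrightarrow> sat S e s p"
  by (simp add: lift_set_def sat_subst)

lemma range_case_nat: "range (case_nat X s) \<subseteq> S \<longleftrightarrow> X \<in> S \<and> range s \<subseteq> S"
proof -
  have "(\<forall>n. case_nat X s n \<in> S) \<longleftrightarrow> X \<in> S \<and> (\<forall>n. s n \<in> S)"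
    by (metis nat.case nat.exhaust)
  then show ?thesis by auto
qed

lemma soundness:
  "\<Gamma> \<turnstile> p \<Longrightarrow> range s \<subseteq> S \<Longrightarrow> (\<And>q. q \<in> \<Gamma> \<Longrightarrow> sat S e s q) \<Longrightarrow> sat S e s p"
proof (induction arbitrary: e s rule: proves.induct)
  case (ImpI p \<Gamma> q)
  have "sat S e s q" if "sat S e s p"
    using ImpI.prems that by (intro ImpI.IH) auto
  then show ?case by simp
next
  case (Classical p \<Gamma>)
  show ?case
  proof (rule ccontr)
    assume "\<not> sat S e s p"
    then have "sat S e s \<^bold>\<bottom>" using Classical.prems by (intro Classical.IH) auto
    then show False by simp
  qed
next
  case (AllNI \<Gamma> p)
  have "sat S (case_nat x e) s p" for x
    using AllNI.prems by (intro AllNI.IH) (auto simp: sat_lift_num)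
  then show ?case by simp
next
  case (AllSI \<Gamma> p)
  have "sat S e (case_nat X s) p" if "X \<in> S" for X
    using AllSI.prems that by (intro AllSI.IH) (auto simp: sat_lift_set range_case_nat)
  then show ?case by simp
next
  case (AllSE \<Gamma> p X)
  have "sat S e s (AllS p)" by (rule AllSE.IH[OF AllSE.prems])
  then show ?case using AllSE.prems(1) by (auto simp: sat_inst_set)
next
  case (AllNE \<Gamma> p t)
  have "sat S e s (AllN p)" by (rule AllNE.IH[OF AllNE.prems])
  then show ?case by (auto simp: sat_inst_num)
next
  case (EqE \<Gamma> u t p)
  have "sat S e s (u \<^bold>= t)" by (rule EqE.IH(1)[OF EqE.prems])
  moreover have "sat S e s (inst_num u p)" by (rule EqE.IH(2)[OF EqE.prems])
  ultimately show ?case by (simp add: sat_inst_num)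
next
  case (ImpE \<Gamma> p q)
  have "sat S e s (p \<^bold>\<longrightarrow> q)" by (rule ImpE.IH(1)[OF ImpE.prems])
  moreover have "sat S e s p" by (rule ImpE.IH(2)[OF ImpE.prems])
  ultimately show ?case by simp
qed auto

lemma ev_cong: "bounded_tm m t \<Longrightarrow> (\<And>n. n < m \<Longrightarrow> e n = e' n) \<Longrightarrow> ev e t = ev e' t"
  by (induction t) auto

lemma sat_cong:
  "bounded m k p \<Longrightarrow> (\<And>n. n < m \<Longrightarrow> e n = e' n) \<Longrightarrow> (\<And>X. X < k \<Longrightarrow> s X = s' X) \<Longrightarrow>
    sat S e s p \<longleftrightarrow> sat S e' s' p"
proof (induction p arbitrary: m k e e' s s')
  case (AllN p)
  have "sat S (case_nat x e) s p = sat S (case_nat x e') s' p" for x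
    by (rule AllN.IH[of "Suc m" k]) (use AllN.prems in \<open>auto split: nat.split\<close>)
  then show ?case by simp
next
  case (AllS p)
  have "sat S e (case_nat X s) p = sat S e' (case_nat X s') p" for X
    by (rule AllS.IH[of m "Suc k"]) (use AllS.prems in \<open>auto split: nat.split\<close>)
  then show ?case by simp
next
  case (Imp p q)
  have "sat S e s p = sat S e' s' p" "sat S e s q = sat S e' s' q"
    by (rule Imp.IH[of m k]; use Imp.prems in simp)+
  then show ?case by simp
next
  case (Eq t u)
  then show ?case using ev_cong[of m t e e'] ev_cong[of m u e e'] by simp
next
  case (Less t u)
  then show ?case using ev_cong[of m t e e'] ev_cong[of m u e e'] by simp
next
  case (Mem t X)
  then show ?case using ev_cong[of m t e e'] by simp
qed auto

text \<open>One assignment f replaces m nested quantifiers. The induction strips the innermost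
  quantifier first, so that the index arithmetic stays uniform.\<close>

lemma sat_AllN_pow: "sat S e s ((AllN ^^ m) p) \<longleftrightarrow>
  (\<forall>f. sat S (\<lambda>n. if n < m then f n else e (n - m)) s p)"
proof (induction m arbitrary: p)
  case (Suc m)
  have *: "case_nat x (\<lambda>n. if n < m then f n else e (n - m)) =
      (\<lambda>n. if n < Suc m then case_nat x f n else e (n - Suc m))" for x f
    by (intro ext) (auto split: nat.split)
  have "sat S e s ((AllN ^^ Suc m) p) \<longleftrightarrow> sat S e s ((AllN ^^ m) (AllN p))"
    by (simp add: funpow_swap1)
  also have "\<dots> \<longleftrightarrow> (\<forall>f x. sat S (\<lambda>n. if n < Suc m then case_nat x f n else e (n - Suc m)) s p)"
    unfolding Suc.IH by (simp add: *)
  also have "\<dots> \<longleftrightarrow> (\<forall>f. sat S (\<lambda>n. if n < Suc m then f n else e (n - Suc m)) s p)"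
  proof (intro iffI allI)
    fix f :: "nat \<Rightarrow> 'a" assume *: "\<forall>f x. sat S (\<lambda>n. if n < Suc m then case_nat x f n else e (n - Suc m)) s p"
    have f: "case_nat (f 0) (\<lambda>n. f (Suc n)) = f" by (intro ext) (auto split: nat.split)
    show "sat S (\<lambda>n. if n < Suc m then f n else e (n - Suc m)) s p"
      using *[THEN spec, of "\<lambda>n. f (Suc n)", THEN spec, of "f 0"] by (simp only: f)
  qed blast
  finally show ?case .
qed simp

lemma sat_AllS_pow: "sat S e s ((AllS ^^ k) p) \<longleftrightarrow>
  (\<forall>f::nat \<Rightarrow> _. range f \<subseteq> S \<longrightarrow> sat S e (\<lambda>n. if n < k then f n else s (n - k)) p)"
  if "range s \<subseteq> S"
proof (induction k arbitrary: p)
  case 0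
  then show ?case using that by auto
next
  case (Suc k)
  have *: "case_nat x (\<lambda>n. if n < k then f n else s (n - k)) =
      (\<lambda>n. if n < Suc k then case_nat x f n else s (n - Suc k))" for x f
    by (intro ext) (auto split: nat.split)
  have "sat S e s ((AllS ^^ Suc k) p) \<longleftrightarrow> sat S e s ((AllS ^^ k) (AllS p))"
    by (simp add: funpow_swap1)
  also have "\<dots> \<longleftrightarrow> (\<forall>f. range f \<subseteq> S \<longrightarrow> (\<forall>x\<in>S.
      sat S e (\<lambda>n. if n < Suc k then case_nat x f n else s (n - Suc k)) p))"
    unfolding Suc.IH by (simp add: *)
  also have "\<dots> \<longleftrightarrow> (\<forall>f. range f \<subseteq> S \<longrightarrow> sat S e (\<lambda>n. if n < Suc k then f n else s (n - Suc k)) p)"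
  proof (intro iffI allI impI ballI)
    fix f :: "nat \<Rightarrow> 'a set" assume *: "\<forall>f. range f \<subseteq> S \<longrightarrow> (\<forall>x\<in>S.
      sat S e (\<lambda>n. if n < Suc k then case_nat x f n else s (n - Suc k)) p)" and r: "range f \<subseteq> S"
    have f: "case_nat (f 0) (\<lambda>n. f (Suc n)) = f" by (intro ext) (auto split: nat.split)
    have "range (\<lambda>n. f (Suc n)) \<subseteq> S" "f 0 \<in> S" using r by auto
    then show "sat S e (\<lambda>n. if n < Suc k then f n else s (n - Suc k)) p"
      using *[THEN spec, of "\<lambda>n. f (Suc n)"] f by metis
  next
    fix f :: "nat \<Rightarrow> 'a set" and x assume *: "\<forall>f. range f \<subseteq> S \<longrightarrow> sat S e (\<lambda>n. if n < Suc k then f n else s (n - Suc k)) p"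
      and "range f \<subseteq> S" "x \<in> S"
    then show "sat S e (\<lambda>n. if n < Suc k then case_nat x f n else s (n - Suc k)) p"
      using *[THEN spec, of "case_nat x f"] by (simp add: range_case_nat)
  qed
  finally show ?case .
qed

lemma sat_univ_closures:
  assumes "range s \<subseteq> S" "\<And>p e s. p \<in> A \<Longrightarrow> range s \<subseteq> S \<Longrightarrow> sat S e s p" "q \<in> univ_closures A"
  shows "sat S e s q"
proof -
  obtain p m k where q: "q = (AllS ^^ k) ((AllN ^^ m) p)" "p \<in> A"
    using assms(3) unfolding univ_closures_def by blast
  show ?thesis unfolding q sat_AllS_pow[OF assms(1)] sat_AllN_pow
    using assms(1) by (intro allI impI assms(2)[OF q(2)]) auto
qed

text \<open>Truth of the closure at a single assignment gives the axiom at all of them; in this form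
  the axioms can be applied with arbitrary parameters from the model.\<close>

lemma univ_closures_sat:
  assumes "\<And>q. q \<in> univ_closures A \<Longrightarrow> sat S e s q" "range s \<subseteq> S" "p \<in> A" "range s' \<subseteq> S"
  shows "sat S e' s' p"
proof -
  obtain m k where mk: "bounded m k p" using bounded_exists by blast
  then have "sat S e s ((AllS ^^ k) ((AllN ^^ m) p))"
    using assms(1,3) unfolding univ_closures_def by blast
  then have "sat S (\<lambda>n. if n < m then e' n else e (n - m))
      (\<lambda>n. if n < k then s' n else s (n - k)) p"
    using assms(4) unfolding sat_AllS_pow[OF assms(2)] sat_AllN_pow by blast
  then show ?thesis using sat_cong[OF mk] by (smt (verit))
qed

text \<open>With all sets of naturals present, comprehension is trivial, and induction is that of
  \<open>nat\<close>.\<close>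

lemma RCA0_axioms_standard:
  assumes "p \<in> basic_axioms \<union> Sigma01_induction \<union> Delta01_comprehension"
  shows "sat UNIV (e :: nat \<Rightarrow> nat) s p"
proof -
  have "sat UNIV e s p" if p: "p \<in> Sigma01_induction"
  proof -
    obtain r where p: "p = inst_num Zero r \<^bold>\<and>
        AllN (r \<^bold>\<longrightarrow> subst (case_nat (V 0 \<^bold>+ One) (\<lambda>n. V (Suc n))) id r) \<^bold>\<longrightarrow> AllN r"
      using p unfolding Sigma01_induction_def by blast
    have *: "(\<lambda>n. ev (case_nat x e) (case_nat (V 0 \<^bold>+ One) (\<lambda>n. V (Suc n)) n)) = case_nat (Suc x) e"
      for x by (intro ext) (auto split: nat.split)
    have "sat UNIV (case_nat x e) s r"
      if "sat UNIV (case_nat 0 e) s r"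
        "\<forall>x. sat UNIV (case_nat x e) s r \<longrightarrow> sat UNIV (case_nat (Suc x) e) s r" for x
      using that by (induct x) auto
    moreover have "sat UNIV e s p \<longleftrightarrow> (sat UNIV (case_nat 0 e) s r \<longrightarrow>
        (\<forall>x. sat UNIV (case_nat x e) s r \<longrightarrow> sat UNIV (case_nat (Suc x) e) s r) \<longrightarrow>
        (\<forall>x. sat UNIV (case_nat x e) s r))"
      unfolding p sat.simps sat_inst_num sat_subst * by simp blast
    ultimately show ?thesis by blast
  qed
  moreover have "sat UNIV e s p" if p: "p \<in> Delta01_comprehension"
  proof -
    obtain q where p: "\<exists>q'. p = AllN (q \<^bold>\<longleftrightarrow> q') \<^bold>\<longrightarrow> ExS (AllN (V 0 \<^bold>\<in> 0 \<^bold>\<longleftrightarrow> lift_set q))"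
      using p unfolding Delta01_comprehension_def by blast
    have "\<forall>x. (x \<in> {x. sat UNIV (case_nat x e) s q}) \<longleftrightarrow> sat UNIV (case_nat x e) s q"
      by simp
    then have "\<exists>X. \<forall>x. (x \<in> X) \<longleftrightarrow> sat UNIV (case_nat x e) s q" ..
    then have "sat UNIV e s (ExS (AllN (V 0 \<^bold>\<in> 0 \<^bold>\<longleftrightarrow> lift_set q)))"
      unfolding sat.simps sat_lift_set ev.simps by simp blast
    then show ?thesis using p sat.simps(5) by blast
  qed
  moreover have "sat UNIV e s p" if "p \<in> basic_axioms"
    using that unfolding basic_axioms_def by (auto simp: algebra_simps)
  ultimately show ?thesis using assms by blast
qed

text \<open>A type cannot be defined under a hypothesis, so some maximal consistent theory must
  exist in any case. This covers the case in which adding the negated implication is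
  inconsistent.\<close>

lemma consistent_RCA0: "consistent RCA0"
proof
  assume "RCA0 \<turnstile> \<^bold>\<bottom>"
  then have "sat UNIV (\<lambda>_. 0 :: nat) (\<lambda>_. {}) \<^bold>\<bottom>"
  proof (rule soundness)
    fix q assume "q \<in> RCA0"
    then show "sat UNIV (\<lambda>_. 0 :: nat) (\<lambda>_. {}) q"
      unfolding RCA0_def
      by (rule sat_univ_closures[rotated 2]) (auto intro: RCA0_axioms_standard[unfolded Un_iff])
  qed auto
  then show False by simp
qed


section \<open>The term model\<close>

text \<open>
  Fixing one maximal theory globally turns its term model into a type, so that the model can be made
  an instance of the arithmetic type classes. If there were no counterexample theory, the model
  would still be one of \<open>RCA0\<close>, which is all the instance proofs need.
\<close>

definition counter_theory :: "fm set" where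
  "counter_theory =
    (let \<Gamma> = insert (\<^bold>\<not> (TS2 \<^bold>\<longrightarrow> RRT22)) RCA0 in if consistent \<Gamma> then \<Gamma> else RCA0)"

definition model_theory :: "fm set" where
  "model_theory = (SOME T. counter_theory \<subseteq> T \<and> Henkin T)"

lemma bounded_TS2_RRT22: "bounded 0 0 (TS2 \<^bold>\<longrightarrow> RRT22)"
  by (simp add: TS2_def RRT22_def is_function_def is_infinite_def is_thin_def is_2_bounded_def
      is_rainbow_def pair_def)

lemma model_theory: "counter_theory \<subseteq> model_theory" "Henkin model_theory"
proof -
  have "consistent counter_theory"
    unfolding counter_theory_def Let_def using consistent_RCA0 by simp
  moreover have "\<forall>q\<in>counter_theory. bounded 0 0 q"
    unfolding counter_theory_def Let_def RCA0_def
    using bounded_univ_closures bounded_TS2_RRT22 by auto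
  ultimately have "\<exists>T. counter_theory \<subseteq> T \<and> Henkin T"
    using Henkin_extension unfolding uniformly_bounded_def by blast
  then show "counter_theory \<subseteq> model_theory" "Henkin model_theory"
    unfolding model_theory_def by (metis (no_types, lifting) someI_ex)+
qed

lemma RCA0_subset_model_theory: "RCA0 \<subseteq> model_theory"
  using model_theory(1) unfolding counter_theory_def Let_def by (auto split: if_splits)

lemma model_theory_eqI: "(t \<^bold>= t) \<in> model_theory"
  using Henkin_proves[OF model_theory(2)] proves.EqI by blast

lemma model_theory_eqE:
  "(s \<^bold>= t) \<in> model_theory \<Longrightarrow> inst_num s p \<in> model_theory \<Longrightarrow> inst_num t p \<in> model_theory"
  using Henkin_proves[OF model_theory(2)] proves.EqE by blast

lemma subst_tm_lift_tm: "subst_tm (case_nat s V) (lift_tm t) = t"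
  by (simp add: lift_tm_def subst_tm_subst_tm subst_tm_V)

text \<open>\<open>EqE\<close> replaces the variable 0 of an arbitrary formula. Congruence of each
  symbol follows by putting \<open>V 0\<close> in the argument concerned and lifted terms
  elsewhere.\<close>

lemma model_theory_cong:
  assumes "(s \<^bold>= t) \<in> model_theory"
  shows "inst_num s p \<in> model_theory \<longleftrightarrow> inst_num t p \<in> model_theory"
proof -
  have "(t \<^bold>= s) \<in> model_theory"
    using model_theory_eqE[OF assms, of "V 0 \<^bold>= lift_tm s"] model_theory_eqI
    by (simp add: inst_num_def subst_tm_lift_tm)
  then show ?thesis using model_theory_eqE assms by blast
qed

quotient_type mnum = tm / "\<lambda>s t. (s \<^bold>= t) \<in> model_theory"
proof (rule equivpI)
  show "reflp (\<lambda>s t. (s \<^bold>= t) \<in> model_theory)" by (auto intro: reflpI model_theory_eqI)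
  show "symp (\<lambda>s t. (s \<^bold>= t) \<in> model_theory)"
  proof (rule sympI)
    fix s t assume "(s \<^bold>= t) \<in> model_theory"
    then show "(t \<^bold>= s) \<in> model_theory"
      using model_theory_cong[of s t "V 0 \<^bold>= lift_tm s"] model_theory_eqI
      by (simp add: inst_num_def subst_tm_lift_tm)
  qed
  show "transp (\<lambda>s t. (s \<^bold>= t) \<in> model_theory)"
  proof (rule transpI)
    fix s t u assume "(s \<^bold>= t) \<in> model_theory" "(t \<^bold>= u) \<in> model_theory"
    then show "(s \<^bold>= u) \<in> model_theory"
      using model_theory_cong[of t u "lift_tm s \<^bold>= V 0"]
      by (simp add: inst_num_def subst_tm_lift_tm)
  qed
qed

instantiation mnum :: "{zero,one,plus,times,ord}"
begin

lift_definition zero_mnum :: mnum is Zero .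
lift_definition one_mnum :: mnum is One .

lift_definition plus_mnum :: "mnum \<Rightarrow> mnum \<Rightarrow> mnum" is Add
proof -
  fix s s' t t' assume "(s \<^bold>= s') \<in> model_theory" "(t \<^bold>= t') \<in> model_theory"
  then show "(s \<^bold>+ t \<^bold>= s' \<^bold>+ t') \<in> model_theory"
    using model_theory_cong[of s s' "lift_tm (s \<^bold>+ t) \<^bold>= V 0 \<^bold>+ lift_tm t"]
      model_theory_cong[of t t' "lift_tm (s \<^bold>+ t) \<^bold>= lift_tm s' \<^bold>+ V 0"] model_theory_eqI
    by (simp add: inst_num_def subst_tm_lift_tm)
qed

lift_definition times_mnum :: "mnum \<Rightarrow> mnum \<Rightarrow> mnum" is Mul
proof -
  fix s s' t t' assume "(s \<^bold>= s') \<in> model_theory" "(t \<^bold>= t') \<in> model_theory"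
  then show "(s \<^bold>* t \<^bold>= s' \<^bold>* t') \<in> model_theory"
    using model_theory_cong[of s s' "lift_tm (s \<^bold>* t) \<^bold>= V 0 \<^bold>* lift_tm t"]
      model_theory_cong[of t t' "lift_tm (s \<^bold>* t) \<^bold>= lift_tm s' \<^bold>* V 0"] model_theory_eqI
    by (simp add: inst_num_def subst_tm_lift_tm)
qed

lift_definition less_mnum :: "mnum \<Rightarrow> mnum \<Rightarrow> bool" is "\<lambda>s t. (s \<^bold>< t) \<in> model_theory"
proof -
  fix s s' t t' assume "(s \<^bold>= s') \<in> model_theory" "(t \<^bold>= t') \<in> model_theory"
  then show "(s \<^bold>< t) \<in> model_theory \<longleftrightarrow> (s' \<^bold>< t') \<in> model_theory"
    using model_theory_cong[of s s' "V 0 \<^bold>< lift_tm t"]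
      model_theory_cong[of t t' "lift_tm s' \<^bold>< V 0"]
    by (simp add: inst_num_def subst_tm_lift_tm)
qed

definition less_eq_mnum :: "mnum \<Rightarrow> mnum \<Rightarrow> bool" where
  "less_eq_mnum x y \<longleftrightarrow> x < y \<or> x = y"

instance ..

end

text \<open>Sets have no primitive equality, so a set variable is interpreted by its extension and
  no quotient is formed.\<close>

definition set_of :: "nat \<Rightarrow> mnum set" where
  "set_of X = {abs_mnum t | t. (t \<^bold>\<in> X) \<in> model_theory}"

lemma abs_mnum_in_set_of: "abs_mnum t \<in> set_of X \<longleftrightarrow> (t \<^bold>\<in> X) \<in> model_theory"
proof -
  have "(t \<^bold>\<in> X) \<in> model_theory"
    if "abs_mnum t = abs_mnum s" "(s \<^bold>\<in> X) \<in> model_theory" for s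
    using that model_theory_cong[of t s "V 0 \<^bold>\<in> X"] by (simp add: inst_num_def mnum.abs_eq_iff)
  then show ?thesis unfolding set_of_def by blast
qed

abbreviation MS :: "mnum set set" where "MS \<equiv> range set_of"

lemma ev_abs_mnum: "ev (\<lambda>n. abs_mnum (\<sigma> n)) t = abs_mnum (subst_tm \<sigma> t)"
  by (induction t)
    (auto simp: zero_mnum.abs_eq one_mnum.abs_eq plus_mnum.abs_eq times_mnum.abs_eq)

lemma abs_mnum_exists: "\<exists>t. x = abs_mnum t"
  by (metis Quotient_abs_rep Quotient_mnum)

text \<open>The quantifier steps need arbitrary \<sigma> and \<tau>: every element is the class of a
  term and every set of the model is named by a variable, so quantifiers amount to running over all
  instances.\<close>

lemma truth_lemma:
  "sat MS (\<lambda>n. abs_mnum (\<sigma> n)) (\<lambda>X. set_of (\<tau> X)) p \<longleftrightarrow> subst \<sigma> \<tau> p \<in> model_theory"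
proof (induction p arbitrary: \<sigma> \<tau>)
  case Falsum
  then show ?case using Henkin_Falsum[OF model_theory(2)] by simp
next
  case (Imp p q)
  then show ?case using Henkin_Imp[OF model_theory(2)] by simp
next
  case (AllN p)
  have "case_nat (abs_mnum t) (\<lambda>n. abs_mnum (\<sigma> n)) = (\<lambda>n. abs_mnum (case_nat t \<sigma> n))" for t
    by (intro ext) (auto split: nat.split)
  then have "sat MS (\<lambda>n. abs_mnum (\<sigma> n)) (\<lambda>X. set_of (\<tau> X)) (AllN p) \<longleftrightarrow>
      (\<forall>t. subst (case_nat t \<sigma>) \<tau> p \<in> model_theory)"
    using AllN by simp (metis abs_mnum_exists)
  then show ?case by (simp add: Henkin_AllN[OF model_theory(2)] inst_num_subst)
next
  case (AllS p)
  have "case_nat (set_of X) (\<lambda>n. set_of (\<tau> n)) = (\<lambda>n. set_of (case_nat X \<tau> n))" for X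
    by (intro ext) (auto split: nat.split)
  then have "sat MS (\<lambda>n. abs_mnum (\<sigma> n)) (\<lambda>X. set_of (\<tau> X)) (AllS p) \<longleftrightarrow>
      (\<forall>X. subst \<sigma> (case_nat X \<tau>) p \<in> model_theory)"
    using AllS by simp
  then show ?case by (simp add: Henkin_AllS[OF model_theory(2)] inst_set_subst)
qed (simp_all add: ev_abs_mnum mnum.abs_eq_iff less_mnum.abs_eq abs_mnum_in_set_of)

lemma model_theory_sat: "p \<in> model_theory \<longleftrightarrow> sat MS (\<lambda>n. abs_mnum (V n)) set_of p"
  using truth_lemma[of V id p] by (simp add: subst_id)

lemma model_axioms:
  assumes "p \<in> basic_axioms \<union> Sigma01_induction \<union> Delta01_comprehension" "range s \<subseteq> MS"
  shows "sat MS e s p"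
  using univ_closures_sat[OF _ subset_refl assms] RCA0_subset_model_theory model_theory_sat
  unfolding RCA0_def by blast

text \<open>If the implication were unprovable, \<open>counter_theory\<close> would contain its
  negation, and the term model would refute it.\<close>

lemma provable_if_true_in_model:
  assumes "sat MS (\<lambda>n. abs_mnum (V n)) set_of (TS2 \<^bold>\<longrightarrow> RRT22)"
  shows "RCA0 \<turnstile> TS2 \<^bold>\<longrightarrow> RRT22"
proof (rule proves.Classical, rule ccontr)
  assume "consistent (insert (\<^bold>\<not> (TS2 \<^bold>\<longrightarrow> RRT22)) RCA0)"
  then have "\<^bold>\<not> (TS2 \<^bold>\<longrightarrow> RRT22) \<in> model_theory"
    using model_theory(1) unfolding counter_theory_def by (auto simp: Let_def)
  then show False using assms model_theory_sat by auto
qed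


section \<open>Definability in the model\<close>

lemma Delta00_subst: "p \<in> Delta00 \<Longrightarrow> subst \<sigma> \<tau> p \<in> Delta00"
proof (induction arbitrary: \<sigma> rule: Delta00.induct)
  case (6 p t)
  have "subst_tm (up \<sigma>) (lift_tm t) = lift_tm (subst_tm \<sigma> t)"
    by (simp add: lift_tm_def subst_tm_subst_tm)
  then show ?case using 6 by (simp add: Delta00.intros)
next
  case (7 p t)
  have "subst_tm (up \<sigma>) (lift_tm t) = lift_tm (subst_tm \<sigma> t)"
    by (simp add: lift_tm_def subst_tm_subst_tm)
  then show ?case using 7 Delta00.intros(7)[OF 7(2)[of "up \<sigma>"], of "subst_tm \<sigma> t"] by simp
qed (simp_all add: Delta00.intros)

text \<open>The even number variables carry the arguments of a definable predicate. Every element of the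
  model is named by some term in the odd ones, so parameters need no separate bookkeeping.\<close>

definition mix :: "(nat \<Rightarrow> mnum) \<Rightarrow> nat \<Rightarrow> mnum" where
  "mix e n = (if even n then e (n div 2) else abs_mnum (V (n div 2)))"

definition TM :: "((nat \<Rightarrow> mnum) \<Rightarrow> mnum) \<Rightarrow> bool" where
  "TM f \<longleftrightarrow> (\<exists>t. \<forall>e. f e = ev (mix e) t)"

definition D0 :: "((nat \<Rightarrow> mnum) \<Rightarrow> bool) \<Rightarrow> bool" where
  "D0 P \<longleftrightarrow> (\<exists>p\<in>Delta00. \<forall>e. P e \<longleftrightarrow> sat MS (mix e) set_of p)"

named_theorems definable

lemma TM_var [definable]: "TM (\<lambda>e. e n)"
  unfolding TM_def by (intro exI[of _ "V (2 * n)"]) (simp add: mix_def)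

lemma TM_const [definable]: "TM (\<lambda>e. c)"
proof -
  obtain t where t: "c = abs_mnum t" using abs_mnum_exists by blast
  have "(\<lambda>n. ev (mix e) (V (Suc (2 * n)))) = (\<lambda>n. abs_mnum (V n))" for e
    by (simp add: mix_def)
  then have "c = ev (mix e) (subst_tm (\<lambda>n. V (Suc (2 * n))) t)" for e
    unfolding ev_subst_tm t using ev_abs_mnum[of V t] by (simp add: subst_tm_V)
  then show ?thesis unfolding TM_def by blast
qed

lemma TM_add [definable]: "TM s \<Longrightarrow> TM t \<Longrightarrow> TM (\<lambda>e. s e + t e)"
  unfolding TM_def by (metis ev.simps(4))

lemma TM_mult [definable]: "TM s \<Longrightarrow> TM t \<Longrightarrow> TM (\<lambda>e. s e * t e)"
  unfolding TM_def by (metis ev.simps(5))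

lemma D0_eq [definable]: "TM s \<Longrightarrow> TM t \<Longrightarrow> D0 (\<lambda>e. s e = t e)"
  unfolding TM_def D0_def by (metis sat.simps(2) Delta00.intros(2))

lemma D0_less [definable]: "TM s \<Longrightarrow> TM t \<Longrightarrow> D0 (\<lambda>e. s e < t e)"
  unfolding TM_def D0_def by (metis sat.simps(3) Delta00.intros(3))

lemma D0_mem [definable]: "TM s \<Longrightarrow> X \<in> MS \<Longrightarrow> D0 (\<lambda>e. s e \<in> X)"
  unfolding TM_def D0_def by (auto intro!: bexI[of _ "_ \<^bold>\<in> _"] Delta00.intros)

lemma D0_imp [definable]: "D0 P \<Longrightarrow> D0 Q \<Longrightarrow> D0 (\<lambda>e. P e \<longrightarrow> Q e)"
  unfolding D0_def by (metis sat.simps(5) Delta00.intros(5))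

lemma D0_False [definable]: "D0 (\<lambda>e. False)"
  unfolding D0_def by (metis sat.simps(1) Delta00.intros(1))

lemma D0_not [definable]: "D0 P \<Longrightarrow> D0 (\<lambda>e. \<not> P e)"
  using D0_imp[OF _ D0_False] by simp

lemma D0_conj [definable]: "D0 P \<Longrightarrow> D0 Q \<Longrightarrow> D0 (\<lambda>e. P e \<and> Q e)"
  using D0_not[OF D0_imp[OF _ D0_not]] by simp

lemma D0_disj [definable]: "D0 P \<Longrightarrow> D0 Q \<Longrightarrow> D0 (\<lambda>e. P e \<or> Q e)"
  using D0_imp[OF D0_not] by (simp add: disj_imp)

lemma D0_subst:
  assumes "D0 P" "\<And>n. TM (\<sigma> n)"
  shows "D0 (\<lambda>e. P (\<lambda>n. \<sigma> n e))"
proof -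
  obtain p where p: "p \<in> Delta00" "\<And>e. P e \<longleftrightarrow> sat MS (mix e) set_of p"
    using assms(1) unfolding D0_def by blast
  obtain t where t: "\<And>n e. \<sigma> n e = ev (mix e) (t n)"
    using assms(2) unfolding TM_def by metis
  let ?\<rho> = "\<lambda>n. if even n then t (n div 2) else V n"
  have "(\<lambda>n. ev (mix e) (?\<rho> n)) = mix (\<lambda>n. \<sigma> n e)" for e
    by (auto simp: mix_def t)
  then have "P (\<lambda>n. \<sigma> n e) \<longleftrightarrow> sat MS (mix e) set_of (subst ?\<rho> id p)" for e
    unfolding sat_subst by (simp add: p(2))
  then show ?thesis unfolding D0_def using p(1) Delta00_subst by blast
qed

lemma D0_ball [definable]:
  assumes "D0 (\<lambda>e. P (e 0) (\<lambda>n. e (Suc n)))" "TM t"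
  shows "D0 (\<lambda>e. \<forall>y<t e. P y e)"
proof -
  obtain p where p: "p \<in> Delta00" "\<And>e. P (e 0) (\<lambda>n. e (Suc n)) \<longleftrightarrow> sat MS (mix e) set_of p"
    using assms(1) unfolding D0_def by blast
  obtain u where u: "\<And>e. t e = ev (mix e) u"
    using assms(2) unfolding TM_def by blast
  \<comment> \<open>Binding y shifts every index by one, which would exchange the even argument
    slots with the odd parameter slots. The renaming sends each index to the place where its value
    now stands.\<close>
  let ?\<rho> = "\<lambda>n. V (if n = 0 then 0 else if even n then n - 1 else n + 1)"
  have "(\<lambda>n. ev (case_nat y (mix e)) (?\<rho> n)) = mix (case_nat y e)" for e y
  proof
    fix n
    show "ev (case_nat y (mix e)) (?\<rho> n) = mix (case_nat y e) n"
    proof (cases "even n")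
      case True
      then obtain k where "n = 2 * k" by blast
      then show ?thesis by (cases k) (simp_all add: mix_def)
    next
      case False
      then obtain k where "n = 2 * k + 1" by (metis oddE)
      then show ?thesis by (simp add: mix_def)
    qed
  qed
  then have "P y e \<longleftrightarrow> sat MS (case_nat y (mix e)) set_of (subst ?\<rho> id p)" for e y
    using p(2)[of "case_nat y e"] unfolding sat_subst by simp
  then have "(\<forall>y<t e. P y e) \<longleftrightarrow>
      sat MS (mix e) set_of (AllN (V 0 \<^bold>< lift_tm u \<^bold>\<longrightarrow> subst ?\<rho> id p))" for e
    by (simp add: ev_lift_tm u)
  then show ?thesis unfolding D0_def using p(1) Delta00_subst Delta00.intros(6) by blast
qed

lemma D0_bex [definable]:
  assumes "D0 (\<lambda>e. P (e 0) (\<lambda>n. e (Suc n)))" "TM t"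
  shows "D0 (\<lambda>e. \<exists>y<t e. P y e)"
  using D0_not[OF D0_ball[OF D0_not[OF assms(1)] assms(2)]] by simp

text \<open>\<open>Sg\<close> is \<open>\<Sigma>\<^sup>0\<^sub>1\<close>-definability with parameters; \<open>Rec\<close> and \<open>RecF\<close> below are the
  \<open>\<Delta>\<^sup>0\<^sub>1\<close> predicates and functions.\<close>

definition Sg :: "((nat \<Rightarrow> mnum) \<Rightarrow> bool) \<Rightarrow> bool" where
  "Sg P \<longleftrightarrow> (\<exists>Q. D0 Q \<and> (\<forall>e. P e \<longleftrightarrow> (\<exists>y. Q (case_nat y e))))"

lemma Sg_D0: "D0 P \<Longrightarrow> Sg P"
  unfolding Sg_def using D0_subst[of P "\<lambda>n e. e (Suc n)"]
  by (intro exI[of _ "\<lambda>e. P (\<lambda>n. e (Suc n))"]) (simp add: TM_var)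

lemma Sg_ex_D0:
  assumes "D0 (\<lambda>e. P (e 0) (\<lambda>n. e (Suc n)))"
  shows "Sg (\<lambda>e. \<exists>y. P y e)"
  unfolding Sg_def by (rule exI, rule conjI, rule assms) simp


lemma Sg_Sigma01:
  assumes "Sg P"
  shows "\<exists>p\<in>Delta00. \<forall>x. P (case_nat x e) \<longleftrightarrow> (\<exists>y. sat MS (case_nat y (case_nat x (mix e))) set_of p)"
proof -
  obtain Q where Q: "D0 Q" "\<And>e. P e \<longleftrightarrow> (\<exists>y. Q (case_nat y e))"
    using assms unfolding Sg_def by blast
  then obtain p where p: "p \<in> Delta00" "\<And>e. Q e \<longleftrightarrow> sat MS (mix e) set_of p"
    unfolding D0_def by blast
  \<comment> \<open>Two binders shift by two and keep the parity, but y and x have to be moved from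
    the argument slots 0 and 2 to the bound indices 0 and 1.\<close>
  let ?\<rho> = "\<lambda>n. V (if n = 0 then 0 else if n = 2 then 1 else if even n then n - 2 else n + 2)"
  have "(\<lambda>n. ev (case_nat y (case_nat x (mix e))) (?\<rho> n)) = mix (case_nat y (case_nat x e))" for x y
  proof
    fix n
    show "ev (case_nat y (case_nat x (mix e))) (?\<rho> n) = mix (case_nat y (case_nat x e)) n"
    proof (cases "even n")
      case True
      then obtain k where k: "n = 2 * k" by blast
      consider "k = 0" | "k = 1" | j where "k = Suc (Suc j)" by (cases k; cases "k - 1") auto
      then show ?thesis by cases (simp_all add: mix_def k)
    next
      case False
      then obtain k where "n = 2 * k + 1" by (metis oddE)
      then show ?thesis by (simp add: mix_def)
    qed
  qed
  then have "P (case_nat x e) \<longleftrightarrow> (\<exists>y. sat MS (case_nat y (case_nat x (mix e))) set_of (subst ?\<rho> id p))"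
    for x by (simp add: sat_subst Q(2) p(2))
  then show ?thesis using Delta00_subst p(1) by blast
qed

text \<open>The induction scheme, freed from syntax: every later induction inside the model rests on
  this lemma.\<close>

lemma Sg_induct:
  assumes "Sg (\<lambda>e. \<phi> (e 0))" "\<phi> 0" "\<And>x. \<phi> x \<Longrightarrow> \<phi> (x + 1)"
  shows "\<phi> x"
proof -
  fix e :: "nat \<Rightarrow> mnum"
  obtain q where q: "q \<in> Delta00"
    "\<And>x. \<phi> x \<longleftrightarrow> (\<exists>y. sat MS (case_nat y (case_nat x (mix e))) set_of q)"
    using Sg_Sigma01[OF assms(1), of e] by auto
  let ?p = "ExN q"
  have p: "\<phi> x \<longleftrightarrow> sat MS (case_nat x (mix e)) set_of ?p" for x using q(2) by simp
  let ?ax = "inst_num Zero ?p \<^bold>\<and>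
      AllN (?p \<^bold>\<longrightarrow> subst (case_nat (V 0 \<^bold>+ One) (\<lambda>n. V (Suc n))) id ?p) \<^bold>\<longrightarrow> AllN ?p"
  have "?ax \<in> Sigma01_induction" using q(1) unfolding Sigma01_induction_def Sigma01_def by blast
  then have ax: "sat MS (mix e) set_of ?ax" by (intro model_axioms) blast+
  have *: "(\<lambda>n. ev (case_nat x e) (case_nat (V 0 \<^bold>+ One) (\<lambda>n. V (Suc n)) n)) = case_nat (x + 1) e"
    for x and e :: "nat \<Rightarrow> mnum" by (intro ext) (auto split: nat.split)
  have **: "sat MS (case_nat x (mix e)) set_of (subst (case_nat (V 0 \<^bold>+ One) (\<lambda>n. V (Suc n))) id ?p)
      \<longleftrightarrow> \<phi> (x + 1)" for x
    unfolding sat_subst * p by simp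
  have "sat MS (mix e) set_of (inst_num Zero ?p)" using assms(2) unfolding sat_inst_num p by simp
  moreover have "\<forall>x. sat MS (case_nat x (mix e)) set_of
      (?p \<^bold>\<longrightarrow> subst (case_nat (V 0 \<^bold>+ One) (\<lambda>n. V (Suc n))) id ?p)"
    using assms(3) unfolding sat.simps(5)[of _ _ _ ?p] ** p[symmetric] by blast
  ultimately have "sat MS (mix e) set_of (AllN ?p)" using ax by (metis sat.simps(1,5,6))
  then show ?thesis unfolding p by simp
qed

lemma sat_AllN_Iff:
  "sat S e s (AllN (p \<^bold>\<longleftrightarrow> q)) \<longleftrightarrow> (\<forall>x. sat S (case_nat x e) s p \<longleftrightarrow> sat S (case_nat x e) s q)"
  by auto

lemma sat_ExS: "sat S e s (ExS p) \<longleftrightarrow> (\<exists>X\<in>S. sat S e (case_nat X s) p)"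
  by simp

lemma Sg_comprehension:
  assumes "Sg (\<lambda>e. \<phi> (e 0))" "Sg (\<lambda>e. \<not> \<phi> (e 0))"
  shows "{x. \<phi> x} \<in> MS"
proof -
  fix e :: "nat \<Rightarrow> mnum"
  obtain p q where p: "p \<in> Delta00"
      "\<And>x. \<phi> x \<longleftrightarrow> (\<exists>y. sat MS (case_nat y (case_nat x (mix e))) set_of p)"
    and q: "q \<in> Delta00"
      "\<And>x. \<not> \<phi> x \<longleftrightarrow> (\<exists>y. sat MS (case_nat y (case_nat x (mix e))) set_of q)"
    using Sg_Sigma01[OF assms(1), of e] Sg_Sigma01[OF assms(2), of e] by auto
  \<comment> \<open>The universal form of \<phi> demanded by the scheme negates the matrix q of its
    complement.\<close>
  let ?ax = "AllN (ExN p \<^bold>\<longleftrightarrow> AllN (\<^bold>\<not> q)) \<^bold>\<longrightarrow> ExS (AllN (V 0 \<^bold>\<in> 0 \<^bold>\<longleftrightarrow> lift_set (ExN p)))"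
  have "\<^bold>\<not> q \<in> Delta00" using q(1) by (simp add: Delta00.intros)
  then have "?ax \<in> Delta01_comprehension"
    using p(1) unfolding Delta01_comprehension_def Sigma01_def Pi01_def by blast
  then have ax: "sat MS (mix e) set_of ?ax" by (intro model_axioms) blast+
  have phi: "\<phi> x \<longleftrightarrow> sat MS (case_nat x (mix e)) set_of (ExN p)"
    "\<phi> x \<longleftrightarrow> sat MS (case_nat x (mix e)) set_of (AllN (\<^bold>\<not> q))" for x
    using p(2)[of x] q(2)[of x] by auto
  have "sat MS (mix e) set_of (AllN (ExN p \<^bold>\<longleftrightarrow> AllN (\<^bold>\<not> q)))"
    unfolding sat_AllN_Iff using phi by blast
  then have "sat MS (mix e) set_of (ExS (AllN (V 0 \<^bold>\<in> 0 \<^bold>\<longleftrightarrow> lift_set (ExN p))))"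
    using ax sat.simps(5) by blast
  then obtain X where X: "X \<in> MS"
      "sat MS (mix e) (case_nat X set_of) (AllN (V 0 \<^bold>\<in> 0 \<^bold>\<longleftrightarrow> lift_set (ExN p)))"
    unfolding sat_ExS by blast
  have "(x \<in> X) \<longleftrightarrow> \<phi> x" for x
    using X(2) unfolding sat_AllN_Iff sat_lift_set phi(1)[symmetric] by simp
  then have "{x. \<phi> x} = X" by blast
  then show ?thesis using X(1) by simp
qed


section \<open>Arithmetic in the model\<close>

lemma basic_sat: "p \<in> basic_axioms \<Longrightarrow> sat MS (\<lambda>n. case n of 0 \<Rightarrow> x | Suc _ \<Rightarrow> y) set_of p"
  by (rule model_axioms) auto

lemma basic:
  fixes x y :: mnum
  shows add_one_neq_0: "x + 1 \<noteq> 0"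
    and add_one_inject: "x + 1 = y + 1 \<Longrightarrow> x = y"
    and mnum_add_0: "x + 0 = x"
    and mnum_add_one: "x + (y + 1) = (x + y) + 1"
    and mnum_mult_0: "x * 0 = 0"
    and mnum_mult_one: "x * (y + 1) = x * y + x"
    and mnum_not_less_0: "\<not> x < 0"
    and mnum_less_add_one: "x < y + 1 \<longleftrightarrow> x < y \<or> x = y"
proof -
  have "\<forall>p\<in>basic_axioms. sat MS (\<lambda>n. case n of 0 \<Rightarrow> x | Suc _ \<Rightarrow> y) set_of p"
    using basic_sat by blast
  then have *: "x + 1 \<noteq> 0 \<and> (x + 1 = y + 1 \<longrightarrow> x = y) \<and> x + 0 = x \<and> x + (y + 1) = (x + y) + 1 \<and>
      x * 0 = 0 \<and> x * (y + 1) = x * y + x \<and> \<not> x < 0 \<and> (x < y + 1 \<longleftrightarrow> x < y \<or> x = y)"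
    unfolding basic_axioms_def by simp metis
  show "x + 1 \<noteq> 0" "x + 0 = x" "x + (y + 1) = (x + y) + 1" "x * 0 = 0"
    "x * (y + 1) = x * y + x" "\<not> x < 0" "x < y + 1 \<longleftrightarrow> x < y \<or> x = y"
    by (simp_all add: *)
  show "x + 1 = y + 1 \<Longrightarrow> x = y" using * by metis
qed

section \<open>Semiring laws and the order\<close>

lemma mnum_D0_induct:
  fixes x :: mnum
  assumes "D0 (\<lambda>e. \<phi> (e 0))" "\<phi> 0" "\<And>x. \<phi> x \<Longrightarrow> \<phi> (x + 1)"
  shows "\<phi> x"
  by (rule Sg_induct[of \<phi>]) (use assms Sg_D0 in auto)

lemma mnum_cases: "(x::mnum) = 0 \<or> (\<exists>y. x = y + 1)"
  by (rule Sg_induct[of "\<lambda>x. x = 0 \<or> (\<exists>y. x = y + 1)"])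
    (auto intro!: exI[of _ "\<lambda>e. e 1 = 0 \<or> e 1 = e 0 + 1"] definable simp: Sg_def)

lemma mnum_0_add: "0 + x = (x::mnum)"
  by (rule mnum_D0_induct[of "\<lambda>x. 0 + x = x"])
    (auto intro!: definable simp: mnum_add_0 mnum_add_one)

lemma mnum_add_one_left: "(x + 1) + y = (x + y) + (1::mnum)"
  by (rule mnum_D0_induct[of "\<lambda>y. (x + 1) + y = (x + y) + 1"])
    (auto intro!: definable simp: mnum_add_0 mnum_add_one)

lemma mnum_add_commute: "x + y = y + (x::mnum)"
  by (rule mnum_D0_induct[of "\<lambda>y. x + y = y + x"])
    (auto intro!: definable simp: mnum_add_0 mnum_0_add mnum_add_one mnum_add_one_left)

lemma mnum_add_assoc: "x + y + z = x + (y + (z::mnum))"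
  by (rule mnum_D0_induct[of "\<lambda>z. x + y + z = x + (y + z)"])
    (auto intro!: definable simp: mnum_add_0 mnum_add_one)

instance mnum :: comm_monoid_add
  by standard (rule mnum_add_assoc, rule mnum_add_commute, rule mnum_0_add)

lemma mnum_add_left_cancel: "x + y = x + z \<Longrightarrow> y = (z::mnum)"
proof -
  have "x + y = x + z \<longrightarrow> y = z"
    by (rule mnum_D0_induct[of "\<lambda>x. x + y = x + z \<longrightarrow> y = z"])
      (auto intro!: definable dest!: add_one_inject simp: mnum_0_add mnum_add_one_left)
  then show "x + y = x + z \<Longrightarrow> y = z" by blast
qed

lemma mnum_0_mult: "0 * x = (0::mnum)"
  by (rule mnum_D0_induct[of "\<lambda>x. 0 * x = 0"])
    (auto intro!: definable simp: mnum_mult_0 mnum_mult_one)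

lemma mnum_mult_one_left: "(x + 1) * y = x * y + (y::mnum)"
  by (rule mnum_D0_induct[of "\<lambda>y. (x + 1) * y = x * y + y"])
    (auto intro!: definable simp: mnum_mult_0 mnum_mult_one ac_simps)

lemma mnum_mult_commute: "x * y = y * (x::mnum)"
  by (rule mnum_D0_induct[of "\<lambda>y. x * y = y * x"])
    (auto intro!: definable simp: mnum_mult_0 mnum_0_mult mnum_mult_one mnum_mult_one_left)

lemma mnum_distrib: "x * (y + z) = x * y + x * (z::mnum)"
  by (rule mnum_D0_induct[of "\<lambda>z. x * (y + z) = x * y + x * z"])
    (auto intro!: definable simp: mnum_mult_0 mnum_mult_one add.assoc[symmetric])

lemma mnum_mult_1: "x * 1 = (x::mnum)"
  using mnum_mult_one[of x 0] by (simp add: mnum_mult_0 mnum_0_add)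

lemma mnum_mult_assoc: "x * y * z = x * (y * (z::mnum))"
  by (rule mnum_D0_induct[of "\<lambda>z. x * y * z = x * (y * z)"])
    (auto intro!: definable simp: mnum_mult_0 mnum_mult_1 mnum_mult_one mnum_distrib)

text \<open>The axioms describe the order only through zero and successor. This form reduces it to
  addition, so that the order laws follow from cancellation.\<close>

lemma mnum_less_iff: "x < y \<longleftrightarrow> (\<exists>z. y = x + z + (1::mnum))"
proof
  have "x < y \<longrightarrow> (\<exists>z. y = x + z + 1)"
  proof (rule Sg_induct[of "\<lambda>y. x < y \<longrightarrow> (\<exists>z. y = x + z + 1)"])
    show "Sg (\<lambda>e. x < e 0 \<longrightarrow> (\<exists>z. e 0 = x + z + 1))"
      unfolding Sg_def
      by (intro exI[of _ "\<lambda>e. x < e 1 \<longrightarrow> e 1 = x + e 0 + 1"]) (auto intro!: definable)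
    fix y assume IH: "x < y \<longrightarrow> (\<exists>z. y = x + z + 1)"
    show "x < y + 1 \<longrightarrow> (\<exists>z. y + 1 = x + z + 1)"
      using IH by (metis mnum_less_add_one add.assoc add.right_neutral)
  qed (simp add: mnum_not_less_0)
  then show "x < y \<Longrightarrow> \<exists>z. y = x + z + 1" by blast
next
  have "x < x + z + 1" for z
    by (rule mnum_D0_induct[of "\<lambda>z. x < x + z + 1"])
      (auto intro!: definable simp: mnum_less_add_one add.assoc[symmetric])
  then show "\<exists>z. y = x + z + 1 \<Longrightarrow> x < y" by blast
qed

lemma mnum_le_iff: "x \<le> y \<longleftrightarrow> (\<exists>z. y = x + (z::mnum))"
proof -
  have "(\<exists>z. y = x + z) \<longleftrightarrow> y = x \<or> (\<exists>z. y = x + z + 1)"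
    by (metis mnum_cases add.assoc add.right_neutral)
  then show ?thesis unfolding less_eq_mnum_def mnum_less_iff by auto
qed

lemma mnum_add_eq_0: "x + y = 0 \<Longrightarrow> x = (0::mnum)"
  by (metis mnum_cases add_one_neq_0 mnum_add_one_left)

lemma mnum_linear: "x \<le> y \<or> y \<le> (x::mnum)"
proof (rule mnum_D0_induct[of "\<lambda>y. x \<le> y \<or> y \<le> x"])
  show "D0 (\<lambda>e. x \<le> e 0 \<or> e 0 \<le> x)" unfolding less_eq_mnum_def by (intro definable)
  show "x \<le> 0 \<or> 0 \<le> x" unfolding mnum_le_iff by (metis add.left_neutral)
  fix y assume "x \<le> y \<or> y \<le> x"
  then consider z where "y = x + z" | z where "x = y + z + 1"
    unfolding mnum_le_iff by (metis add.assoc add.right_neutral mnum_cases)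
  then show "x \<le> y + 1 \<or> y + 1 \<le> x"
  proof cases
    case 1 then show ?thesis unfolding mnum_le_iff by (metis add.assoc)
  next
    case 2 then show ?thesis unfolding mnum_le_iff by (metis add.assoc add.commute)
  qed
qed

instantiation mnum :: minus
begin

text \<open>Truncated, as \<open>linordered_semidom\<close> requires; the difference exists by
  \<open>mnum_le_iff\<close> and is unique by cancellation.\<close>

definition minus_mnum :: "mnum \<Rightarrow> mnum \<Rightarrow> mnum" where
  "minus_mnum x y = (if y \<le> x then THE z. x = y + z else 0)"

instance ..

end

instance mnum :: linordered_semidom
proof
  fix x y z :: mnum
  have antisym: "x \<le> y \<Longrightarrow> y \<le> x \<Longrightarrow> x = y" for x y :: mnum
  proof -
    assume "x \<le> y" "y \<le> x"
    then obtain u v where uv: "y = x + u" "x = y + v" unfolding mnum_le_iff by blast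
    then have "x + (u + v) = x + 0" by (simp add: add.assoc[symmetric])
    then have "u = 0" by (metis mnum_add_left_cancel mnum_add_eq_0)
    then show "x = y" using uv by simp
  qed
  show "x * y * z = x * (y * z)" by (rule mnum_mult_assoc)
  show "x * y = y * x" by (rule mnum_mult_commute)
  show "1 * x = x" by (metis mnum_mult_commute mnum_mult_1)
  show "(x + y) * z = x * z + y * z" by (metis mnum_mult_commute mnum_distrib)
  show "x * (y + z) = x * y + x * z" by (rule mnum_distrib)
  show "0 * x = 0" "x * 0 = 0" by (rule mnum_0_mult mnum_mult_0)+
  show "(0::mnum) \<noteq> 1" using add_one_neq_0[of 0] by (simp add: mnum_0_add)
  have add_diff: "x + y - x = y" for x y :: mnum
  proof -
    have "x \<le> x + y" unfolding mnum_le_iff by blast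
    then show ?thesis unfolding minus_mnum_def by (auto intro: mnum_add_left_cancel[symmetric])
  qed
  show "x + y - x = y" by (rule add_diff)
  have not_le: "x - y = 0" if "\<not> y \<le> x" for x y :: mnum
    using that unfolding minus_mnum_def by simp
  show "x - y - z = x - (y + z)"
  proof (cases "y \<le> x")
    case False
    then have "\<not> y + z \<le> x" unfolding mnum_le_iff by (metis add.assoc)
    have "0 - z = 0"
    proof (cases "z \<le> 0")
      case True
      then have "z = 0" unfolding mnum_le_iff by (metis mnum_add_eq_0)
      then show ?thesis using add_diff[of 0 0] by simp
    qed (rule not_le)
    then show ?thesis using not_le[OF False] not_le[OF \<open>\<not> y + z \<le> x\<close>] by simp
  next
    case True
    then obtain u where u: "x = y + u" unfolding mnum_le_iff by blast
    show ?thesis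
    proof (cases "z \<le> u")
      case True
      then obtain v where "u = z + v" unfolding mnum_le_iff by blast
      then show ?thesis unfolding u by (metis add_diff add.assoc)
    next
      case False
      then have "\<not> y + z \<le> x" unfolding mnum_le_iff u by (metis add.assoc mnum_add_left_cancel)
      then show ?thesis using not_le[OF False] not_le add_diff u by metis
    qed
  qed
  show "x \<le> x" unfolding less_eq_mnum_def by simp
  show "x \<le> y \<or> y \<le> x" by (rule mnum_linear)
  show "x \<le> y \<Longrightarrow> y \<le> x \<Longrightarrow> x = y" by (rule antisym)
  show "x \<le> y \<Longrightarrow> y \<le> z \<Longrightarrow> x \<le> z" unfolding mnum_le_iff by (metis add.assoc)
  have irrefl: "\<not> x < x" for x :: mnum
    unfolding mnum_less_iff by (metis add.assoc add.right_neutral add_one_neq_0 mnum_add_left_cancel)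
  show "(x < y) = (x \<le> y \<and> \<not> y \<le> x)"
    using antisym[of x y] irrefl unfolding less_eq_mnum_def by metis
  show "x \<le> y \<Longrightarrow> z + x \<le> z + y" unfolding mnum_le_iff by (metis add.assoc)
  have pos: "0 < x \<Longrightarrow> \<exists>z. x = z + 1" for x :: mnum
    unfolding mnum_less_iff by (metis add.left_neutral)
  show "x < y \<Longrightarrow> 0 < z \<Longrightarrow> z * x < z * y"
  proof -
    assume "x < y" "0 < z"
    then obtain u v where "y = x + u + 1" "z = v + 1" using pos unfolding mnum_less_iff by blast
    then have "z * y = z * x + (z * u + v) + 1"
      by (simp add: mnum_distrib mnum_mult_1 add.assoc)
    then show "z * x < z * y" unfolding mnum_less_iff by blast
  qed
  show "(0::mnum) < 1" unfolding mnum_less_iff by (metis add.left_neutral)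
  show "y \<le> x \<Longrightarrow> x - y + y = x"
    unfolding mnum_le_iff using add_diff by (metis add.commute)
  show mult_diff: "x * (y - z) = x * y - x * z"
  proof (cases "z \<le> y")
    case True
    then obtain u where "y = z + u" unfolding mnum_le_iff by blast
    then show ?thesis by (simp add: add_diff mnum_distrib)
  next
    case False
    then obtain u where u: "z = y + u" using mnum_linear unfolding mnum_le_iff by blast
    then show ?thesis
    proof (cases "x * z \<le> x * y")
      case True
      then have "x * y = x * z" using u antisym unfolding mnum_le_iff
        by (metis mnum_distrib mnum_le_iff)
      then show ?thesis using not_le[OF False] add_diff[of "x * z" 0] by (simp add: mnum_mult_0)
    next
      case F: False
      then show ?thesis using not_le[OF False] not_le[OF F] by (simp add: mnum_mult_0)
    qed
  qed
  show "x \<noteq> 0 \<Longrightarrow> y \<noteq> 0 \<Longrightarrow> x * y \<noteq> 0"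
    by (metis mnum_cases mnum_mult_one mnum_add_eq_0 mnum_add_one add_one_neq_0)
qed

lemma mnum_less_add_one_iff [simp]: "x < y + 1 \<longleftrightarrow> x \<le> (y::mnum)"
  by (auto simp: mnum_less_add_one)

lemma mnum_add_one_le_iff [simp]: "x + 1 \<le> y \<longleftrightarrow> x < (y::mnum)"
  by (metis linorder_not_less mnum_less_add_one_iff)

lemma mnum_zero_le [simp]: "0 \<le> (x::mnum)"
  unfolding mnum_le_iff by simp

lemma mnum_le_zero [simp]: "x \<le> 0 \<longleftrightarrow> x = (0::mnum)"
  by (meson mnum_zero_le antisym order_refl)


section \<open>Recursive predicates and functions\<close>

text \<open>A witness is replaced by a bound for it. Bounds can be raised, so two of them merge into
  their maximum, and no pairing function is needed at this stage.\<close>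

lemma Sg_mono_form:
  assumes "Sg P"
  obtains R where "D0 (\<lambda>e. R (e 0) (\<lambda>n. e (Suc n)))" "\<And>e. P e \<longleftrightarrow> (\<exists>y. R y e)"
    "\<And>y y' e. R y e \<Longrightarrow> y \<le> y' \<Longrightarrow> R y' e"
proof -
  obtain Q where Q: "D0 Q" "\<And>e. P e \<longleftrightarrow> (\<exists>y. Q (case_nat y e))"
    using assms unfolding Sg_def by blast
  have D: "D0 (\<lambda>e. Q (case_nat (e 0) (\<lambda>n. e (Suc (Suc n)))))"
  proof -
    let ?\<sigma> = "\<lambda>n e. case_nat (e 0) (\<lambda>n. e (Suc (Suc n))) n :: mnum"
    have "TM (?\<sigma> n)" for n by (cases n) (simp_all add: TM_var)
    then show ?thesis using D0_subst[OF Q(1), of ?\<sigma>] by simp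
  qed
  show ?thesis
  proof
    show "D0 (\<lambda>e. \<exists>y<e 0 + 1. Q (case_nat y (\<lambda>n. e (Suc n))))"
      by (rule D0_bex) (use D in \<open>auto intro!: definable\<close>)
    show "P e \<longleftrightarrow> (\<exists>b. \<exists>y<b + 1. Q (case_nat y e))" for e
      using Q(2) by auto
    show "\<exists>y<b + 1. Q (case_nat y e) \<Longrightarrow> b \<le> b' \<Longrightarrow> \<exists>y<b' + 1. Q (case_nat y e)" for b b' e
      by (auto intro: order_trans)
  qed
qed

lemma Sg_conj:
  assumes "Sg P" "Sg P'"
  shows "Sg (\<lambda>e. P e \<and> P' e)"
proof -
  from assms(1) obtain R where R: "D0 (\<lambda>e. R (e 0) (\<lambda>n. e (Suc n)))"
    "\<And>e. P e \<longleftrightarrow> (\<exists>y. R y e)" "\<And>y y' e. R y e \<Longrightarrow> y \<le> y' \<Longrightarrow> R y' e" by (rule Sg_mono_form) blast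
  from assms(2) obtain R' where R': "D0 (\<lambda>e. R' (e 0) (\<lambda>n. e (Suc n)))"
    "\<And>e. P' e \<longleftrightarrow> (\<exists>y. R' y e)" "\<And>y y' e. R' y e \<Longrightarrow> y \<le> y' \<Longrightarrow> R' y' e" by (rule Sg_mono_form) blast
  have "P e \<and> P' e \<longleftrightarrow> (\<exists>y. R y e \<and> R' y e)" for e
    using R(2,3) R'(2,3) by (metis linorder_linear)
  then show ?thesis using Sg_ex_D0[OF D0_conj[OF R(1) R'(1)]] by simp
qed

lemma Sg_disj:
  assumes "Sg P" "Sg P'"
  shows "Sg (\<lambda>e. P e \<or> P' e)"
proof -
  from assms(1) obtain R where R: "D0 (\<lambda>e. R (e 0) (\<lambda>n. e (Suc n)))"
    "\<And>e. P e \<longleftrightarrow> (\<exists>y. R y e)" by (rule Sg_mono_form) blast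
  from assms(2) obtain R' where R': "D0 (\<lambda>e. R' (e 0) (\<lambda>n. e (Suc n)))"
    "\<And>e. P' e \<longleftrightarrow> (\<exists>y. R' y e)" by (rule Sg_mono_form) blast
  have "P e \<or> P' e \<longleftrightarrow> (\<exists>y. R y e \<or> R' y e)" for e
    using R(2) R'(2) by blast
  then show ?thesis using Sg_ex_D0[OF D0_disj[OF R(1) R'(1)]] by simp
qed

lemma D0_swap:
  assumes "D0 (\<lambda>e. R (e 0) (\<lambda>n. e (Suc n)))"
  shows "D0 (\<lambda>e. R (e (Suc 0)) (case_nat (e 0) (\<lambda>n. e (Suc (Suc n)))))"
proof -
  let ?\<sigma> = "\<lambda>n e. case_nat (e (Suc 0)) (case_nat (e 0) (\<lambda>n. e (Suc (Suc n)))) n :: mnum"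
  have "TM (?\<sigma> n)" for n by (cases n; cases "n - 1") (auto simp: TM_var)
  then show ?thesis using D0_subst[OF assms, of ?\<sigma>] by simp
qed

text \<open>Two unbounded quantifiers contract into one: a single w bounds the outer value and the
  inner witness.\<close>

lemma Sg_ex:
  assumes "Sg (\<lambda>e. P (e 0) (\<lambda>n. e (Suc n)))"
  shows "Sg (\<lambda>e. \<exists>y. P y e)"
proof -
  from assms obtain R where R: "D0 (\<lambda>e. R (e 0) (\<lambda>n. e (Suc n)))"
    "\<And>e. P (e 0) (\<lambda>n. e (Suc n)) \<longleftrightarrow> (\<exists>y. R y e)" "\<And>y y' e. R y e \<Longrightarrow> y \<le> y' \<Longrightarrow> R y' e"
    by (rule Sg_mono_form) blast
  have "Sg (\<lambda>e. \<exists>w. \<exists>y<w + 1. R w (case_nat y e))"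
    by (rule Sg_ex_D0, rule D0_bex) (use D0_swap[OF R(1)] in \<open>auto intro!: definable\<close>)
  moreover have "(\<exists>y. P y e) \<longleftrightarrow> (\<exists>w. \<exists>y<w + 1. R w (case_nat y e))" for e
  proof
    assume "\<exists>y. P y e"
    then obtain y w where "R w (case_nat y e)" using R(2)[of "case_nat _ e"] by auto
    then have "R (max w y) (case_nat y e)" using R(3) by (meson max.cobounded1)
    then show "\<exists>w. \<exists>y<w + 1. R w (case_nat y e)" by (intro exI[of _ "max w y"] exI[of _ y]) auto
  qed (use R(2)[of "case_nat _ e"] in auto)
  ultimately show ?thesis by simp
qed

text \<open>For a total function a \<Sigma>_1 graph is enough; its complement is treated in
  \<open>RecF_graph\<close>.\<close>

definition RecF :: "((nat \<Rightarrow> mnum) \<Rightarrow> mnum) \<Rightarrow> bool" where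
  "RecF f \<longleftrightarrow> Sg (\<lambda>e. e 0 = f (\<lambda>n. e (Suc n)))"

definition Rec :: "((nat \<Rightarrow> mnum) \<Rightarrow> bool) \<Rightarrow> bool" where
  "Rec P \<longleftrightarrow> Sg P \<and> Sg (\<lambda>e. \<not> P e)"

lemma Sg_subst_TM:
  assumes "Sg P" "\<And>n. TM (\<sigma> n)"
  shows "Sg (\<lambda>e. P (\<lambda>n. \<sigma> n e))"
proof -
  obtain Q where Q: "D0 Q" "\<And>e. P e \<longleftrightarrow> (\<exists>y. Q (case_nat y e))"
    using assms unfolding Sg_def by blast
  let ?\<sigma> = "\<lambda>n e. case_nat (e 0) (\<lambda>n. \<sigma> n (\<lambda>n. e (Suc n))) n :: mnum"
  have "TM (\<lambda>e. \<sigma> n (\<lambda>n. e (Suc n)))" for n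
  proof -
    obtain t where t: "\<And>e. \<sigma> n e = ev (mix e) t" using assms(2) unfolding TM_def by blast
    let ?r = "\<lambda>n. V (if even n then n + 2 else n)"
    have "(\<lambda>n. ev (mix e) (?r n)) = mix (\<lambda>n. e (Suc n))" for e
      by (auto simp: mix_def)
    then have "\<sigma> n (\<lambda>n. e (Suc n)) = ev (mix e) (subst_tm ?r t)" for e
      unfolding t by (simp add: ev_subst_tm)
    then show ?thesis unfolding TM_def by blast
  qed
  then have "TM (?\<sigma> n)" for n by (cases n) (simp_all add: TM_var)
  then have "D0 (\<lambda>e. Q (case_nat (e 0) (\<lambda>n. \<sigma> n (\<lambda>n. e (Suc n)))))"
    using D0_subst[OF Q(1), of ?\<sigma>] by simp
  then have "Sg (\<lambda>e. \<exists>y. Q (case_nat y (\<lambda>n. \<sigma> n e)))"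
    by (intro Sg_ex_D0) simp
  then show ?thesis by (simp add: Q(2))
qed

lemma Rec_subst_TM:
  assumes "Rec P" "\<And>n. TM (\<sigma> n)"
  shows "Rec (\<lambda>e. P (\<lambda>n. \<sigma> n e))"
  using Sg_subst_TM[of P \<sigma>] Sg_subst_TM[of "\<lambda>e. \<not> P e" \<sigma>] assms unfolding Rec_def by blast

lemma Rec_D0: "D0 P \<Longrightarrow> Rec P"
  unfolding Rec_def by (simp add: Sg_D0 D0_not)

lemma Sg_Rec: "Rec P \<Longrightarrow> Sg P"
  unfolding Rec_def by simp

named_theorems recs

lemma Rec_not [recs]: "Rec P \<Longrightarrow> Rec (\<lambda>e. \<not> P e)"
  unfolding Rec_def by simp

lemma Rec_conj [recs]:
  assumes "Rec P" "Rec Q"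
  shows "Rec (\<lambda>e. P e \<and> Q e)"
proof -
  have "Sg (\<lambda>e. P e \<and> Q e)"
    by (rule Sg_conj) (use assms in \<open>simp_all add: Rec_def\<close>)
  moreover have "Sg (\<lambda>e. \<not> P e \<or> \<not> Q e)"
    by (rule Sg_disj) (use assms in \<open>simp_all add: Rec_def\<close>)
  ultimately show ?thesis unfolding Rec_def de_Morgan_conj ..
qed

lemma Rec_disj [recs]:
  assumes "Rec P" "Rec Q"
  shows "Rec (\<lambda>e. P e \<or> Q e)"
  using Rec_not[OF Rec_conj[OF Rec_not[OF assms(1)] Rec_not[OF assms(2)]]] by simp

lemma Rec_imp [recs]:
  assumes "Rec P" "Rec Q"
  shows "Rec (\<lambda>e. P e \<longrightarrow> Q e)"
  using Rec_disj[OF Rec_not[OF assms(1)] assms(2)] unfolding imp_conv_disj .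

lemma Rec_iff [recs]:
  assumes "Rec P" "Rec Q"
  shows "Rec (\<lambda>e. P e \<longleftrightarrow> Q e)"
  using Rec_conj[OF Rec_imp[OF assms] Rec_imp[OF assms(2,1)]] unfolding iff_conv_conj_imp .

lemma TM_RecF: "TM f \<Longrightarrow> RecF f"
proof -
  assume "TM f"
  then obtain t where t: "\<And>e. f e = ev (mix e) t" unfolding TM_def by blast
  let ?r = "\<lambda>n. V (if even n then n + 2 else n)"
  have "(\<lambda>n. ev (mix e) (?r n)) = mix (\<lambda>n. e (Suc n))" for e
    by (auto simp: mix_def)
  then have "f (\<lambda>n. e (Suc n)) = ev (mix e) (subst_tm ?r t)" for e
    unfolding t by (simp add: ev_subst_tm)
  then have "TM (\<lambda>e. f (\<lambda>n. e (Suc n)))" unfolding TM_def by blast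
  then show "RecF f" unfolding RecF_def by (intro Sg_D0 definable)
qed

lemma RecF_var [recs]: "RecF (\<lambda>e. e n)"
  by (intro TM_RecF definable)

lemma RecF_const [recs]: "RecF (\<lambda>e. c)"
  by (intro TM_RecF definable)

lemma Sg_subst1:
  assumes "Sg (\<lambda>e. P (e 0) (\<lambda>n. e (Suc n)))" "RecF f"
  shows "Sg (\<lambda>e. P (f e) e)"
proof -
  have "Sg (\<lambda>e. \<exists>v. v = f e \<and> P v e)"
    using assms unfolding RecF_def by (intro Sg_ex Sg_conj)
  then show ?thesis by simp
qed

lemma Rec_subst1:
  assumes "Rec (\<lambda>e. P (e 0) (\<lambda>n. e (Suc n)))" "RecF f"
  shows "Rec (\<lambda>e. P (f e) e)"
  using assms Sg_subst1[of P f] Sg_subst1[of "\<lambda>v e. \<not> P v e" f] unfolding Rec_def by simp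

lemma RecF_shift: "RecF f \<Longrightarrow> RecF (\<lambda>e. f (\<lambda>n. e (Suc n)))"
proof -
  assume f: "RecF f"
  let ?\<sigma> = "\<lambda>n e. case_nat (e 0) (\<lambda>n. e (Suc (Suc n))) n :: mnum"
  have "TM (?\<sigma> n)" for n by (cases n) (simp_all add: TM_var)
  then show ?thesis using Sg_subst_TM[of "\<lambda>e. e 0 = f (\<lambda>n. e (Suc n))" ?\<sigma>] f
    unfolding RecF_def by simp
qed

lemma Rec_shift: "Rec P \<Longrightarrow> Rec (\<lambda>e. P (\<lambda>n. e (Suc n)))"
  using Rec_subst_TM[of P "\<lambda>n e. e (Suc n)"] TM_var by simp

lemma Rec_comp1:
  assumes "Rec (\<lambda>e. P (e 0))" "RecF s"
  shows "Rec (\<lambda>e. P (s e))"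
  using Rec_subst1[of "\<lambda>v e. P v", OF _ assms(2)] assms(1) by simp

text \<open>\<open>Rec_subst1\<close> eliminates only variable 0, so the arguments are permuted into
  that slot and substituted one at a time, the last one first.\<close>

lemma Rec_comp2:
  assumes "Rec (\<lambda>e. P (e 0) (e (Suc 0)))" "RecF s" "RecF t"
  shows "Rec (\<lambda>e. P (s e) (t e))"
proof -
  have "Rec (\<lambda>e. P (e (Suc 0)) (e 0))"
  proof -
    let ?\<sigma> = "\<lambda>n e. (if n = 0 then e (Suc 0) else if n = Suc 0 then e 0 else e n) :: mnum"
    have "TM (?\<sigma> n)" for n by (cases "n = 0"; cases "n = Suc 0") (simp_all add: TM_var)
    then show ?thesis using Rec_subst_TM[OF assms(1), of ?\<sigma>] by simp
  qed
  then have "Rec (\<lambda>e. P (e 0) (t (\<lambda>n. e (Suc n))))"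
    using Rec_subst1[of "\<lambda>v e. P (e 0) v", OF _ RecF_shift[OF assms(3)]] by simp
  then show ?thesis using Rec_subst1[of "\<lambda>v e. P v (t e)", OF _ assms(2)] by simp
qed

lemma Rec_comp3:
  assumes "Rec (\<lambda>e. P (e 0) (e (Suc 0)) (e (Suc (Suc 0))))" "RecF s" "RecF t" "RecF u"
  shows "Rec (\<lambda>e. P (s e) (t e) (u e))"
proof -
  have "Rec (\<lambda>e. P (e (Suc 0)) (e (Suc (Suc 0))) (e 0))"
  proof -
    let ?\<sigma> = "\<lambda>n e. (if n = 0 then e (Suc 0) else if n = Suc 0 then e (Suc (Suc 0)) else e 0) :: mnum"
    have "TM (?\<sigma> n)" for n by (cases "n = 0"; cases "n = Suc 0") (simp_all add: TM_var)
    then show ?thesis using Rec_subst_TM[OF assms(1), of ?\<sigma>] by simp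
  qed
  then have *: "Rec (\<lambda>e. P (e 0) (e (Suc 0)) (u (\<lambda>n. e (Suc (Suc n)))))"
    using Rec_subst1[of "\<lambda>v e. P (e 0) (e (Suc 0)) v", OF _ RecF_shift[OF RecF_shift[OF assms(4)]]]
    by simp
  have "Rec (\<lambda>e. P (e (Suc 0)) (e 0) (u (\<lambda>n. e (Suc (Suc n)))))"
  proof -
    let ?\<sigma> = "\<lambda>n e. (if n = 0 then e (Suc 0) else if n = Suc 0 then e 0 else e n) :: mnum"
    have "TM (?\<sigma> n)" for n by (cases "n = 0"; cases "n = Suc 0") (simp_all add: TM_var)
    then show ?thesis using Rec_subst_TM[OF *, of ?\<sigma>] by simp
  qed
  then have "Rec (\<lambda>e. P (e 0) (t (\<lambda>n. e (Suc n))) (u (\<lambda>n. e (Suc n))))"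
    using Rec_subst1[of "\<lambda>v e. P (e 0) v (u (\<lambda>n. e (Suc n)))", OF _ RecF_shift[OF assms(3)]] by simp
  then show ?thesis using Rec_subst1[of "\<lambda>v e. P v (t e) (u e)", OF _ assms(2)] by simp
qed

text \<open>A number differs from the value of f iff the value is some other number, and this is
  again \<Sigma>_1.\<close>

lemma RecF_graph:
  assumes "RecF f"
  shows "Rec (\<lambda>e. e 0 = f (\<lambda>n. e (Suc n)))"
proof -
  have "Sg (\<lambda>e. \<exists>w. w = f (\<lambda>n. e (Suc n)) \<and> e 0 \<noteq> w)"
    by (intro Sg_ex Sg_conj)
      (use RecF_shift[OF assms] in \<open>auto simp: RecF_def intro!: Sg_D0 definable\<close>)
  then show ?thesis using assms unfolding Rec_def RecF_def by simp
qed

lemma RecF_comp1: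
  assumes "RecF (\<lambda>e. h (e 0))" "RecF s"
  shows "RecF (\<lambda>e. h (s e))"
proof -
  have "Rec (\<lambda>e. e 0 = h (e (Suc 0)))" using RecF_graph[OF assms(1)] by simp
  then have "Rec (\<lambda>e. e 0 = h (s (\<lambda>n. e (Suc n))))"
    using Rec_comp2[of "\<lambda>v x. v = h x"] RecF_var RecF_shift[OF assms(2)] by simp
  then show ?thesis unfolding RecF_def by (rule Sg_Rec)
qed

lemma RecF_comp2:
  assumes "RecF (\<lambda>e. h (e 0) (e (Suc 0)))" "RecF s" "RecF t"
  shows "RecF (\<lambda>e. h (s e) (t e))"
proof -
  have "Rec (\<lambda>e. e 0 = h (e (Suc 0)) (e (Suc (Suc 0))))" using RecF_graph[OF assms(1)] by simp
  then have "Rec (\<lambda>e. e 0 = h (s (\<lambda>n. e (Suc n))) (t (\<lambda>n. e (Suc n))))"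
    using Rec_comp3[of "\<lambda>v x y. v = h x y"] RecF_var RecF_shift[OF assms(2)] RecF_shift[OF assms(3)]
    by simp
  then show ?thesis unfolding RecF_def by (rule Sg_Rec)
qed

lemma Rec_eq [recs]: "RecF s \<Longrightarrow> RecF t \<Longrightarrow> Rec (\<lambda>e. s e = t e)"
  by (rule Rec_comp2[of "(=)"]) (auto intro!: Rec_D0 definable)

lemma Rec_less [recs]: "RecF s \<Longrightarrow> RecF t \<Longrightarrow> Rec (\<lambda>e. s e < t e)"
  by (rule Rec_comp2[of "(<)"]) (auto intro!: Rec_D0 definable)

lemma Rec_le [recs]: "RecF s \<Longrightarrow> RecF t \<Longrightarrow> Rec (\<lambda>e. s e \<le> t e)"
  by (subst linorder_not_less[symmetric]) (intro recs)

lemma Rec_mem [recs]: "RecF s \<Longrightarrow> X \<in> MS \<Longrightarrow> Rec (\<lambda>e. s e \<in> X)"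
  by (rule Rec_comp1[of "\<lambda>x. x \<in> X"]) (auto intro!: Rec_D0 D0_mem TM_var)

lemma RecF_add [recs]: "RecF s \<Longrightarrow> RecF t \<Longrightarrow> RecF (\<lambda>e. s e + t e)"
  by (rule RecF_comp2[of "(+)"]) (auto intro!: TM_RecF definable)

lemma RecF_mult [recs]: "RecF s \<Longrightarrow> RecF t \<Longrightarrow> RecF (\<lambda>e. s e * t e)"
  by (rule RecF_comp2[of "(*)"]) (auto intro!: TM_RecF definable)

lemma RecF_if [recs]:
  assumes "Rec P" "RecF s" "RecF t"
  shows "RecF (\<lambda>e. if P e then s e else t e)"
proof -
  have "Rec (\<lambda>e. P (\<lambda>n. e (Suc n)) \<and> e 0 = s (\<lambda>n. e (Suc n)) \<or>
      \<not> P (\<lambda>n. e (Suc n)) \<and> e 0 = t (\<lambda>n. e (Suc n)))"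
    by (intro recs Rec_shift RecF_graph assms)
  moreover have "(P (\<lambda>n. e (Suc n)) \<and> e 0 = s (\<lambda>n. e (Suc n)) \<or>
      \<not> P (\<lambda>n. e (Suc n)) \<and> e 0 = t (\<lambda>n. e (Suc n))) \<longleftrightarrow>
      e 0 = (if P (\<lambda>n. e (Suc n)) then s (\<lambda>n. e (Suc n)) else t (\<lambda>n. e (Suc n)))" for e
    by auto
  ultimately show ?thesis unfolding RecF_def Rec_def by simp
qed

section \<open>Bounded quantifiers, minimisation and derived induction principles\<close>

lemma Rec_instance:
  assumes "Rec (\<lambda>e. P (e 0) (\<lambda>n. e (Suc n)))"
  shows "Rec (\<lambda>e'. P (e' 0) e)"
proof -
  let ?\<sigma> = "\<lambda>n e'. case_nat (e' 0) e n :: mnum"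
  have "TM (?\<sigma> n)" for n by (cases n) (simp_all add: TM_var TM_const)
  then show ?thesis using Rec_subst_TM[OF assms, of ?\<sigma>] by simp
qed

text \<open>Induction on the number of cases already bounded: each step takes the maximum of the old
  bound and one new witness, and monotonicity of R keeps the earlier cases valid.\<close>

lemma collection:
  assumes D: "D0 (\<lambda>e. R (e 0) (\<lambda>n. e (Suc n)))" and R: "\<And>y y' e. R y e \<Longrightarrow> y \<le> y' \<Longrightarrow> R y' e"
    and "\<And>y. y < t \<Longrightarrow> \<exists>z. R z (case_nat y e)"
  shows "\<exists>b. \<forall>y<t. R b (case_nat y e)"
proof -
  have "D0 (\<lambda>e'. R (e' (Suc 0)) (case_nat (e' 0) e))"
  proof -
    let ?\<sigma> = "\<lambda>n e'. case_nat (e' (Suc 0)) (case_nat (e' 0) e) n :: mnum"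
    have "TM (?\<sigma> n)" for n by (cases n; cases "n - 1") (auto simp: TM_var TM_const)
    then show ?thesis using D0_subst[OF D, of ?\<sigma>] by simp
  qed
  \<comment> \<open>The guard \<open>y < t\<close> lets the induction run past t, where no witnesses
    are assumed.\<close>
  then have S: "Sg (\<lambda>e'. \<exists>b. \<forall>y<e' 0. y < t \<longrightarrow> R b (case_nat y e))"
    by (intro Sg_ex_D0 definable)
  have "\<exists>b. \<forall>y<t. y < t \<longrightarrow> R b (case_nat y e)"
  proof (rule Sg_induct[of "\<lambda>x. \<exists>b. \<forall>y<x. y < t \<longrightarrow> R b (case_nat y e)", OF S])
    show "\<exists>b. \<forall>y<0. y < t \<longrightarrow> R b (case_nat y e)" by (simp add: mnum_not_less_0)
    fix x assume "\<exists>b. \<forall>y<x. y < t \<longrightarrow> R b (case_nat y e)"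
    then obtain b where b: "\<forall>y<x. y < t \<longrightarrow> R b (case_nat y e)" ..
    obtain z where z: "x < t \<longrightarrow> R z (case_nat x e)" using assms(3) by blast
    have "R (max b z) (case_nat y e)" if "y < x + 1" "y < t" for y
    proof (cases "y = x")
      case True then show ?thesis using z that R by (meson max.cobounded2)
    next
      case False then show ?thesis using b that R by (metis max.cobounded1 mnum_less_add_one)
    qed
    then show "\<exists>b. \<forall>y<x + 1. y < t \<longrightarrow> R b (case_nat y e)" by blast
  qed
  then show ?thesis by blast
qed

text \<open>Collection moves the unbounded quantifier in front of the bounded one.\<close>

lemma Sg_ball_TM:
  assumes "Sg (\<lambda>e. P (e 0) (\<lambda>n. e (Suc n)))" "TM t"
  shows "Sg (\<lambda>e. \<forall>y<t e. P y e)"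
proof -
  from assms(1) obtain R where R: "D0 (\<lambda>e. R (e 0) (\<lambda>n. e (Suc n)))"
    "\<And>e. P (e 0) (\<lambda>n. e (Suc n)) \<longleftrightarrow> (\<exists>y. R y e)" "\<And>y y' e. R y e \<Longrightarrow> y \<le> y' \<Longrightarrow> R y' e"
    by (rule Sg_mono_form) blast
  have P: "P y e \<longleftrightarrow> (\<exists>b. R b (case_nat y e))" for y e using R(2)[of "case_nat y e"] by simp
  have "TM (\<lambda>e. t (\<lambda>n. e (Suc n)))"
  proof -
    obtain u where t: "\<And>e. t e = ev (mix e) u" using assms(2) unfolding TM_def by blast
    let ?r = "\<lambda>n. V (if even n then n + 2 else n)"
    have "(\<lambda>n. ev (mix e) (?r n)) = mix (\<lambda>n. e (Suc n))" for e
      by (auto simp: mix_def)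
    then have "t (\<lambda>n. e (Suc n)) = ev (mix e) (subst_tm ?r u)" for e
      unfolding t by (simp add: ev_subst_tm)
    then show ?thesis unfolding TM_def by blast
  qed
  then have "Sg (\<lambda>e. \<exists>b. \<forall>y<t e. R b (case_nat y e))"
    by (intro Sg_ex_D0 D0_ball) (use D0_swap[OF R(1)] in simp_all)
  moreover have "(\<forall>y<t e. P y e) \<longleftrightarrow> (\<exists>b. \<forall>y<t e. R b (case_nat y e))" for e
  proof
    assume "\<forall>y<t e. P y e"
    then show "\<exists>b. \<forall>y<t e. R b (case_nat y e)"
      unfolding P by (intro collection[OF R(1)]) (blast intro: R(3))+
  qed (auto simp: P)
  ultimately show ?thesis by simp
qed

lemma Sg_ball:
  assumes "Sg (\<lambda>e. P (e 0) (\<lambda>n. e (Suc n)))" "RecF t"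
  shows "Sg (\<lambda>e. \<forall>y<t e. P y e)"
proof -
  have "Sg (\<lambda>e. P (e 0) (\<lambda>n. e (Suc (Suc n))))"
  proof -
    let ?\<sigma> = "\<lambda>n e. case_nat (e 0) (\<lambda>n. e (Suc (Suc n))) n :: mnum"
    have "TM (?\<sigma> n)" for n by (cases n) (simp_all add: TM_var)
    then show ?thesis using Sg_subst_TM[OF assms(1), of ?\<sigma>] by simp
  qed
  then have "Sg (\<lambda>e. \<forall>y<e 0. P y (\<lambda>n. e (Suc n)))"
    by (intro Sg_ball_TM TM_var)
  then show ?thesis using Sg_subst1[of "\<lambda>v e. \<forall>y<v. P y e", OF _ assms(2)] by simp
qed

lemma Rec_ball [recs]:
  assumes "Rec (\<lambda>e. P (e 0) (\<lambda>n. e (Suc n)))" "RecF t"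
  shows "Rec (\<lambda>e. \<forall>y<t e. P y e)"
proof -
  have "Sg (\<lambda>e. \<exists>y. y < t e \<and> \<not> P y e)"
    using assms RecF_shift[OF assms(2)] by (intro Sg_ex Sg_conj Sg_Rec recs)
  then show ?thesis using Sg_ball assms unfolding Rec_def by (simp add: not_less)
qed

lemma Rec_bex [recs]:
  assumes "Rec (\<lambda>e. P (e 0) (\<lambda>n. e (Suc n)))" "RecF t"
  shows "Rec (\<lambda>e. \<exists>y<t e. P y e)"
  using Rec_not[OF Rec_ball[OF Rec_not[OF assms(1)] assms(2)]] by simp

lemma Rec_ball_le [recs]:
  assumes "Rec (\<lambda>e. P (e 0) (\<lambda>n. e (Suc n)))" "RecF t"
  shows "Rec (\<lambda>e. \<forall>y\<le>t e. P y e)"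
  using Rec_ball[OF assms(1) RecF_add[OF assms(2) RecF_const[of 1]]] by simp

lemma Rec_bex_le [recs]:
  assumes "Rec (\<lambda>e. P (e 0) (\<lambda>n. e (Suc n)))" "RecF t"
  shows "Rec (\<lambda>e. \<exists>y\<le>t e. P y e)"
  using Rec_bex[OF assms(1) RecF_add[OF assms(2) RecF_const[of 1]]] by simp

lemma Sg_imp:
  assumes "Rec P" "Sg Q"
  shows "Sg (\<lambda>e. P e \<longrightarrow> Q e)"
  using Sg_disj[OF Sg_Rec[OF Rec_not[OF assms(1)]] assms(2)] unfolding imp_conv_disj .

lemma comprehension: "Rec (\<lambda>e. \<phi> (e 0)) \<Longrightarrow> {x. \<phi> x} \<in> MS"
  using Sg_comprehension unfolding Rec_def by blast

text \<open>The model need not be well-founded, so \<open>LEAST\<close> is meaningful only where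
  such a principle applies. It follows by induction on a bound below which \<phi> fails.\<close>

lemma least_number:
  assumes "Rec (\<lambda>e. \<phi> (e 0))" "\<phi> x"
  shows "\<exists>y. \<phi> y \<and> (\<forall>z<y. \<not> \<phi> z)"
proof (rule ccontr)
  assume *: "\<nexists>y. \<phi> y \<and> (\<forall>z<y. \<not> \<phi> z)"
  have R: "Rec (\<lambda>e. \<not> \<phi> (e 0))" by (intro recs assms)
  have "\<forall>z<x + 1. \<not> \<phi> z"
  proof (rule Sg_induct[of "\<lambda>x. \<forall>z<x. \<not> \<phi> z"])
    show "Sg (\<lambda>e. \<forall>z<e 0. \<not> \<phi> z)" by (intro Sg_Rec recs R)
    show "\<forall>z<x + 1. \<not> \<phi> z" if "\<forall>z<x. \<not> \<phi> z" for x using * that mnum_less_add_one by blast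
  qed (simp add: mnum_not_less_0)
  then show False using assms(2) by simp
qed

lemma Least_Rec:
  assumes "Rec (\<lambda>e. \<phi> (e 0))" "\<phi> x"
  shows "\<phi> (LEAST x. \<phi> x)" "z < (LEAST x. \<phi> x) \<Longrightarrow> \<not> \<phi> z"
proof -
  obtain y where y: "\<phi> y" "\<forall>z<y. \<not> \<phi> z" using least_number[OF assms] by blast
  then have "(LEAST x. \<phi> x) = y" by (intro Least_equality) (auto simp: linorder_not_less[symmetric])
  then show "\<phi> (LEAST x. \<phi> x)" "z < (LEAST x. \<phi> x) \<Longrightarrow> \<not> \<phi> z" using y by auto
qed

text \<open>Minimisation. Existence is demanded in every environment, which is the reason for the
  default alternatives in the definitions by \<open>LEAST\<close> below.\<close>

lemma RecF_Least:
  assumes "Rec (\<lambda>e. P (e 0) (\<lambda>n. e (Suc n)))" "\<And>e. \<exists>x. P x e"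
  shows "RecF (\<lambda>e. LEAST x. P x e)"
proof -
  have "Rec (\<lambda>e. P (e 0) (\<lambda>n. e (Suc (Suc n))))"
  proof -
    let ?\<sigma> = "\<lambda>n e. case_nat (e 0) (\<lambda>n. e (Suc (Suc n))) n :: mnum"
    have "TM (?\<sigma> n)" for n by (cases n) (simp_all add: TM_var)
    then show ?thesis using Rec_subst_TM[OF assms(1), of ?\<sigma>] by simp
  qed
  then have "Sg (\<lambda>e. P (e 0) (\<lambda>n. e (Suc n)) \<and> (\<forall>z<e 0. \<not> P z (\<lambda>n. e (Suc n))))"
    by (intro Sg_Rec recs assms)
  moreover have "P v e \<and> (\<forall>z<v. \<not> P z e) \<longleftrightarrow> v = (LEAST x. P x e)" for v e
  proof -
    obtain x where "P x e" using assms(2) by blast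
    note L = Least_Rec[of "\<lambda>x. P x e", OF Rec_instance[OF assms(1)] this]
    show ?thesis using L by (metis linorder_neqE)
  qed
  ultimately show ?thesis unfolding RecF_def by simp
qed

text \<open>A counterexample x is pushed downwards: by \<Sigma>_1 induction on i there is one at
  distance i below x, and i = x contradicts the base case.\<close>

lemma Pi_induct:
  assumes "Sg (\<lambda>e. \<not> \<phi> (e 0))" "\<phi> 0" "\<And>x. \<phi> x \<Longrightarrow> \<phi> (x + 1)"
  shows "\<phi> x"
proof (rule ccontr)
  assume x: "\<not> \<phi> x"
  have "\<forall>i. i \<le> x \<longrightarrow> (\<exists>r. r + i = x \<and> \<not> \<phi> r)"
  proof
    fix i
    show "i \<le> x \<longrightarrow> (\<exists>r. r + i = x \<and> \<not> \<phi> r)"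
    proof (rule Sg_induct[of "\<lambda>i. i \<le> x \<longrightarrow> (\<exists>r. r + i = x \<and> \<not> \<phi> r)"])
      have "Sg (\<lambda>e. \<not> \<phi> (e 0) )" by (rule assms)
      then show "Sg (\<lambda>e. e 0 \<le> x \<longrightarrow> (\<exists>r. r + e 0 = x \<and> \<not> \<phi> r))"
        by (intro Sg_imp Sg_ex Sg_conj) (auto intro!: recs Sg_Rec)
      fix i assume IH: "i \<le> x \<longrightarrow> (\<exists>r. r + i = x \<and> \<not> \<phi> r)"
      show "i + 1 \<le> x \<longrightarrow> (\<exists>r. r + (i + 1) = x \<and> \<not> \<phi> r)"
      proof
        assume i: "i + 1 \<le> x"
        then obtain r where r: "r + i = x" "\<not> \<phi> r" using IH by auto
        then have "r \<noteq> 0" using i by auto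
        then obtain r' where r': "r = r' + 1" using mnum_cases by blast
        have "\<not> \<phi> r'" using assms(3) r(2) r' by metis
        moreover have "r' + (i + 1) = x" using r(1) r' by (simp add: ac_simps)
        ultimately show "\<exists>r. r + (i + 1) = x \<and> \<not> \<phi> r" by blast
      qed
    qed (use x in simp)
  qed
  then obtain r where "r + x = x" "\<not> \<phi> r" by blast
  then show False using assms(2) by simp
qed

lemma mnum_induct:
  assumes "Rec (\<lambda>e. \<phi> (e 0))" "\<phi> 0" "\<And>x. \<phi> x \<Longrightarrow> \<phi> (x + 1)"
  shows "\<phi> x"
  by (rule Sg_induct[of \<phi>, OF Sg_Rec[OF assms(1)]]) (use assms in auto)


section \<open>Coding finite sequences\<close>

declare add_one_neq_0 [simp]

lemma mnum_less_one [simp]: "x < 1 \<longleftrightarrow> x = (0::mnum)"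
  using mnum_less_add_one_iff[of x 0] by simp

lemma mnum_zero_less [simp]: "0 < x \<longleftrightarrow> x \<noteq> (0::mnum)"
  by (metis mnum_le_zero linorder_not_less)

lemma mnum_le_square: "x \<le> x * (x::mnum)"
proof -
  have "x = 0 \<or> (\<exists>y. x * x = x + y)"
    using mnum_cases[of x] by (metis distrib_left mult.right_neutral add.commute)
  then show ?thesis unfolding mnum_le_iff by auto
qed

lemma mnum_lessE:
  assumes "x < (y::mnum)"
  obtains z where "y = x + z + 1"
  using assms unfolding mnum_less_iff by blast

text \<open>The value of the term \<open>pair\<close>, so that colorings and internal codes share
  one pairing.\<close>

definition pr :: "mnum \<Rightarrow> mnum \<Rightarrow> mnum" where
  "pr x y = (x + y) * (x + y) + x"

lemma RecF_pr [recs]: "RecF s \<Longrightarrow> RecF t \<Longrightarrow> RecF (\<lambda>e. pr (s e) (t e))"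
  unfolding pr_def by (intro recs)

lemma pr_sum_mono: "x + y < x' + y' \<Longrightarrow> pr x y < pr x' y'"
proof -
  assume "x + y < x' + y'"
  then obtain z where z: "x' + y' = x + y + z + 1" by (rule mnum_lessE)
  have "x' + y' = (x + y) + (z + 1)" using z by (simp add: ac_simps)
  \<comment> \<open>The bracket is the surplus of (s + z + 1)^2 over s^2 + x + 1 for s = x + y,
    written without subtraction.\<close>
  then have "(x' + y') * (x' + y') = (x + y) * (x + y) + x + (x + y + y + (x + y) * z + (x + y) * z + z * z + z + z) + 1"
    by (simp add: algebra_simps)
  then have "pr x' y' = pr x y + ((x + y + y + (x + y) * z + (x + y) * z + z * z + z + z) + x') + 1"
    unfolding pr_def by (simp add: ac_simps)
  then show ?thesis unfolding mnum_less_iff by blast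
qed

lemma pr_inject [simp]: "pr x y = pr x' y' \<longleftrightarrow> x = x' \<and> y = y'"
proof
  assume *: "pr x y = pr x' y'"
  then have "x + y = x' + y'"
    using pr_sum_mono[of x y x' y'] pr_sum_mono[of x' y' x y] by (metis linorder_neqE order_less_irrefl)
  then show "x = x' \<and> y = y'" using * unfolding pr_def by auto
qed simp

lemma le_pr: "x \<le> pr x y" "y \<le> pr x y"
proof -
  show "x \<le> pr x y" unfolding pr_def by (metis add.commute mnum_le_iff)
  have "y \<le> x + y" "x + y \<le> (x + y) * (x + y)" "(x + y) * (x + y) \<le> pr x y"
    unfolding pr_def using mnum_le_square by (auto simp: mnum_le_iff intro: add.commute)
  then show "y \<le> pr x y" by (meson order_trans)
qed

lemma pr_mono: "x \<le> x' \<Longrightarrow> y \<le> y' \<Longrightarrow> pr x y \<le> pr x' y'"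
  unfolding pr_def by (intro add_mono mult_mono) auto

text \<open>The default value \<open>z\<close> makes both projections total.\<close>

definition p1 :: "mnum \<Rightarrow> mnum" where "p1 z = (LEAST x. (\<exists>y\<le>z. z = pr x y) \<or> x = z)"
definition p2 :: "mnum \<Rightarrow> mnum" where "p2 z = (LEAST y. (\<exists>x\<le>z. z = pr x y) \<or> y = z)"

lemma RecF_p1 [recs]: "RecF s \<Longrightarrow> RecF (\<lambda>e. p1 (s e))"
  by (rule RecF_comp1[of p1], unfold p1_def, rule RecF_Least) (auto intro!: recs)

lemma RecF_p2 [recs]: "RecF s \<Longrightarrow> RecF (\<lambda>e. p2 (s e))"
  by (rule RecF_comp1[of p2], unfold p2_def, rule RecF_Least) (auto intro!: recs)

lemma p1_pr [simp]: "p1 (pr x y) = x"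
  unfolding p1_def by (rule Least_equality) (auto intro: le_pr)

lemma p2_pr [simp]: "p2 (pr x y) = y"
  unfolding p2_def by (rule Least_equality) (auto intro: le_pr)

text \<open>Goedel's beta function. The moduli for \<open>i < n\<close> are pairwise coprime if \<open>p1 z\<close> is a common multiple
  of the numbers up to \<open>n\<close>.\<close>

definition mem :: "mnum \<Rightarrow> mnum \<Rightarrow> bool" where
  "mem i z \<longleftrightarrow> (\<exists>r\<le>p2 z. p2 z = (1 + (i + 1) * p1 z) * r)"

lemma Rec_mem_code [recs]: "RecF s \<Longrightarrow> RecF t \<Longrightarrow> Rec (\<lambda>e. mem (s e) (t e))"
  by (rule Rec_comp2[of mem], unfold mem_def) (intro recs | assumption)+

lemma mnum_dvd_iff: "(\<exists>r\<le>b. b = (1 + a) * r) \<longleftrightarrow> (1 + a) dvd (b::mnum)"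
proof
  assume "(1 + a) dvd b"
  then obtain r where r: "b = (1 + a) * r" by (auto simp: dvd_def)
  then have "b = r + a * r" by (simp add: algebra_simps)
  then have "r \<le> b" unfolding mnum_le_iff by blast
  then show "\<exists>r\<le>b. b = (1 + a) * r" using r by blast
qed auto

lemma mem_iff: "mem i z \<longleftrightarrow> (1 + (i + 1) * p1 z) dvd p2 z"
  unfolding mem_def mnum_dvd_iff ..

text \<open>Plays the role of the factorial: the step multiplies by the next number.\<close>

lemma common_multiple: "\<exists>p::mnum. 0 < p \<and> (\<forall>j<n + 1. 0 < j \<longrightarrow> j dvd p)"
proof -
  have "\<exists>p::mnum. 0 < p \<and> (\<forall>j<n + 1. 0 < j \<longrightarrow> (\<exists>r\<le>p. p = j * r))"
  proof (rule Sg_induct[of "\<lambda>n. \<exists>p::mnum. 0 < p \<and> (\<forall>j<n + 1. 0 < j \<longrightarrow> (\<exists>r\<le>p. p = j * r))"])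
    show "Sg (\<lambda>e. \<exists>p. 0 < p \<and> (\<forall>j<e 0 + 1. 0 < j \<longrightarrow> (\<exists>r\<le>p. p = j * r)))"
      by (rule Sg_ex, rule Sg_Rec) (intro recs)
    show "\<exists>p::mnum. 0 < p \<and> (\<forall>j<0 + 1. 0 < j \<longrightarrow> (\<exists>r\<le>p. p = j * r))"
      by (intro exI[of _ 1]) auto
    fix n assume "\<exists>p::mnum. 0 < p \<and> (\<forall>j<n + 1. 0 < j \<longrightarrow> (\<exists>r\<le>p. p = j * r))"
    then obtain p :: mnum where p: "0 < p" "\<And>j. j < n + 1 \<Longrightarrow> 0 < j \<Longrightarrow> j dvd p"
      by (metis dvd_def)
    have "0 < p * (n + 1)" using p(1) by simp
    moreover have "\<exists>r\<le>p * (n + 1). p * (n + 1) = j * r" if j: "j < n + 1 + 1" "0 < j" for j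
    proof -
      have "j dvd p * (n + 1)"
        using p(2)[of j] j by (metis dvd_mult dvd_mult2 dvd_refl mnum_less_add_one)
      moreover obtain a where "j = 1 + a" using j(2) mnum_cases[of j] by (metis add.commute order_less_irrefl)
      ultimately show ?thesis using mnum_dvd_iff by metis
    qed
    ultimately show "\<exists>p::mnum. 0 < p \<and> (\<forall>j<n + 1 + 1. 0 < j \<longrightarrow> (\<exists>r\<le>p. p = j * r))" by blast
  qed
  then show ?thesis by (auto simp: dvd_def)
qed

lemma mnum_dvd_add_cancel: "a dvd x + y \<Longrightarrow> a dvd x \<Longrightarrow> a dvd (y::mnum)"
proof -
  assume "a dvd x + y" "a dvd x"
  then obtain k l where "x + y = a * l" "x = a * k" by (auto simp: dvd_def)
  then have "y = a * (l - k)" by (metis add_diff_cancel_left' right_diff_distrib')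
  then show ?thesis by simp
qed

text \<open>Coprimality of two moduli stated as cancellation, which avoids gcds. The moduli differ
  by d * p, so the first one divides q * d * p; modulo it, (i + 1) * p is -1, so factors p can be
  removed.\<close>

lemma beta_coprime:
  assumes "0 < d" "d dvd p" "k = i + d \<or> i = k + d" "(1 + (i + 1) * p) dvd q * (1 + (k + 1) * p)"
  shows "(1 + (i + 1) * p) dvd (q::mnum)"
proof -
  let ?a = "1 + (i + 1) * p" and ?b = "1 + (k + 1) * p"
  have 1: "?a dvd q * d * p"
    using assms(3)
  proof
    assume "k = i + d"
    then have "q * ?b = q * ?a + q * d * p" by (simp add: algebra_simps)
    then show ?thesis using assms(4) by (metis dvd_triv_right mnum_dvd_add_cancel)
  next
    assume "i = k + d"
    then have "q * ?a = q * ?b + q * d * p" by (simp add: algebra_simps)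
    then show ?thesis using assms(4) by (metis dvd_triv_right mnum_dvd_add_cancel)
  qed
  obtain r where r: "p = d * r" using assms(2) by (auto simp: dvd_def)
  \<comment> \<open>The factor r turns d into p, and i + 1 prepares the removal of one factor
    p.\<close>
  have "?a dvd (q * d * p) * (r * (i + 1))" using 1 by (rule dvd_mult2)
  then have 2: "?a dvd (i + 1) * q * p * p" by (simp add: r ac_simps)
  have "(i + 1) * q * p * p + q * p = q * p * ?a" by (simp add: algebra_simps)
  then have "?a dvd q * p" using 2 by (metis dvd_triv_right mnum_dvd_add_cancel)
  then have 3: "?a dvd (q * p) * (i + 1)" by (rule dvd_mult2)
  have "(q * p) * (i + 1) + q = q * ?a" by (simp add: algebra_simps)
  then show ?thesis using 3 by (metis dvd_triv_right mnum_dvd_add_cancel)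
qed

text \<open>The code consists of p and the product q of the moduli of those i < n that satisfy
  \<phi>. Since q > 0 and every modulus exceeds its index, a code lies above all its
  elements.\<close>

lemma bounded_comprehension:
  assumes "Rec (\<lambda>e. \<phi> (e 0))"
  shows "\<exists>z. (\<forall>i<n. mem i z \<longleftrightarrow> \<phi> i) \<and> (\<forall>i. mem i z \<longrightarrow> i < z)"
proof -
  obtain p :: mnum where p: "0 < p" "\<And>j. j < n + 1 \<Longrightarrow> 0 < j \<Longrightarrow> j dvd p"
    using common_multiple by blast
  let ?m = "\<lambda>i. 1 + (i + 1) * p"
  have "\<exists>q. 0 < q \<and> (\<forall>i<n. (\<exists>r\<le>q. q = ?m i * r) \<longleftrightarrow> i < n \<and> \<phi> i)"
  proof (rule Sg_induct[of "\<lambda>k. \<exists>q. 0 < q \<and> (\<forall>i<n. (\<exists>r\<le>q. q = ?m i * r) \<longleftrightarrow> i < k \<and> \<phi> i)"])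
    show "Sg (\<lambda>e. \<exists>q. 0 < q \<and> (\<forall>i<n. (\<exists>r\<le>q. q = ?m i * r) \<longleftrightarrow> i < e 0 \<and> \<phi> i))"
      by (rule Sg_ex, rule Sg_Rec) (intro recs Rec_comp1[of \<phi>, OF assms])
    have "\<not> (\<exists>r\<le>1. 1 = ?m i * r)" for i
    proof
      assume "\<exists>r\<le>1. 1 = ?m i * r"
      then obtain r where r: "1 = ?m i * r" by blast
      then have "r \<noteq> 0" by auto
      then obtain r' where "r = r' + 1" using mnum_cases by blast
      then have "1 = 1 + (r' * ?m i + (i + 1) * p)" using r by (simp add: algebra_simps)
      then have "r' * ?m i + (i + 1) * p = 0" by (metis add_cancel_right_right)
      then have "(i + 1) * p = 0" by (metis add.commute mnum_add_eq_0)
      then show False using p(1) add_one_neq_0 by auto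
    qed
    then show "\<exists>q. 0 < q \<and> (\<forall>i<n. (\<exists>r\<le>q. q = ?m i * r) \<longleftrightarrow> i < 0 \<and> \<phi> i)"
      by (intro exI[of _ 1]) (simp add: mnum_not_less_0)
    fix k assume "\<exists>q. 0 < q \<and> (\<forall>i<n. (\<exists>r\<le>q. q = ?m i * r) \<longleftrightarrow> i < k \<and> \<phi> i)"
    then obtain q where q: "0 < q" "\<And>i. i < n \<Longrightarrow> ?m i dvd q \<longleftrightarrow> i < k \<and> \<phi> i"
      unfolding mnum_dvd_iff by blast
    show "\<exists>q. 0 < q \<and> (\<forall>i<n. (\<exists>r\<le>q. q = ?m i * r) \<longleftrightarrow> i < k + 1 \<and> \<phi> i)"
      unfolding mnum_dvd_iff
    proof (cases "k < n \<and> \<phi> k")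
      case False
      then show "\<exists>q. 0 < q \<and> (\<forall>i<n. ?m i dvd q \<longleftrightarrow> i < k + 1 \<and> \<phi> i)"
        using q mnum_less_add_one by (intro exI[of _ q]) blast
    next
      case True
      have "?m i dvd q * ?m k \<longleftrightarrow> i < k + 1 \<and> \<phi> i" if i: "i < n" for i
      proof (cases "i = k")
        case False
        have "?m i dvd q" if "?m i dvd q * ?m k"
        proof -
          \<comment> \<open>Two indices below n differ by at most n, so p is a multiple of their
            distance.\<close>
          have "\<exists>d. d < n + 1 \<and> 0 < d \<and> (k = i + d \<or> i = k + d)"
            using False True i
          proof (cases "i < k")
            case True
            then obtain d where d: "k = i + (d + 1)" by (auto elim: mnum_lessE simp: add.assoc)
            then have "d + 1 \<le> k" unfolding mnum_le_iff by (metis add.commute)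
            then have "d + 1 < n + 1" using \<open>k < n \<and> \<phi> k\<close> by auto
            then show ?thesis using d by (intro exI[of _ "d + 1"]) (auto simp: mnum_less_iff)
          next
            case F: False
            then have "k < i" using False by auto
            then obtain d where d: "i = k + (d + 1)" by (auto elim: mnum_lessE simp: add.assoc)
            then have "d + 1 \<le> i" unfolding mnum_le_iff by (metis add.commute)
            then have "d + 1 < n + 1" using i by auto
            then show ?thesis using d by (intro exI[of _ "d + 1"]) (auto simp: mnum_less_iff)
          qed
          then show ?thesis using beta_coprime p(2) that by blast
        qed
        then have "?m i dvd q * ?m k \<longleftrightarrow> ?m i dvd q" using dvd_mult2 by blast
        then show ?thesis using q(2)[OF i] False mnum_less_add_one by metis
      qed (use True in simp)
      moreover have "0 < q * ?m k"
      proof -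
        have "?m k = (k + 1) * p + 1" by (rule add.commute)
        then have "0 < ?m k" unfolding mnum_less_iff by auto
        then show ?thesis using q(1) by simp
      qed
      ultimately show "\<exists>q. 0 < q \<and> (\<forall>i<n. ?m i dvd q \<longleftrightarrow> i < k + 1 \<and> \<phi> i)" by blast
    qed
  qed
  then obtain q where q: "0 < q" "\<And>i. i < n \<Longrightarrow> ?m i dvd q \<longleftrightarrow> \<phi> i"
    unfolding mnum_dvd_iff by blast
  have "i < pr p q" if "?m i dvd q" for i
  proof -
    obtain r where r: "q = ?m i * r" using \<open>?m i dvd q\<close> by (auto simp: dvd_def)
    then have "r \<noteq> 0" using q(1) by auto
    then obtain r' where r': "r = r' + 1" using mnum_cases by blast
    obtain p' where p': "p = p' + 1" using p(1) mnum_cases[of p] by auto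
    have "q = i + (1 + p' + i * p' + ?m i * r') + 1" unfolding r r' p' by (simp add: algebra_simps)
    then have "i < q" unfolding mnum_less_iff by blast
    then show ?thesis using le_pr(2) by (rule order_less_le_trans)
  qed
  then show ?thesis using q(2) by (intro exI[of _ "pr p q"]) (simp add: mem_iff)
qed

text \<open>A sequence is coded by its graph; the default z makes reading an entry total.\<close>

definition sq :: "mnum \<Rightarrow> mnum \<Rightarrow> mnum" where
  "sq z i = (LEAST v. mem (pr i v) z \<or> v = z)"

lemma RecF_sq [recs]: "RecF s \<Longrightarrow> RecF t \<Longrightarrow> RecF (\<lambda>e. sq (s e) (t e))"
  by (rule RecF_comp2[of sq], unfold sq_def, rule RecF_Least) (auto intro!: recs)

lemma finite_bound:
  assumes "RecF (\<lambda>e. h (e 0))"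
  shows "\<exists>B. \<forall>i<n. h i \<le> B"
proof (rule Sg_induct[of "\<lambda>n. \<exists>B. \<forall>i<n. h i \<le> B"])
  show "Sg (\<lambda>e. \<exists>B. \<forall>i<e 0. h i \<le> B)"
    by (rule Sg_ex, rule Sg_Rec) (intro recs RecF_comp1[of h, OF assms])
  fix n assume "\<exists>B. \<forall>i<n. h i \<le> B"
  then obtain B where "\<forall>i<n. h i \<le> B" ..
  then have "\<forall>i<n + 1. h i \<le> max B (h n)" by (metis mnum_less_add_one le_max_iff_disj order_refl)
  then show "\<exists>B. \<forall>i<n + 1. h i \<le> B" ..
qed (simp add: mnum_not_less_0)

lemma sequence_code:
  assumes "RecF (\<lambda>e. h (e 0))"
  shows "\<exists>z. \<forall>i<n. sq z i = h i \<and> h i < z"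
proof -
  obtain B where B: "\<forall>i<n. h i \<le> B" using finite_bound[OF assms] by blast
  have "Rec (\<lambda>e. \<exists>i<n. e 0 = pr i (h i))" by (intro recs RecF_comp1[of h, OF assms])
  \<comment> \<open>Every pair of an index below n and a value up to B lies below this bound, so z
    describes the graph correctly on all relevant pairs.\<close>
  then obtain z where z: "\<And>j. j < pr n B + 1 \<Longrightarrow> mem j z \<longleftrightarrow> (\<exists>i<n. j = pr i (h i))"
    "\<And>j. mem j z \<Longrightarrow> j < z"
    using bounded_comprehension[of "\<lambda>j. \<exists>i<n. j = pr i (h i)" "pr n B + 1"] by blast
  have "sq z i = h i \<and> h i < z" if i: "i < n" for i
  proof -
    have m: "mem (pr i v) z \<longleftrightarrow> v = h i" if "v \<le> h i" for v
    proof -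
      have "v \<le> B" using that B i by (meson order_trans)
      then have "pr i v < pr n B + 1" using i by (simp add: pr_mono)
      then show ?thesis using z(1) i by auto
    qed
    then have "pr i (h i) < z" using z(2) by blast
    then have lt: "h i < z" using le_pr(2) by (rule order_le_less_trans[rotated])
    have "sq z i = h i" unfolding sq_def
    proof (rule Least_equality)
      show "mem (pr i (h i)) z \<or> h i = z" using m by blast
      fix v assume "mem (pr i v) z \<or> v = z"
      then show "h i \<le> v" using m lt by (metis linorder_le_cases order_less_imp_le)
    qed
    then show ?thesis using lt by blast
  qed
  then show ?thesis by blast
qed

lemma sequence_append: "\<exists>z'. (\<forall>i<n. sq z' i = sq z i) \<and> sq z' n = v"
proof -
  have "RecF (\<lambda>e. if e 0 < n then sq z (e 0) else v)" by (intro recs)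
  then obtain z' where "\<forall>i<n + 1. sq z' i = (if i < n then sq z i else v)"
    using sequence_code[of "\<lambda>i. if i < n then sq z i else v" "n + 1"] by blast
  then have "(\<forall>i<n. sq z' i = sq z i) \<and> sq z' n = v" by (auto simp: mnum_less_add_one)
  then show ?thesis ..
qed

text \<open>The value at n is the last entry of the least code of a computation of length n. Codes
  of different lengths agree on common indices, so the recursion equation passes from one code to
  the next.\<close>

theorem recursion:
  assumes G: "RecF (\<lambda>e. G (e 0) (e (Suc 0)))"
  obtains h where "RecF (\<lambda>e. h (e 0))" "h 0 = a" "\<And>n. h (n + 1) = G n (h n)"
proof -
  define comp where "comp z n \<longleftrightarrow> sq z 0 = a \<and> (\<forall>i<n. sq z (i + 1) = G i (sq z i))" for z n
  have G': "RecF s \<Longrightarrow> RecF t \<Longrightarrow> RecF (\<lambda>e. G (s e) (t e))" for s t by (rule RecF_comp2[OF G])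
  have compR: "Rec (\<lambda>e. comp (s e) (t e))" if "RecF s" "RecF t" for s t
  proof -
    have "Rec (\<lambda>e. comp (e 0) (e (Suc 0)))" unfolding comp_def by (intro recs G')
    then show ?thesis using that by (rule Rec_comp2)
  qed
  have ex: "\<exists>z. comp z n" for n
  proof (rule Sg_induct[of "\<lambda>n. \<exists>z. comp z n"])
    show "Sg (\<lambda>e. \<exists>z. comp z (e 0))" by (rule Sg_ex, rule Sg_Rec) (intro compR recs)
    show "\<exists>z. comp z 0" using sequence_append[of 0 _ a] by (auto simp: comp_def mnum_not_less_0)
    fix n assume "\<exists>z. comp z n"
    then obtain z where z: "comp z n" ..
    obtain z' where z': "\<forall>i<n + 1. sq z' i = sq z i" "sq z' (n + 1) = G n (sq z n)"
      using sequence_append by blast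
    have "comp z' (n + 1)" unfolding comp_def
    proof (intro conjI allI impI)
      show "sq z' 0 = a" using z z'(1) by (simp add: comp_def)
      fix i assume "i < n + 1"
      then show "sq z' (i + 1) = G i (sq z' i)"
        using z z' unfolding comp_def by (metis add_less_cancel_right mnum_less_add_one)
    qed
    then show "\<exists>z. comp z (n + 1)" ..
  qed
  have unique: "sq z i = sq z' i" if "comp z n" "comp z' m" "i \<le> n" "i \<le> m" for z z' n m i
  proof -
    have "i \<le> n \<and> i \<le> m \<longrightarrow> sq z i = sq z' i"
    proof (rule mnum_induct[of "\<lambda>i. i \<le> n \<and> i \<le> m \<longrightarrow> sq z i = sq z' i"])
      show "Rec (\<lambda>e. e 0 \<le> n \<and> e 0 \<le> m \<longrightarrow> sq z (e 0) = sq z' (e 0))" by (intro recs)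
    qed (use that(1,2) in \<open>auto simp: comp_def\<close>)
    then show ?thesis using that by blast
  qed
  define h where "h n = sq (LEAST z. comp z n) n" for n
  have L: "comp (LEAST z. comp z n) n" for n
    using ex[of n] Least_Rec(1)[of "\<lambda>z. comp z n"] compR[OF RecF_var RecF_const] by blast
  show ?thesis
  proof
    have "RecF (\<lambda>e. LEAST z. comp z (e 0))"
      by (rule RecF_Least) (use ex in \<open>auto intro!: compR recs\<close>)
    then show "RecF (\<lambda>e. h (e 0))" unfolding h_def by (intro recs)
    show "h 0 = a" using L[of 0] by (simp add: h_def comp_def)
    fix n
    have "h n = sq (LEAST z. comp z (n + 1)) n"
      unfolding h_def by (rule unique[OF L L]) (auto simp: mnum_le_iff)
    then show "h (n + 1) = G n (h n)" using L[of "n + 1"] by (simp add: h_def comp_def)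
  qed
qed

text \<open>Choosing least witnesses turns a recursive relation into a recursive sequence.\<close>

theorem dependent_choice:
  assumes P: "Rec (\<lambda>e. P (e 0) (e (Suc 0)) (e (Suc (Suc 0))))" and ex: "\<And>n v. \<exists>w. P n v w"
  obtains h where "RecF (\<lambda>e. h (e 0))" "h 0 = a" "\<And>n. P n (h n) (h (n + 1))"
proof -
  define G where "G n v = (LEAST w. P n v w)" for n v
  have PR: "RecF s \<Longrightarrow> RecF t \<Longrightarrow> RecF u \<Longrightarrow> Rec (\<lambda>e. P (s e) (t e) (u e))" for s t u
    by (rule Rec_comp3[OF P])
  have "RecF (\<lambda>e. G (e 0) (e (Suc 0)))"
    unfolding G_def by (rule RecF_Least) (use ex in \<open>auto intro!: PR recs\<close>)
  then obtain h where h: "RecF (\<lambda>e. h (e 0))" "h 0 = a" "\<And>n. h (n + 1) = G n (h n)"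
    by (rule recursion[of G a]) (rule that)
  have "P n v (G n v)" for n v
  proof -
    obtain w where "P n v w" using ex by blast
    then show ?thesis unfolding G_def
      using Least_Rec(1)[of "\<lambda>w. P n v w"] PR[OF RecF_const RecF_const RecF_var] by blast
  qed
  then show ?thesis using that h by metis
qed


section \<open>Finite combinatorics in the model\<close>

text \<open>Lets the code of a block bound that block, and puts the candidates coded by z below
  every a > z.\<close>

lemma sq_le: "sq z i \<le> z"
proof -
  have "Rec (\<lambda>e. mem (pr i (e 0)) z \<or> e 0 = z)" by (intro recs)
  then show ?thesis
    unfolding sq_def using Least_Rec(2)[of "\<lambda>v. mem (pr i v) z \<or> v = z" z z]
    by (metis linorder_not_less)
qed

text \<open>The statement denies the existence of a code and is therefore \<Pi>_1, which is why
  \<open>Pi_induct\<close> is used.\<close>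

lemma pigeonhole:
  "\<not> (\<exists>z. \<forall>j<n + 1. sq z j < n \<and> (\<forall>j'<j. sq z j' \<noteq> sq z j))"
proof (rule Pi_induct[of "\<lambda>n. \<not> (\<exists>z. \<forall>j<n + 1. sq z j < n \<and> (\<forall>j'<j. sq z j' \<noteq> sq z j))"])
  show "Sg (\<lambda>e. \<not> \<not> (\<exists>z. \<forall>j<e 0 + 1. sq z j < e 0 \<and> (\<forall>j'<j. sq z j' \<noteq> sq z j)))"
    unfolding not_not by (rule Sg_ex, rule Sg_Rec) (intro recs)
  show "\<not> (\<exists>z. \<forall>j<0 + 1. sq z j < 0 \<and> (\<forall>j'<j. sq z j' \<noteq> sq z j))"
    by (auto simp: mnum_not_less_0)
  fix n assume IH: "\<not> (\<exists>z. \<forall>j<n + 1. sq z j < n \<and> (\<forall>j'<j. sq z j' \<noteq> sq z j))"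
  show "\<not> (\<exists>z. \<forall>j<n + 1 + 1. sq z j < n + 1 \<and> (\<forall>j'<j. sq z j' \<noteq> sq z j))"
  proof
    assume "\<exists>z. \<forall>j<n + 1 + 1. sq z j < n + 1 \<and> (\<forall>j'<j. sq z j' \<noteq> sq z j)"
    then obtain z where z: "\<And>j. j < n + 1 + 1 \<Longrightarrow> sq z j < n + 1"
      "\<And>j j'. j < n + 1 + 1 \<Longrightarrow> j' < j \<Longrightarrow> sq z j' \<noteq> sq z j" by blast
    \<comment> \<open>The last entry is dropped and its value replaces n wherever n occurs; the
      shorter sequence is still injective and stays below n.\<close>
    have "RecF (\<lambda>e. if sq z (e 0) = n then sq z (n + 1) else sq z (e 0))" by (intro recs)
    then obtain z' where z': "\<And>j. j < n + 1 \<Longrightarrow> sq z' j = (if sq z j = n then sq z (n + 1) else sq z j)"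
      using sequence_code[of "\<lambda>j. if sq z j = n then sq z (n + 1) else sq z j" "n + 1"] by blast
    have "sq z' j < n \<and> (\<forall>j'<j. sq z' j' \<noteq> sq z' j)" if j: "j < n + 1" for j
    proof -
      have less: "j < n + 1 + 1" using j by (meson mnum_less_add_one)
      have ne: "sq z j \<noteq> sq z (n + 1)" using z(2)[of "n + 1" j] j by simp
      have "sq z' j < n"
        using z(1)[OF less] z(1)[of "n + 1"] z'[OF j] ne mnum_less_add_one by (metis order_refl mnum_less_add_one_iff)
      moreover have "sq z' j' \<noteq> sq z' j" if j': "j' < j" for j'
      proof -
        have "j' < n + 1" using j j' by (rule order_less_trans[rotated])
        moreover have "sq z j' \<noteq> sq z (n + 1)" using z(2)[of "n + 1" j'] calculation by simp
        ultimately show ?thesis using z(2)[OF less j'] z' j ne by metis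
      qed
      ultimately show ?thesis by blast
    qed
    then show False using IH by blast
  qed
qed

text \<open>Otherwise sending j to a position of h j in s would be an injection of n + 1 numbers
  into n.\<close>

lemma avoid_finitely_many:
  assumes h: "RecF (\<lambda>e. h (e 0))" and inj: "\<And>j j'. j \<le> n \<Longrightarrow> j' < j \<Longrightarrow> h j' \<noteq> h j"
  shows "\<exists>j\<le>n. \<forall>k<n. sq s k \<noteq> h j"
proof (rule ccontr)
  assume *: "\<not> ?thesis"
  define \<kappa> where "\<kappa> j = (LEAST k. sq s k = h j \<or> k = n)" for j
  note hR = RecF_comp1[of h, OF h]
  have "RecF (\<lambda>e. \<kappa> (e 0))"
    unfolding \<kappa>_def by (rule RecF_Least) (auto intro!: recs hR)
  then obtain z where z: "\<And>j. j < n + 1 \<Longrightarrow> sq z j = \<kappa> j"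
    using sequence_code[of \<kappa> "n + 1"] by blast
  have \<kappa>: "\<kappa> j < n \<and> sq s (\<kappa> j) = h j" if j: "j \<le> n" for j
  proof -
    obtain k where k: "k < n" "sq s k = h j" using * j by blast
    have R: "Rec (\<lambda>e. sq s (e 0) = h j \<or> e 0 = n)" by (intro recs)
    have "\<not> n < n" "\<not> k < \<kappa> j"
      using Least_Rec(2)[of "\<lambda>k. sq s k = h j \<or> k = n" n k, OF R] k unfolding \<kappa>_def by auto
    then have "\<kappa> j < n" using k(1) by (meson linorder_not_less order_le_less_trans)
    moreover have "sq s (\<kappa> j) = h j \<or> \<kappa> j = n"
      using Least_Rec(1)[of "\<lambda>k. sq s k = h j \<or> k = n" n, OF R] unfolding \<kappa>_def by auto
    ultimately show ?thesis by auto
  qed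
  have "sq z j < n \<and> (\<forall>j'<j. sq z j' \<noteq> sq z j)" if j: "j < n + 1" for j
  proof -
    have "sq z j' \<noteq> sq z j" if j': "j' < j" for j'
    proof -
      have "j \<le> n" "j' \<le> n" "j' < n + 1" using j j' by auto
      then show ?thesis using \<kappa> z j inj[OF _ j'] by metis
    qed
    then show ?thesis using \<kappa>[of j] z[OF j] j by auto
  qed
  then show False using pigeonhole by blast
qed

text \<open>The \<open>k\<close>-th set has \<open>k + 1\<close> elements, so a greedy choice never gets stuck.\<close>

lemma distinct_representatives:
  assumes U: "Rec (\<lambda>e. U (e 0))" and Z: "RecF (\<lambda>e. Z (e 0))"
    and inj: "\<And>k j j'. U k \<Longrightarrow> j \<le> k \<Longrightarrow> j' < j \<Longrightarrow> sq (Z k) j' \<noteq> sq (Z k) j"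
  shows "\<exists>s. \<forall>k<n. U k \<longrightarrow> (\<exists>j\<le>k. sq s k = sq (Z k) j) \<and> (\<forall>k'<k. sq s k' \<noteq> sq s k)"
proof (rule Sg_induct[of "\<lambda>n. \<exists>s. \<forall>k<n. U k \<longrightarrow> (\<exists>j\<le>k. sq s k = sq (Z k) j) \<and> (\<forall>k'<k. sq s k' \<noteq> sq s k)"])
  show "Sg (\<lambda>e. \<exists>s. \<forall>k<e 0. U k \<longrightarrow> (\<exists>j\<le>k. sq s k = sq (Z k) j) \<and> (\<forall>k'<k. sq s k' \<noteq> sq s k))"
    by (rule Sg_ex, rule Sg_Rec) (intro recs Rec_comp1[of U, OF U] RecF_comp1[of Z, OF Z])
  fix n
  assume "\<exists>s. \<forall>k<n. U k \<longrightarrow> (\<exists>j\<le>k. sq s k = sq (Z k) j) \<and> (\<forall>k'<k. sq s k' \<noteq> sq s k)"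
  then obtain s where s: "\<And>k. k < n \<Longrightarrow> U k \<Longrightarrow> \<exists>j\<le>k. sq s k = sq (Z k) j"
    "\<And>k k'. k < n \<Longrightarrow> U k \<Longrightarrow> k' < k \<Longrightarrow> sq s k' \<noteq> sq s k" by blast
  have "\<exists>v. U n \<longrightarrow> (\<exists>j\<le>n. v = sq (Z n) j) \<and> (\<forall>k'<n. sq s k' \<noteq> v)"
  proof (cases "U n")
    case True
    have "RecF (\<lambda>e. sq (Z n) (e 0))" by (intro recs)
    then show ?thesis using avoid_finitely_many[of "sq (Z n)" n s] inj[OF True] by blast
  qed blast
  then obtain v where v: "U n \<Longrightarrow> (\<exists>j\<le>n. v = sq (Z n) j) \<and> (\<forall>k'<n. sq s k' \<noteq> v)" by blast
  obtain s' where s': "\<And>k. k < n \<Longrightarrow> sq s' k = sq s k" "sq s' n = v"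
    using sequence_append[of n s v] by blast
  have "(\<exists>j\<le>k. sq s' k = sq (Z k) j) \<and> (\<forall>k'<k. sq s' k' \<noteq> sq s' k)" if k: "k < n + 1" "U k" for k
  proof (cases "k = n")
    case True
    then show ?thesis using v s' k by simp
  next
    case False
    then have "k < n" using k(1) mnum_less_add_one by blast
    then show ?thesis using s[OF _ k(2)] s'(1) by (metis order_less_trans)
  qed
  then show "\<exists>s. \<forall>k<n + 1. U k \<longrightarrow> (\<exists>j\<le>k. sq s k = sq (Z k) j) \<and> (\<forall>k'<k. sq s k' \<noteq> sq s k)"
    by blast
qed (simp add: mnum_not_less_0)

definition incr :: "mnum \<Rightarrow> mnum \<Rightarrow> bool" where
  "incr z n \<longleftrightarrow> (\<forall>i<n. \<forall>j<i. sq z j < sq z i)"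

lemma Rec_incr [recs]: "RecF s \<Longrightarrow> RecF t \<Longrightarrow> Rec (\<lambda>e. incr (s e) (t e))"
  by (rule Rec_comp2[of incr], unfold incr_def) (intro recs | assumption)+

definition members :: "mnum \<Rightarrow> mnum \<Rightarrow> mnum set" where
  "members z n = {sq z i | i. i < n}"

lemma members_add_one: "members z (n + 1) = insert (sq z n) (members z n)"
  unfolding members_def by (auto simp: mnum_less_add_one simp del: mnum_less_add_one_iff)

lemma members_mono: "m \<le> n \<Longrightarrow> members z m \<subseteq> members z n"
  unfolding members_def by (blast intro: order_less_le_trans)

lemma incr_mono: "m \<le> n \<Longrightarrow> incr z n \<Longrightarrow> incr z m"
  unfolding incr_def by (meson order_less_le_trans)

lemma incr_append:
  assumes "incr t n" "\<And>y. y \<in> members t n \<Longrightarrow> y < v"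
  shows "\<exists>t'. incr t' (n + 1) \<and> members t' (n + 1) = insert v (members t n)"
proof -
  obtain t' where t': "\<And>i. i < n \<Longrightarrow> sq t' i = sq t i" "sq t' n = v"
    using sequence_append[of n t v] by blast
  have "incr t' (n + 1)" unfolding incr_def
  proof (intro allI impI)
    fix i j assume i: "i < n + 1" "j < i"
    show "sq t' j < sq t' i"
    proof (cases "i = n")
      case True
      then show ?thesis using assms(2) t' i unfolding members_def by auto
    next
      case False
      then have "i < n" using i(1) mnum_less_add_one by blast
      then show ?thesis using assms(1) t'(1) i(2) unfolding incr_def by (metis order_less_trans)
    qed
  qed
  moreover have "members t' (n + 1) = insert v (members t n)"
  proof -
    have "members t' n = members t n" unfolding members_def using t'(1) by (intro Collect_cong) metis
    then show ?thesis by (simp add: members_add_one t'(2))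
  qed
  ultimately show ?thesis by blast
qed

text \<open>The sequence is read once and each entry appended to one of two lists; entries arrive in
  increasing order, so both lists stay increasing.\<close>

lemma incr_split:
  assumes P: "Rec (\<lambda>e. P (e 0))" and z: "incr z n"
  shows "\<exists>t0 n0 t1 n1. n0 + n1 = n \<and> incr t0 n0 \<and> incr t1 n1 \<and>
    members t0 n0 \<subseteq> {y \<in> members z n. P y} \<and> members t1 n1 \<subseteq> {y \<in> members z n. \<not> P y}"
proof -
  \<comment> \<open>Written with indices, since bounded quantifiers show that the invariant is
    recursive; the form with \<open>members\<close> is used for reasoning.\<close>
  let ?\<phi> = "\<lambda>m t0 n0 t1 n1. n0 + n1 = m \<and> incr t0 n0 \<and> incr t1 n1 \<and>
    (\<forall>i<n0. P (sq t0 i) \<and> (\<exists>j<m. sq t0 i = sq z j)) \<and>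
    (\<forall>i<n1. \<not> P (sq t1 i) \<and> (\<exists>j<m. sq t1 i = sq z j))"
  have \<phi>: "?\<phi> m t0 n0 t1 n1 \<longleftrightarrow> n0 + n1 = m \<and> incr t0 n0 \<and> incr t1 n1 \<and>
    members t0 n0 \<subseteq> {y \<in> members z m. P y} \<and> members t1 n1 \<subseteq> {y \<in> members z m. \<not> P y}"
    for m t0 n0 t1 n1 unfolding members_def by blast
  have "n \<le> n \<longrightarrow> (\<exists>t0 n0 t1 n1. ?\<phi> n t0 n0 t1 n1)"
  proof (rule Sg_induct[of "\<lambda>m. m \<le> n \<longrightarrow> (\<exists>t0 n0 t1 n1. ?\<phi> m t0 n0 t1 n1)"])
    show "Sg (\<lambda>e. e 0 \<le> n \<longrightarrow> (\<exists>t0 n0 t1 n1. ?\<phi> (e 0) t0 n0 t1 n1))"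
      by (rule Sg_imp, intro recs, (rule Sg_ex)+, rule Sg_Rec) (intro recs Rec_comp1[of P, OF P])
    have "?\<phi> 0 0 0 0 0" by (simp add: mnum_not_less_0 incr_def)
    then show "0 \<le> n \<longrightarrow> (\<exists>t0 n0 t1 n1. ?\<phi> 0 t0 n0 t1 n1)" by blast
    fix m assume IH: "m \<le> n \<longrightarrow> (\<exists>t0 n0 t1 n1. ?\<phi> m t0 n0 t1 n1)"
    show "m + 1 \<le> n \<longrightarrow> (\<exists>t0 n0 t1 n1. ?\<phi> (m + 1) t0 n0 t1 n1)"
      unfolding \<phi>
    proof
      assume m: "m + 1 \<le> n"
      then have "m \<le> n" by auto
      then obtain t0 n0 t1 n1 where t: "n0 + n1 = m" "incr t0 n0" "incr t1 n1"
        "members t0 n0 \<subseteq> {y \<in> members z m. P y}" "members t1 n1 \<subseteq> {y \<in> members z m. \<not> P y}"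
        using IH unfolding \<phi> by blast
      have lt: "y < sq z m" if "y \<in> members z m" for y
        using that z m unfolding members_def incr_def by auto
      show "\<exists>t0 n0 t1 n1. n0 + n1 = m + 1 \<and> incr t0 n0 \<and> incr t1 n1 \<and>
          members t0 n0 \<subseteq> {y \<in> members z (m + 1). P y} \<and> members t1 n1 \<subseteq> {y \<in> members z (m + 1). \<not> P y}"
      proof (cases "P (sq z m)")
        case True
        obtain t' where "incr t' (n0 + 1)" "members t' (n0 + 1) = insert (sq z m) (members t0 n0)"
          using incr_append[OF t(2), of "sq z m"] lt t(4) by blast
        moreover have "n0 + 1 + n1 = m + 1" using t(1) by (simp add: ac_simps)
        ultimately show ?thesis using t True
          by (intro exI[of _ t'] exI[of _ "n0 + 1"] exI[of _ t1] exI[of _ n1]) (auto simp: members_add_one)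
      next
        case False
        obtain t' where "incr t' (n1 + 1)" "members t' (n1 + 1) = insert (sq z m) (members t1 n1)"
          using incr_append[OF t(3), of "sq z m"] lt t(5) by blast
        moreover have "n0 + (n1 + 1) = m + 1" using t(1) by (simp add: ac_simps)
        ultimately show ?thesis using t False
          by (intro exI[of _ t0] exI[of _ n0] exI[of _ t'] exI[of _ "n1 + 1"]) (auto simp: members_add_one)
      qed
    qed
  qed
  then show ?thesis unfolding \<phi> by simp
qed

text \<open>By repeated halving, starting from \<open>2\<^sup>Q * l\<close> numbers.\<close>

lemma homogeneous_sequence:
  assumes P: "Rec (\<lambda>e. P (e 0) (e (Suc 0)))"
  shows "\<exists>z. incr z l \<and> (\<forall>y\<in>members z l. N < y) \<and>
    (\<forall>b<Q. \<forall>x\<in>members z l. \<forall>y\<in>members z l. P b x \<longleftrightarrow> P b y)"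
proof -
  have PR: "RecF s \<Longrightarrow> RecF t \<Longrightarrow> Rec (\<lambda>e. P (s e) (t e))" for s t by (rule Rec_comp2[OF P])
  \<comment> \<open>Exponentiation is not a term of the language, so powers of two are obtained by
    recursion.\<close>
  have "RecF (\<lambda>e. e (Suc 0) + e (Suc 0))" by (intro recs)
  then obtain pow where pow: "RecF (\<lambda>e. pow (e 0))" "pow 0 = 1" "\<And>n. pow (n + 1) = pow n + pow n"
    by (rule recursion[of "\<lambda>_ v. v + v" 1]) (rule that)
  note powR = RecF_comp1[of pow, OF pow(1)]
  have pow_pos: "0 < pow n" for n
  proof (rule mnum_induct[of "\<lambda>n. 0 < pow n"])
    show "Rec (\<lambda>e. 0 < pow (e 0))" by (intro recs powR)
    show "0 < pow (n + 1)" if "0 < pow n" for n using that pow(3) mnum_add_eq_0 by auto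
  qed (simp add: pow(2))
  \<comment> \<open>After q halvings at least \<open>pow (Q - q) * l\<close> entries remain; the
    inequality says this without subtraction or division.\<close>
  let ?\<phi> = "\<lambda>q z L. pow Q * l \<le> L * pow q \<and> incr z L \<and> (\<forall>i<L. N < sq z i) \<and>
    (\<forall>b<q. \<forall>i<L. \<forall>j<L. P b (sq z i) \<longleftrightarrow> P b (sq z j))"
  have \<phi>: "?\<phi> q z L \<longleftrightarrow> pow Q * l \<le> L * pow q \<and> incr z L \<and> (\<forall>y\<in>members z L. N < y) \<and>
    (\<forall>b<q. \<forall>x\<in>members z L. \<forall>y\<in>members z L. P b x \<longleftrightarrow> P b y)" for q z L
    unfolding members_def by blast
  have "\<exists>z L. ?\<phi> Q z L"
  proof (rule Sg_induct[of "\<lambda>q. \<exists>z L. ?\<phi> q z L"])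
    show "Sg (\<lambda>e. \<exists>z L. ?\<phi> (e 0) z L)"
      by ((rule Sg_ex)+, rule Sg_Rec) (intro recs PR powR)
    have "RecF (\<lambda>e. N + 1 + e 0)" by (intro recs)
    then obtain z where z: "\<And>i. i < pow Q * l \<Longrightarrow> sq z i = N + 1 + i"
      using sequence_code[of "\<lambda>i. N + 1 + i" "pow Q * l"] by blast
    have "N < N + 1 + i" for i unfolding mnum_less_iff by (metis add.commute add.assoc)
    then have "?\<phi> 0 z (pow Q * l)"
      using z by (auto simp: pow(2) incr_def mnum_not_less_0)
    then show "\<exists>z L. ?\<phi> 0 z L" by blast
    fix q assume "\<exists>z L. ?\<phi> q z L"
    then obtain z L where z: "pow Q * l \<le> L * pow q" "incr z L" "\<forall>y\<in>members z L. N < y"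
      "\<forall>b<q. \<forall>x\<in>members z L. \<forall>y\<in>members z L. P b x \<longleftrightarrow> P b y"
      unfolding \<phi> by blast
    have "Rec (\<lambda>e. P q (e 0))" by (intro PR recs)
    then obtain t0 n0 t1 n1 where t: "n0 + n1 = L" "incr t0 n0" "incr t1 n1"
      "members t0 n0 \<subseteq> {y \<in> members z L. P q y}" "members t1 n1 \<subseteq> {y \<in> members z L. \<not> P q y}"
      using incr_split[of "P q", OF _ z(2)] by blast
    have half: "pow Q * l \<le> n * pow (q + 1)" if "L \<le> n + n" for n
    proof -
      have "L * pow q \<le> (n + n) * pow q" using that by (intro mult_right_mono) auto
      also have "\<dots> = n * pow (q + 1)" unfolding pow(3) by (simp add: algebra_simps)
      finally show ?thesis by (rule order_trans[OF z(1)])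
    qed
    have hom: "\<forall>b<q + 1. \<forall>x\<in>members t n. \<forall>y\<in>members t n. P b x \<longleftrightarrow> P b y"
      if "members t n \<subseteq> {y \<in> members z L. P q y} \<or> members t n \<subseteq> {y \<in> members z L. \<not> P q y}" for t n
      using that z(4) mnum_less_add_one by blast
    show "\<exists>z L. ?\<phi> (q + 1) z L"
      unfolding \<phi>
    proof (cases "n1 \<le> n0")
      case True
      then have "L \<le> n0 + n0" using t(1) by auto
      then show "\<exists>z L. pow Q * l \<le> L * pow (q + 1) \<and> incr z L \<and> (\<forall>y\<in>members z L. N < y) \<and>
          (\<forall>b<q + 1. \<forall>x\<in>members z L. \<forall>y\<in>members z L. P b x \<longleftrightarrow> P b y)"
        using half hom[of t0 n0] t(2,4) z(3) by (intro exI[of _ t0] exI[of _ n0]) blast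
    next
      case False
      then have "L \<le> n1 + n1" using t(1) by (metis add_right_mono linorder_linear)
      then show "\<exists>z L. pow Q * l \<le> L * pow (q + 1) \<and> incr z L \<and> (\<forall>y\<in>members z L. N < y) \<and>
          (\<forall>b<q + 1. \<forall>x\<in>members z L. \<forall>y\<in>members z L. P b x \<longleftrightarrow> P b y)"
        using half hom[of t1 n1] t(3,5) z(3) by (intro exI[of _ t1] exI[of _ n1]) blast
    qed
  qed
  then obtain z L where z: "pow Q * l \<le> L * pow Q" "incr z L" "\<forall>y\<in>members z L. N < y"
      "\<forall>b<Q. \<forall>x\<in>members z L. \<forall>y\<in>members z L. P b x \<longleftrightarrow> P b y"
    unfolding \<phi> by blast
  have l: "l \<le> L"
    by (rule mult_right_le_imp_le[OF _ pow_pos[of Q]]) (use z(1) in \<open>simp add: mult.commute\<close>)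
  then have sub: "members z l \<subseteq> members z L" and "incr z l"
    using z(2) members_mono incr_mono by blast+
  moreover have "\<forall>y\<in>members z l. N < y" using sub z(3) by blast
  moreover have "\<forall>b<Q. \<forall>x\<in>members z l. \<forall>y\<in>members z l. P b x \<longleftrightarrow> P b y"
    using sub z(4) by (meson subsetD)
  ultimately show ?thesis by blast
qed

lemma infinite_set_enumeration:
  assumes A: "A \<in> MS" "\<And>n. \<exists>x>n. x \<in> A"
  shows "\<exists>z. incr z n \<and> members z n \<subseteq> A"
proof -
  have *: "members z n \<subseteq> A \<longleftrightarrow> (\<forall>i<n. sq z i \<in> A)" for z n unfolding members_def by blast
  show ?thesis
  proof (rule Sg_induct[of "\<lambda>n. \<exists>z. incr z n \<and> members z n \<subseteq> A"])
    show "Sg (\<lambda>e. \<exists>z. incr z (e 0) \<and> members z (e 0) \<subseteq> A)"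
      unfolding * by (rule Sg_ex, rule Sg_Rec) (intro recs A(1))
    show "\<exists>z. incr z 0 \<and> members z 0 \<subseteq> A" by (simp add: incr_def members_def mnum_not_less_0)
    fix n assume "\<exists>z. incr z n \<and> members z n \<subseteq> A"
    then obtain z where z: "incr z n" "members z n \<subseteq> A" by blast
    \<comment> \<open>A number above the code z is above all its entries.\<close>
    obtain v where v: "z < v" "v \<in> A" using A(2) by blast
    have "y < v" if "y \<in> members z n" for y
      using that sq_le v(1) unfolding members_def by (blast intro: order_le_less_trans)
    then show "\<exists>z. incr z (n + 1) \<and> members z (n + 1) \<subseteq> A"
      using incr_append[OF z(1), of v] z(2) v(2) by (metis insert_subset)
  qed
qed


section \<open>Thin sets yield rainbows\<close>

locale two_bounded_coloring =
  fixes f :: "mnum \<Rightarrow> mnum \<Rightarrow> mnum"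
  assumes f_rec: "RecF (\<lambda>e. f (e 0) (e (Suc 0)))"
    and two_bounded: "\<lbrakk>x < y; x' < y'; x'' < y''; f x y = f x' y'; f x y = f x'' y''\<rbrakk> \<Longrightarrow>
      x = x' \<and> y = y' \<or> x = x'' \<and> y = y'' \<or> x' = x'' \<and> y' = y''"
begin

lemma RecF_f: "RecF s \<Longrightarrow> RecF t \<Longrightarrow> RecF (\<lambda>e. f (s e) (t e))"
  by (rule RecF_comp2[OF f_rec])

text \<open>For \<open>b = \<langle>\<langle>u, x\<rangle>, y\<rangle>\<close> this is \<open>f(u, v) = f(x, y)\<close> if \<open>x < y\<close>, and \<open>f(u, v) = f(x, v)\<close>
  otherwise.\<close>

definition agree :: "mnum \<Rightarrow> mnum \<Rightarrow> bool" where
  "agree b v \<longleftrightarrow> f (p1 (p1 b)) v =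
    f (p2 (p1 b)) (if p2 (p1 b) < p2 b then p2 b else v)"

lemma Rec_agree: "RecF s \<Longrightarrow> RecF t \<Longrightarrow> Rec (\<lambda>e. agree (s e) (t e))"
  by (rule Rec_comp2[of agree], unfold agree_def) (intro recs RecF_f | assumption)+

text \<open>Length a + 2 leaves room for every index z \<le> a and gives two elements even for a =
  0. Triples with entries up to v have codes up to \<open>pr (pr v v) v\<close>. Taking the code of
  the previous block as v covers all its elements.\<close>

definition next_block :: "mnum \<Rightarrow> mnum \<Rightarrow> mnum \<Rightarrow> bool" where
  "next_block a v z \<longleftrightarrow> incr z (a + 1 + 1) \<and> (\<forall>i<a + 1 + 1. v < sq z i \<and>
    (\<forall>b<pr (pr v v) v + 1. agree b (sq z i) \<longleftrightarrow> agree b (sq z 0)))"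

lemma blocks_exist:
  obtains h where "RecF (\<lambda>e. h (e 0))" "\<And>a. next_block a (h a) (h (a + 1))"
proof -
  have "Rec (\<lambda>e. next_block (e 0) (e (Suc 0)) (e (Suc (Suc 0))))"
    unfolding next_block_def by (intro recs Rec_agree)
  moreover have "\<exists>z. next_block a v z" for a v
  proof -
    have "Rec (\<lambda>e. agree (e 0) (e (Suc 0)))" by (intro Rec_agree recs)
    then obtain z where z: "incr z (a + 1 + 1)" "\<forall>y\<in>members z (a + 1 + 1). v < y"
      "\<forall>b<pr (pr v v) v + 1. \<forall>x\<in>members z (a + 1 + 1). \<forall>y\<in>members z (a + 1 + 1). agree b x \<longleftrightarrow> agree b y"
      using homogeneous_sequence by blast
    have "0 < a + 1 + 1" by simp
    then have "next_block a v z" using z unfolding next_block_def members_def by blast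
    then show ?thesis ..
  qed
  ultimately obtain h where "RecF (\<lambda>e. h (e 0))" "h 0 = 0" "\<And>a. next_block a (h a) (h (a + 1))"
    by (rule dependent_choice[of next_block]) (rule that)
  then show ?thesis using that by blast
qed

end

locale coloring_blocks = two_bounded_coloring +
  fixes h :: "mnum \<Rightarrow> mnum"
  assumes h_rec: "RecF (\<lambda>e. h (e 0))" and h_next: "next_block a (h a) (h (a + 1))"
begin

definition B :: "mnum \<Rightarrow> mnum \<Rightarrow> mnum" where "B a i = sq (h (a + 1)) i"

lemma RecF_h: "RecF s \<Longrightarrow> RecF (\<lambda>e. h (s e))"
  by (rule RecF_comp1[of h, OF h_rec])

lemma RecF_B: "RecF s \<Longrightarrow> RecF t \<Longrightarrow> RecF (\<lambda>e. B (s e) (t e))"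
  unfolding B_def by (intro recs RecF_h)

lemma B_le: "B a i \<le> h (a + 1)"
  unfolding B_def by (rule sq_le)

lemma le_less_add_two: "i \<le> a \<Longrightarrow> i < a + 1 + (1::mnum)"
  by (meson mnum_less_add_one mnum_less_add_one_iff)

lemma h_less_B: "i \<le> a \<Longrightarrow> h a < B a i"
  using h_next[of a] le_less_add_two unfolding next_block_def B_def by blast

lemma h_mono: "a \<le> b \<Longrightarrow> h a \<le> h b"
proof -
  have "a \<le> b \<longrightarrow> h a \<le> h b"
  proof (rule mnum_induct[of "\<lambda>b. a \<le> b \<longrightarrow> h a \<le> h b"])
    show "Rec (\<lambda>e. a \<le> e 0 \<longrightarrow> h a \<le> h (e 0))" by (intro recs RecF_h)
    show "a \<le> b + 1 \<longrightarrow> h a \<le> h (b + 1)" if IH: "a \<le> b \<longrightarrow> h a \<le> h b" for b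
    proof
      assume "a \<le> b + 1"
      have "h b < h (b + 1)" using h_less_B[of 0 b] B_le[of b 0] by (meson mnum_zero_le order_less_le_trans)
      then show "h a \<le> h (b + 1)"
        using IH \<open>a \<le> b + 1\<close> by (metis mnum_less_add_one order_le_less order_trans)
    qed
  qed auto
  then show "a \<le> b \<Longrightarrow> h a \<le> h b" by blast
qed

lemma B_le_h: "b < a \<Longrightarrow> B b i \<le> h a"
  using B_le[of b i] h_mono[of "b + 1" a] by (meson mnum_add_one_le_iff order_trans)

lemma B_inject:
  assumes "B b z = B b' z'" "z \<le> b" "z' \<le> b'"
  shows "b = b' \<and> z = z'"
proof -
  have "b = b'"
    using assms h_less_B B_le_h by (metis linorder_neqE order_less_le_trans order_less_irrefl)
  moreover have "z = z'"
  proof (rule ccontr)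
    assume "z \<noteq> z'"
    moreover have "incr (h (b + 1)) (b + 1 + 1)" using h_next unfolding next_block_def by blast
    ultimately show False
      using assms \<open>b = b'\<close> le_less_add_two unfolding B_def incr_def
      by (metis linorder_neqE order_less_irrefl)
  qed
  ultimately show ?thesis ..
qed

lemma B_0_less_B_1: "B a 0 < B a 1"
proof -
  have "(1::mnum) < a + 1 + 1" "(0::mnum) < 1" by simp_all
  then show ?thesis using h_next[of a] unfolding next_block_def incr_def B_def by blast
qed

lemma agree_B:
  assumes "u \<le> h a" "x \<le> h a" "y \<le> h a" "i < a + 1 + 1"
  shows "agree (pr (pr u x) y) (B a i) \<longleftrightarrow> agree (pr (pr u x) y) (B a 0)"
proof -
  have "pr (pr u x) y < pr (pr (h a) (h a)) (h a) + 1"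
    using assms by (simp add: pr_mono)
  then show ?thesis using h_next[of a] assms(4) unfolding next_block_def B_def by blast
qed

text \<open>By homogeneity the color of the earlier pair would recur at the indices 0 and 1 of block
  a, and three different pairs would share it.\<close>

lemma no_shared_color_with_block:
  assumes "x < y" "y \<le> h a" "u \<le> h a" "z \<le> a"
  shows "f u (B a z) \<noteq> f x y"
proof
  assume *: "f u (B a z) = f x y"
  have x: "x \<le> h a" using assms(1,2) by simp
  have agree: "agree (pr (pr u x) y) v \<longleftrightarrow> f u v = f x y" for v
    using assms(1) by (simp add: agree_def)
  have "f u (B a 0) = f x y"
    using agree_B[OF assms(3) x assms(2) le_less_add_two[OF assms(4)]] * unfolding agree by blast
  moreover have "(1::mnum) < a + 1 + 1" by simp
  then have "f u (B a 1) = f x y"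
    using agree_B[OF assms(3) x assms(2)] calculation unfolding agree by blast
  moreover have "y < B a 0" using assms(2) h_less_B[of 0 a] by (simp add: order_le_less_trans)
  ultimately show False
    using two_bounded[of x y u "B a 0" u "B a 1"] assms(1,3) B_0_less_B_1[of a] h_less_B[of 0 a]
    by (metis mnum_zero_le order_le_less_trans order_less_irrefl order_less_trans)
qed

text \<open>Index 0 may represent the block in \<open>wants\<close>. The code with y = 0 compares
  f(u, v) with f(x, v), because x < 0 fails.\<close>

lemma shared_color_in_block:
  assumes "u \<le> h a" "x \<le> h a" "z \<le> a" "f u (B a z) = f x (B a z)"
  shows "f u (B a 0) = f x (B a 0)"
proof -
  have agree: "agree (pr (pr u x) 0) v \<longleftrightarrow> f u v = f x v" for v
    by (simp add: agree_def mnum_not_less_0)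
  show ?thesis
    using agree_B[OF assms(1,2) _ le_less_add_two[OF assms(3)], of 0] assms(4) unfolding agree by simp
qed

text \<open>At stage \<open>a\<close>, the requirement \<open>k = \<langle>u, c\<rangle>\<close> looks at the partner \<open>B b z\<close> of \<open>u\<close>, i.e. the number
  which together with \<open>u\<close> spoils the whole block \<open>B a\<close>. It is unique as \<open>f\<close> is 2-bounded. The number
  \<open>z\<close> codes candidates, one of which will receive the color \<open>c\<close>.\<close>

definition wants :: "mnum \<Rightarrow> mnum \<Rightarrow> mnum \<Rightarrow> bool" where
  "wants a k z \<longleftrightarrow> (\<exists>b<a. z < b \<and> p1 k < B b z \<and> f (p1 k) (B a 0) = f (B b z) (B a 0)) \<and> incr z (k + 1)"

text \<open>The default a exceeds every genuine z, since z < b < a, so the least value is genuine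
  whenever one exists.\<close>

definition wanted :: "mnum \<Rightarrow> mnum \<Rightarrow> mnum" where
  "wanted a k = (LEAST z. wants a k z \<or> z = a)"

definition active :: "mnum \<Rightarrow> mnum \<Rightarrow> bool" where
  "active a k \<longleftrightarrow> wants a k (wanted a k)"

definition chosen :: "mnum \<Rightarrow> mnum" where
  "chosen a = (LEAST s. \<forall>k<a. active a k \<longrightarrow>
    (\<exists>j\<le>k. sq s k = sq (wanted a k) j) \<and> (\<forall>k'<k. sq s k' \<noteq> sq s k))"

text \<open>The default a marks numbers that serve no requirement; their color is arbitrary.\<close>

definition requirement :: "mnum \<Rightarrow> mnum \<Rightarrow> mnum" where
  "requirement d a = (LEAST k. k < a \<and> active a k \<and> sq (chosen a) k = d \<or> k = a)"

definition g :: "mnum \<Rightarrow> mnum \<Rightarrow> mnum" where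
  "g d a = p2 (requirement d a)"

section \<open>Recursiveness and correctness of the auxiliary coloring\<close>

lemma Rec_wants: "RecF s \<Longrightarrow> RecF t \<Longrightarrow> RecF u \<Longrightarrow> Rec (\<lambda>e. wants (s e) (t e) (u e))"
  by (rule Rec_comp3[of wants], unfold wants_def) (intro recs RecF_B RecF_f | assumption)+

lemma RecF_wanted: "RecF s \<Longrightarrow> RecF t \<Longrightarrow> RecF (\<lambda>e. wanted (s e) (t e))"
  by (rule RecF_comp2[of wanted], unfold wanted_def, rule RecF_Least) (auto intro!: recs Rec_wants)

lemma Rec_active: "RecF s \<Longrightarrow> RecF t \<Longrightarrow> Rec (\<lambda>e. active (s e) (t e))"
  unfolding active_def by (intro Rec_wants RecF_wanted)

lemma active_incr: "active a k \<Longrightarrow> incr (wanted a k) (k + 1)"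
  unfolding active_def wants_def by blast

lemma chosen_exists: "\<exists>s. \<forall>k<a. active a k \<longrightarrow>
    (\<exists>j\<le>k. sq s k = sq (wanted a k) j) \<and> (\<forall>k'<k. sq s k' \<noteq> sq s k)"
proof (rule distinct_representatives)
  show "Rec (\<lambda>e. active a (e 0))" by (intro Rec_active recs)
  show "RecF (\<lambda>e. wanted a (e 0))" by (intro RecF_wanted recs)
  show "sq (wanted a k) j' \<noteq> sq (wanted a k) j" if "active a k" "j \<le> k" "j' < j" for k j j'
    using active_incr[OF that(1)] that(2,3) unfolding incr_def
    by (metis mnum_less_add_one_iff order_less_irrefl)
qed

lemma Rec_chosen: "Rec (\<lambda>e. \<forall>k<e (Suc 0). active (e (Suc 0)) k \<longrightarrow>
    (\<exists>j\<le>k. sq (e 0) k = sq (wanted (e (Suc 0)) k) j) \<and> (\<forall>k'<k. sq (e 0) k' \<noteq> sq (e 0) k))"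
  by (intro recs Rec_active RecF_wanted)

lemma RecF_chosen: "RecF s \<Longrightarrow> RecF (\<lambda>e. chosen (s e))"
  by (rule RecF_comp1[of chosen], unfold chosen_def, rule RecF_Least)
    (use Rec_chosen chosen_exists in simp_all)

lemma RecF_g:
  assumes "RecF s" "RecF t"
  shows "RecF (\<lambda>e. g (s e) (t e))"
proof -
  have "RecF (\<lambda>e. requirement (e 0) (e (Suc 0)))"
    unfolding requirement_def by (rule RecF_Least) (auto intro!: recs Rec_active RecF_chosen)
  then have "RecF (\<lambda>e. requirement (s e) (t e))"
    by (rule RecF_comp2[of requirement]) (rule assms)+
  then show ?thesis unfolding g_def by (rule RecF_p2)
qed

lemma chosen:
  assumes "k < a" "active a k"
  shows "\<exists>j\<le>k. sq (chosen a) k = sq (wanted a k) j" "k' < k \<Longrightarrow> sq (chosen a) k' \<noteq> sq (chosen a) k"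
proof -
  let ?\<phi> = "\<lambda>s. \<forall>k<a. active a k \<longrightarrow>
    (\<exists>j\<le>k. sq s k = sq (wanted a k) j) \<and> (\<forall>k'<k. sq s k' \<noteq> sq s k)"
  have "Rec (\<lambda>e. ?\<phi> (e 0))" by (intro recs Rec_active RecF_wanted)
  then have "?\<phi> (chosen a)"
    unfolding chosen_def using Least_Rec(1)[of ?\<phi>] chosen_exists[of a] by blast
  then show "\<exists>j\<le>k. sq (chosen a) k = sq (wanted a k) j"
    "k' < k \<Longrightarrow> sq (chosen a) k' \<noteq> sq (chosen a) k"
    using assms by blast+
qed

text \<open>A number chosen for k was not chosen for any smaller requirement, so the least search
  returns k itself.\<close>

lemma requirement_chosen:
  assumes "k < a" "active a k"
  shows "requirement (sq (chosen a) k) a = k"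
  unfolding requirement_def
proof (rule Least_equality)
  fix k' assume k': "k' < a \<and> active a k' \<and> sq (chosen a) k' = sq (chosen a) k \<or> k' = a"
  show "k \<le> k'"
  proof (rule ccontr)
    assume "\<not> k \<le> k'"
    then have "k' < k" by simp
    then show False using chosen(2)[OF assms] k' assms(1) by auto
  qed
qed (use assms in simp)

text \<open>Two different partners would give three pairs with top \<open>B a 0\<close> and one
  color. The common partner then determines its index by \<open>B_inject\<close>.\<close>

lemma wants_unique:
  assumes "wants a k z" "wants a k z'"
  shows "z = z'"
proof -
  obtain b b' where b: "b < a" "z < b" "p1 k < B b z" "f (p1 k) (B a 0) = f (B b z) (B a 0)"
    and b': "b' < a" "z' < b'" "p1 k < B b' z'" "f (p1 k) (B a 0) = f (B b' z') (B a 0)"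
    using assms unfolding wants_def by blast
  have "B b z < B a 0" "B b' z' < B a 0"
    using B_le_h[OF b(1)] B_le_h[OF b'(1)] h_less_B[of 0 a] by (auto intro: order_le_less_trans)
  then have "B b z = B b' z'"
    using two_bounded[of "p1 k" "B a 0" "B b z" "B a 0" "B b' z'" "B a 0"] b b'
    by (metis order_less_irrefl order_less_trans)
  then show ?thesis using B_inject b(2) b'(2) by (meson order_less_imp_le)
qed

lemma wanted_eq:
  assumes "wants a k z"
  shows "wanted a k = z"
  unfolding wanted_def
proof (rule Least_equality)
  fix z' assume "wants a k z' \<or> z' = a"
  then show "z \<le> z'"
  proof
    assume "z' = a"
    then show ?thesis using assms unfolding wants_def by (meson order_less_imp_le order_less_trans)
  qed (use wants_unique[OF assms] in simp)
qed (use assms in simp)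

text \<open>Otherwise one of the candidates coded by z, an element of A below a, would have received
  color c at stage a.\<close>

lemma thin_set_avoids_partners:
  assumes A: "members z (k + 1) \<subseteq> A" "a \<in> A" and thin: "\<And>x y. x \<in> A \<Longrightarrow> y \<in> A \<Longrightarrow> x < y \<Longrightarrow> g x y \<noteq> c"
    and k: "p2 k = c" "k < a"
  shows "\<not> wants a k z"
proof
  assume w: "wants a k z"
  then have z: "wanted a k = z" by (rule wanted_eq)
  then have active: "active a k" using w by (simp add: active_def)
  obtain j where j: "j \<le> k" "sq (chosen a) k = sq z j"
    using chosen(1)[OF k(2) active] z by blast
  have "sq z j \<in> A" using A(1) j(1) unfolding members_def by auto
  moreover have "sq z j < a"
    using sq_le[of z j] w unfolding wants_def by (meson order_le_less_trans order_less_trans)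
  moreover have "g (sq z j) a = c"
    unfolding g_def j(2)[symmetric] requirement_chosen[OF k(2) active] by (rule k(1))
  ultimately show False using thin A(2) by blast
qed

text \<open>The index of each new element codes more members of A than the requirement of its
  predecessor and c demands. As the elements increase, this also suffices for the requirements of
  all earlier elements.\<close>

lemma rainbow_from_thin_set:
  assumes A: "A \<in> MS" "\<And>n. \<exists>x>n. x \<in> A" and thin: "\<And>x y. x \<in> A \<Longrightarrow> y \<in> A \<Longrightarrow> x < y \<Longrightarrow> g x y \<noteq> c"
  shows "\<exists>R\<in>MS. (\<forall>n. \<exists>x>n. x \<in> R) \<and>
    (\<forall>x\<in>R. \<forall>y\<in>R. \<forall>u\<in>R. \<forall>v\<in>R. x < y \<longrightarrow> u < v \<longrightarrow> f x y = f u v \<longrightarrow> x = u \<and> y = v)"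
proof -
  let ?r = "\<lambda>v. B (p2 v) (p1 v)"
  \<comment> \<open>An element \<open>B a z\<close> is represented by \<open>pr z a\<close>. The
    bound \<open>p1 w < p2 w\<close> keeps the index inside the block, and
    \<open>pr (?r v) c < p2 w\<close> ensures that the requirement is already considered at the new
    stage.\<close>
  define step where "step v w \<longleftrightarrow> p2 v < p2 w \<and> p1 w < p2 w \<and> pr (?r v) c < p2 w \<and> p2 w \<in> A \<and>
    incr (p1 w) (pr (?r v) c + 1) \<and> (\<forall>i<pr (?r v) c + 1. sq (p1 w) i \<in> A)" for v w
  have "Rec (\<lambda>e. step (e (Suc 0)) (e (Suc (Suc 0))))"
    unfolding step_def by (intro recs RecF_B A(1))
  moreover have "\<exists>w. step v w" for v
  proof -
    obtain z where z: "incr z (pr (?r v) c + 1)" "members z (pr (?r v) c + 1) \<subseteq> A"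
      using infinite_set_enumeration[OF A] by blast
    obtain a where a: "max z (max (p2 v) (pr (?r v) c)) < a" "a \<in> A" using A(2) by blast
    have "step v (pr z a)" using z a unfolding step_def members_def by auto
    then show ?thesis ..
  qed
  ultimately obtain \<rho> where \<rho>: "RecF (\<lambda>e. \<rho> (e 0))" "\<rho> 0 = 0" "\<And>n. step (\<rho> n) (\<rho> (n + 1))"
    by (rule dependent_choice[of "\<lambda>_. step"]) (rule that)
  define r where "r n = ?r (\<rho> n)" for n
  define a where "a n = p2 (\<rho> n)" for n
  define z where "z n = p1 (\<rho> n)" for n
  have rB: "r n = B (a n) (z n)" for n by (simp add: r_def a_def z_def)
  have st: "a n < a (n + 1)" "z (n + 1) < a (n + 1)" "pr (r n) c < a (n + 1)" "a (n + 1) \<in> A"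
    "incr (z (n + 1)) (pr (r n) c + 1)" "members (z (n + 1)) (pr (r n) c + 1) \<subseteq> A" for n
    using \<rho>(3)[of n] unfolding step_def r_def a_def z_def members_def by auto
  have rR: "RecF (\<lambda>e. r (s e))" if "RecF s" for s
    unfolding r_def by (intro recs RecF_B RecF_comp1[of \<rho>, OF \<rho>(1)] that)
  have aR: "RecF (\<lambda>e. a (s e))" if "RecF s" for s
    unfolding a_def by (intro recs RecF_comp1[of \<rho>, OF \<rho>(1)] that)
  have lt_h: "r n \<le> h (a (n + 1))" for n using B_le_h[OF st(1)] rB by simp
  have h_lt: "h (a (n + 1)) < r (n + 1)" for n
    using h_less_B[OF order_less_imp_le[OF st(2)]] rB by simp
  have r_step: "r n < r (n + 1)" for n using lt_h h_lt by (rule order_le_less_trans)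
  have mono: "n < m \<longrightarrow> r n < r m \<and> a n < a m" for n m
  proof (rule mnum_induct[of "\<lambda>m. n < m \<longrightarrow> r n < r m \<and> a n < a m"])
    show "Rec (\<lambda>e. n < e 0 \<longrightarrow> r n < r (e 0) \<and> a n < a (e 0))" by (intro recs rR aR)
    show "n < m + 1 \<longrightarrow> r n < r (m + 1) \<and> a n < a (m + 1)"
      if "n < m \<longrightarrow> r n < r m \<and> a n < a m" for m
      using that r_step st(1) by (metis mnum_less_add_one order_less_trans)
  qed (simp add: mnum_not_less_0)
  have n_le: "n \<le> r n" for n
  proof (rule mnum_induct[of "\<lambda>n. n \<le> r n"])
    show "Rec (\<lambda>e. e 0 \<le> r (e 0))" by (intro recs rR)
    show "n + 1 \<le> r (n + 1)" if "n \<le> r n" for n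
      using that r_step[of n] by (simp add: order_le_less_trans)
  qed simp
  \<comment> \<open>The start \<open>\<rho> 0\<close> need not satisfy the conditions of
    \<open>step\<close> and is dropped. The bound n < x makes membership recursive and loses nothing
    because r grows at least like the identity.\<close>
  define R where "R = {x. \<exists>n<x. x = r (n + 1)}"
  have "Rec (\<lambda>e. \<exists>n<e 0. e 0 = r (n + 1))" by (intro recs rR)
  then have "R \<in> MS" unfolding R_def by (rule comprehension)
  have R: "\<exists>n. x = r (n + 1)" if "x \<in> R" for x using that unfolding R_def by blast
  have R_in: "r (n + 1) \<in> R" for n using n_le[of "n + 1"] unfolding R_def by auto
  have order: "n < m" if "r (n + 1) < r (m + 1)" for n m
    using that mono[of "m + 1" "n + 1"] by (metis add_less_cancel_right linorder_neqE order_less_asym)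
  have below: "r (n + 1) \<le> h (a (m + 1))" if "n < m" for n m
  proof -
    have "r (n + 1) \<le> r m" using mono[of "n + 1" m] that by (metis mnum_add_one_le_iff order_le_less)
    then show ?thesis using lt_h by (rule order_trans)
  qed
  have no_partner: "f (r (n + 1)) (r (j + 1)) \<noteq> f (r (m + 1)) (r (j + 1))" if nm: "n < m" "m < j" for n m j
  proof
    assume eq: "f (r (n + 1)) (r (j + 1)) = f (r (m + 1)) (r (j + 1))"
    have nj: "n < j" using nm by (rule order_less_trans)
    let ?k = "pr (r (n + 1)) c"
    have "r (n + 1) \<le> r m" using mono[of "n + 1" m] nm(1) by (metis mnum_add_one_le_iff order_le_less)
    then have k: "?k \<le> pr (r m) c" by (simp add: pr_mono)
    have aa: "a (m + 1) < a (j + 1)" using mono[of "m + 1" "j + 1"] nm(2) by simp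
    have "f (r (n + 1)) (B (a (j + 1)) 0) = f (r (m + 1)) (B (a (j + 1)) 0)"
      using shared_color_in_block[OF below[OF nj] below[OF nm(2)] order_less_imp_le[OF st(2)]] eq rB by simp
    moreover have "r (n + 1) < r (m + 1)" using mono[of "n + 1" "m + 1"] nm(1) by simp
    moreover have "incr (z (m + 1)) (?k + 1)" using incr_mono[OF _ st(5)] k by simp
    ultimately have "wants (a (j + 1)) ?k (z (m + 1))"
      unfolding wants_def using aa st(2)[of m] rB[of "m + 1"] by auto
    moreover have "members (z (m + 1)) (?k + 1) \<subseteq> A"
      using members_mono[of "?k + 1" "pr (r m) c + 1"] st(6)[of m] k by auto
    moreover have "?k < a (j + 1)" using k st(3)[of m] aa by (meson order_le_less_trans order_less_trans)
    moreover have "p2 ?k = c" by simp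
    ultimately show False
      using thin_set_avoids_partners[of "z (m + 1)" ?k A "a (j + 1)" c, OF _ st(4) thin] by blast
  qed
  have rainbow_le: "x = u \<and> y = v"
    if xyuv: "x \<in> R" "y \<in> R" "u \<in> R" "v \<in> R" "x < y" "u < v" "f x y = f u v" "y \<le> v" for x y u v
  proof -
    obtain i j k l where ijkl: "x = r (i + 1)" "y = r (j + 1)" "u = r (k + 1)" "v = r (l + 1)"
      using R[OF xyuv(1)] R[OF xyuv(2)] R[OF xyuv(3)] R[OF xyuv(4)] by blast
    have ij: "i < j" and kl: "k < l" using order xyuv(5,6) ijkl by blast+
    \<comment> \<open>If y < v, then x, y and u all lie below the block that contains v, and
      homogeneity excludes a common color.\<close>
    have "y = v"
    proof (rule ccontr)
      assume "y \<noteq> v"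
      then have "j < l" using order[of j l] xyuv(8) ijkl by simp
      then show False
        using no_shared_color_with_block[OF xyuv(5), of "a (l + 1)" u "z (l + 1)"]
          below[of j l] below[of k l] kl order_less_imp_le[OF st(2)[of l]] xyuv(7) ijkl rB[of "l + 1"] by simp
    qed
    then have "j = l" using ijkl order mono by (metis add_less_cancel_right linorder_neqE order_less_irrefl)
    have "i = k"
      using no_partner[of i k j] no_partner[of k i j] ij kl xyuv(7) \<open>j = l\<close> ijkl by (metis linorder_neqE)
    then show ?thesis using ijkl \<open>y = v\<close> by simp
  qed
  have "x = u \<and> y = v"
    if "x \<in> R" "y \<in> R" "u \<in> R" "v \<in> R" "x < y" "u < v" "f x y = f u v" for x y u v
    using rainbow_le[of x y u v] rainbow_le[of u v x y] that by (metis linorder_linear)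
  moreover have "\<exists>x>n. x \<in> R" for n
    using R_in[of n] n_le[of "n + 1"] by (intro exI[of _ "r (n + 1)"]) simp
  ultimately show ?thesis using \<open>R \<in> MS\<close> by (intro bexI[of _ R] conjI) blast+
qed

end

lemma RRT22_from_TS2:
  assumes TS2: "\<And>g. RecF (\<lambda>e. g (e 0) (e (Suc 0))) \<Longrightarrow>
      \<exists>A\<in>MS. (\<forall>n. \<exists>x>n. x \<in> A) \<and> (\<exists>c. \<forall>x\<in>A. \<forall>y\<in>A. x < y \<longrightarrow> g x y \<noteq> c)"
    and "two_bounded_coloring f"
  shows "\<exists>R\<in>MS. (\<forall>n. \<exists>x>n. x \<in> R) \<and>
    (\<forall>x\<in>R. \<forall>y\<in>R. \<forall>u\<in>R. \<forall>v\<in>R. x < y \<longrightarrow> u < v \<longrightarrow> f x y = f u v \<longrightarrow> x = u \<and> y = v)"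
proof -
  interpret two_bounded_coloring f by fact
  obtain h where h: "RecF (\<lambda>e. h (e 0))" "\<And>a. next_block a (h a) (h (a + 1))"
    by (rule blocks_exist) (rule that)
  interpret coloring_blocks f h by unfold_locales (rule h)+
  have "RecF (\<lambda>e. g (e 0) (e (Suc 0)))" by (intro RecF_g recs)
  from TS2[of g, OF this] obtain A c where "A \<in> MS" "\<forall>n. \<exists>x>n. x \<in> A" "\<forall>x\<in>A. \<forall>y\<in>A. x < y \<longrightarrow> g x y \<noteq> c"
    by blast
  then show ?thesis using rainbow_from_thin_set[of A c] by blast
qed


section \<open>The theorem\<close>

lemma ev_pair: "ev e \<^bold>\<langle>s, t\<^bold>\<rangle> = pr (ev e s) (ev e t)"
  by (simp add: pair_def pr_def)

lemma sat_is_function: "sat MS e s (is_function F) \<longleftrightarrow>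
    (\<forall>p\<in>s F. \<exists>x y z. x < y \<and> p = pr (pr x y) z) \<and>
    (\<forall>x y. x < y \<longrightarrow> (\<exists>z. pr (pr x y) z \<in> s F)) \<and>
    (\<forall>p z w. pr p z \<in> s F \<longrightarrow> pr p w \<in> s F \<longrightarrow> z = w)"
  by (simp add: is_function_def ev_pair eval_nat_numeral) blast

lemma sat_is_infinite: "sat MS e s (is_infinite A) \<longleftrightarrow> (\<forall>n. \<exists>x>n. x \<in> s A)"
  by (simp add: is_infinite_def)

lemma sat_is_thin: "sat MS e s (is_thin F A) \<longleftrightarrow>
    (\<exists>c. \<forall>x\<in>s A. \<forall>y\<in>s A. x < y \<longrightarrow> pr (pr x y) c \<notin> s F)"
  by (simp add: is_thin_def ev_pair eval_nat_numeral) blast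

lemma sat_is_2_bounded: "sat MS e s (is_2_bounded F) \<longleftrightarrow>
    (\<forall>p q r z. pr p z \<in> s F \<longrightarrow> pr q z \<in> s F \<longrightarrow> pr r z \<in> s F \<longrightarrow> p = q \<or> p = r \<or> q = r)"
  by (simp add: is_2_bounded_def ev_pair eval_nat_numeral) blast

lemma sat_is_rainbow: "sat MS e s (is_rainbow F R) \<longleftrightarrow>
    (\<forall>x\<in>s R. \<forall>y\<in>s R. \<forall>u\<in>s R. \<forall>v\<in>s R. \<forall>z. x < y \<longrightarrow> u < v \<longrightarrow>
      pr (pr x y) z \<in> s F \<longrightarrow> pr (pr u v) z \<in> s F \<longrightarrow> x = u \<and> y = v)"
  by (simp add: is_rainbow_def ev_pair eval_nat_numeral) blast

lemma thin_set_in_model: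
  assumes TS2: "sat MS e s TS2" and g: "RecF (\<lambda>e. g (e 0) (e (Suc 0)))"
  shows "\<exists>A\<in>MS. (\<forall>n. \<exists>x>n. x \<in> A) \<and> (\<exists>c. \<forall>x\<in>A. \<forall>y\<in>A. x < y \<longrightarrow> g x y \<noteq> c)"
proof -
  \<comment> \<open>Bounding x and y by the code p makes the graph recursive; by
    \<open>le_pr\<close> no pair is lost.\<close>
  define F where "F = {p. \<exists>x<p + 1. \<exists>y<p + 1. x < y \<and> p = pr (pr x y) (g x y)}"
  have "x < pr (pr x y) z + 1" "y < pr (pr x y) z + 1" for x y z
    using le_pr order_trans by (metis mnum_less_add_one_iff)+
  then have F: "F = {pr (pr x y) (g x y) | x y. x < y}" unfolding F_def by blast
  have "F \<in> MS" unfolding F_def by (rule comprehension) (intro recs RecF_comp2[OF g])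
  moreover have "sat MS e (case_nat F s) (is_function 0)"
    unfolding sat_is_function F by auto
  ultimately have "sat MS e (case_nat F s) (ExS (is_infinite 0 \<^bold>\<and> is_thin 1 0))"
    using TS2 unfolding TS2_def sat.simps(7) sat.simps(5)[of _ _ _ "is_function 0"] by blast
  then obtain A where A: "A \<in> MS"
      "sat MS e (case_nat A (case_nat F s)) (is_infinite 0 \<^bold>\<and> is_thin 1 0)"
    unfolding sat_ExS by blast
  from A(2) have "\<forall>n. \<exists>x>n. x \<in> A"
    and "\<exists>c. \<forall>x\<in>A. \<forall>y\<in>A. x < y \<longrightarrow> pr (pr x y) c \<notin> F"
    by (simp_all add: sat_is_infinite sat_is_thin)
  moreover have "pr (pr x y) (g x y) \<in> F" if "x < y" for x y using that unfolding F by blast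
  ultimately show ?thesis using A(1) by metis
qed

lemma rainbow_in_model:
  assumes TS2: "sat MS e s TS2" and F: "F \<in> MS"
    and func: "sat MS e (case_nat F s) (is_function 0)"
    and bounded: "sat MS e (case_nat F s) (is_2_bounded 0)"
  shows "sat MS e (case_nat F s) (ExS (is_infinite 0 \<^bold>\<and> is_rainbow 1 0))"
proof -
  have F_pair: "\<exists>z. pr (pr x y) z \<in> F" if "x < y" for x y
    using func that unfolding sat_is_function by simp
  have F_unique: "pr p z \<in> F \<Longrightarrow> pr p w \<in> F \<Longrightarrow> z = w" for p z w
    using func unfolding sat_is_function by auto
  have F_bounded: "pr p z \<in> F \<Longrightarrow> pr q z \<in> F \<Longrightarrow> pr r z \<in> F \<Longrightarrow> p = q \<or> p = r \<or> q = r" for p q r z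
    using bounded unfolding sat_is_2_bounded by simp
  \<comment> \<open>For y \<le> x every z qualifies, so f is total, with value 0 there.\<close>
  define f where "f x y = (LEAST z. pr (pr x y) z \<in> F \<or> \<not> x < y)" for x y
  have f_rec: "RecF (\<lambda>e. f (e 0) (e (Suc 0)))"
    unfolding f_def by (rule RecF_Least) (use F_pair in \<open>auto intro!: recs F\<close>)
  have f: "f x y = z \<longleftrightarrow> pr (pr x y) z \<in> F" if xy: "x < y" for x y z
  proof -
    have "Rec (\<lambda>e. pr (pr x y) (e 0) \<in> F \<or> \<not> x < y)" by (intro recs F)
    then have "pr (pr x y) (f x y) \<in> F"
      unfolding f_def using Least_Rec(1)[of "\<lambda>z. pr (pr x y) z \<in> F \<or> \<not> x < y"] F_pair[OF xy] xy by blast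
    then show ?thesis using F_unique by blast
  qed
  have f_bounded: "x = x' \<and> y = y' \<or> x = x'' \<and> y = y'' \<or> x' = x'' \<and> y' = y''"
    if "x < y" "x' < y'" "x'' < y''" "f x y = f x' y'" "f x y = f x'' y''" for x y x' y' x'' y''
    using F_bounded[of "pr x y" "f x y" "pr x' y'" "pr x'' y''"] f that by (metis pr_inject)
  have "two_bounded_coloring f"
    by (rule two_bounded_coloring.intro, rule f_rec, rule f_bounded)
  with thin_set_in_model[OF TS2] have "\<exists>R\<in>MS. (\<forall>n. \<exists>x>n. x \<in> R) \<and>
      (\<forall>x\<in>R. \<forall>y\<in>R. \<forall>u\<in>R. \<forall>v\<in>R. x < y \<longrightarrow> u < v \<longrightarrow> f x y = f u v \<longrightarrow> x = u \<and> y = v)"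
    by (rule RRT22_from_TS2)
  then obtain R where R: "R \<in> MS" "\<forall>n. \<exists>x>n. x \<in> R"
      "\<forall>x\<in>R. \<forall>y\<in>R. \<forall>u\<in>R. \<forall>v\<in>R. x < y \<longrightarrow> u < v \<longrightarrow> f x y = f u v \<longrightarrow> x = u \<and> y = v"
    by blast
  have "\<forall>x\<in>R. \<forall>y\<in>R. \<forall>u\<in>R. \<forall>v\<in>R. \<forall>z. x < y \<longrightarrow> u < v \<longrightarrow>
      pr (pr x y) z \<in> F \<longrightarrow> pr (pr u v) z \<in> F \<longrightarrow> x = u \<and> y = v"
    using R(3) f by metis
  then have "sat MS e (case_nat R (case_nat F s)) (is_infinite 0 \<^bold>\<and> is_rainbow 1 0)"
    using R(2) by (simp add: sat_is_infinite sat_is_rainbow)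
  then show ?thesis unfolding sat_ExS using R(1) by blast
qed

theorem corollary4p9: "RCA0 \<turnstile> TS2 \<^bold>\<longrightarrow> RRT22"
proof (rule provable_if_true_in_model)
  show "sat MS (\<lambda>n. abs_mnum (V n)) set_of (TS2 \<^bold>\<longrightarrow> RRT22)"
    unfolding RRT22_def sat.simps(5,7) using rainbow_in_model by simp
qed

end
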